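(* Every countable scattered linear order $L$ with Hausdorff rank $r(L)=\alpha$ has a $\Pi_{2\alpha+2}$ Scott sentence.
   Context: Infinitary formulas of $L_{\omega_1\omega}$: $\Sigma_0=\Pi_0$ are finitary quantifier-free formulas; for $\alpha>0$, $\Sigma_\alpha$ formulas are countable disjunctions $\bigvee_i\exists\bar x\,\varphi_i$ with $\varphi_i$ $\Pi_\beta$, $\beta<\alpha$; $\Pi_\alpha$ formulas are countable conjunctions $\bigwedge_i\forall\bar x\,\varphi_i$ with $\varphi_i$ $\Sigma_\beta$, $\beta<\alpha$. A Scott sentence of a countable structure $\mathcal A$ is an $L_{\omega_1\omega}$ sentence true in exactly the countable structures isomorphic to $\mathcal A$. Hausdorff rank: $HR_0$ = finite linear orders (including empty); for $\alpha>0$, $HR_\alpha$ is the least class containing all $\sum_{i\in\zeta}L_i$ with $L_i\in\bigcup_{\beta<\alpha}HR_\beta$ and closed under finite sums; $r(L)$ = least $\alpha$ with $L\in HR_\alpha$. *)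

theory Defs
  imports "HOL-Library.Countable_Set_Type"
begin

section \<open>Countable ordinals\<close>

text \<open>
  The countable ordinals, i.e. the elements of \<open>\<omega>\<^sub>1\<close>, are the elements of the successor cardinal
  of \<open>\<aleph>\<^sub>0\<close>; the lemmas \<open>countable_lessThan_ord1\<close> and \<open>countable_bounded_ord1\<close> below pin down the
  order type. All Hausdorff ranks and all complexities of formulas of \<open>L\<^bsub>\<omega>\<^sub>1\<omega>\<^esub>\<close> are countable ordinals.
\<close>

typedef ord1 = "Field (cardSuc natLeq)"
  using Field_cardSuc_not_empty[OF natLeq_Card_order] by blast

lemma wo_cardSuc_natLeq: "Well_order (cardSuc natLeq)"
  using cardSuc_Well_order natLeq_Card_order by blast

instantiation ord1 :: wellorder
begin

definition less_eq_ord1 :: "ord1 \<Rightarrow> ord1 \<Rightarrow> bool" where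
  "\<alpha> \<le> \<beta> \<longleftrightarrow> (Rep_ord1 \<alpha>, Rep_ord1 \<beta>) \<in> cardSuc natLeq"

definition less_ord1 :: "ord1 \<Rightarrow> ord1 \<Rightarrow> bool" where
  "\<alpha> < \<beta> \<longleftrightarrow> \<alpha> \<le> \<beta> \<and> \<not> \<beta> \<le> (\<alpha> :: ord1)"

instance
proof -
  let ?r = "cardSuc natLeq"
  have lin: "Linear_order ?r" and wf: "wf (?r - Id)"
    using wo_cardSuc_natLeq by (auto simp: well_order_on_def)
  have refl: "(Rep_ord1 x, Rep_ord1 x) \<in> ?r" for x
    using lin Rep_ord1[of x] by (auto simp: order_on_defs refl_on_def)
  have antisym: "x = y" if "x \<le> y" "y \<le> x" for x y :: ord1
    using lin that unfolding less_eq_ord1_def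
    by (metis Rep_ord1_inject antisymD linear_order_on_def partial_order_on_def)
  show "OFCLASS(ord1, wellorder_class)"
  proof
    fix x y z :: ord1
    show "x < y \<longleftrightarrow> x \<le> y \<and> \<not> y \<le> x" by (simp add: less_ord1_def)
    show "x \<le> x" using refl by (simp add: less_eq_ord1_def)
    show "x \<le> y \<Longrightarrow> y \<le> z \<Longrightarrow> x \<le> z"
      using lin unfolding less_eq_ord1_def by (meson order_on_defs transD)
    show "x \<le> y \<Longrightarrow> y \<le> x \<Longrightarrow> x = y" by (rule antisym)
    show "x \<le> y \<or> y \<le> x"
      using lin refl Rep_ord1[of x] Rep_ord1[of y] unfolding less_eq_ord1_def
      by (metis linear_order_on_def total_on_def)
  next
    fix P :: "ord1 \<Rightarrow> bool" and a :: ord1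
    assume step: "\<And>x. (\<And>y. y < x \<Longrightarrow> P y) \<Longrightarrow> P x"
    have "wf (inv_image (?r - Id) Rep_ord1)" using wf by simp
    then show "P a"
    proof (induction a rule: wf_induct_rule)
      case (less x)
      show ?case
      proof (rule step)
        fix y assume "y < x"
        then have "y \<noteq> x" "(Rep_ord1 y, Rep_ord1 x) \<in> ?r"
          by (auto simp: less_ord1_def less_eq_ord1_def)
        then show "P y" using less by (auto simp: Rep_ord1_inject)
      qed
    qed
  qed
qed

end

lemma countable_lessThan_ord1:
  includes cardinal_syntax
  shows "countable {..<\<beta> :: ord1}"
proof -
  let ?r = "cardSuc natLeq"
  have "Card_order ?r" using cardSuc_Card_order natLeq_Card_order by blast
  then have "|underS ?r (Rep_ord1 \<beta>)| <o ?r"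
    using Rep_ord1 by (rule card_of_underS)
  then have "|underS ?r (Rep_ord1 \<beta>)| \<le>o natLeq"
    using cardSuc_ordLess_ordLeq[OF natLeq_Card_order card_of_Card_order]
      cardSuc_ordLeq_ordLess[OF natLeq_Card_order card_of_Card_order] by blast
  then have c: "countable (underS ?r (Rep_ord1 \<beta>))"
    by (simp add: countable_card_le_natLeq)
  have "Rep_ord1 ` {..<\<beta>} \<subseteq> underS ?r (Rep_ord1 \<beta>)"
    by (auto simp: underS_def less_eq_ord1_def less_le Rep_ord1_inject)
  then have "countable (Rep_ord1 ` {..<\<beta>})" using c countable_subset by blast
  then show ?thesis
    by (rule countable_image_inj_on) (simp add: inj_on_def Rep_ord1_inject)
qed

lemma countable_bounded_ord1:
  includes cardinal_syntax
  assumes "countable (X :: ord1 set)"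
  shows "\<exists>\<gamma>. \<forall>\<xi>\<in>X. \<xi> < \<gamma>"
proof (rule ccontr)
  assume "\<not> ?thesis"
  then have "\<forall>\<gamma>. \<exists>\<xi>\<in>X. \<gamma> \<le> \<xi>" by (meson not_le)
  then have "(UNIV :: ord1 set) = (\<Union>\<xi>\<in>X. insert \<xi> {..<\<xi>})"
    by (auto simp: le_less)
  moreover have "countable (\<Union>\<xi>\<in>X. insert \<xi> {..<\<xi>})"
    using assms countable_lessThan_ord1 by blast
  ultimately have "countable (UNIV :: ord1 set)" by simp
  then have "countable (Rep_ord1 ` UNIV)" by blast
  moreover have "Rep_ord1 ` UNIV = Field (cardSuc natLeq)"
    using Rep_ord1 Abs_ord1_inverse by (metis type_definition.Rep_range type_definition_ord1)
  ultimately have "|Field (cardSuc natLeq)| \<le>o natLeq"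
    by (simp add: countable_card_le_natLeq)
  moreover have "natLeq <o |Field (cardSuc natLeq)|"
    using cardSuc_greater[OF natLeq_Card_order] cardSuc_Card_order[OF natLeq_Card_order]
    by (meson card_of_Field_ordIso ordIso_symmetric ordLess_ordIso_trans)
  ultimately show False using not_ordLess_ordLeq by blast
qed

lemma Least_ord1:
  assumes "countable X" "\<And>\<gamma>. (\<forall>\<xi>\<in>X. \<xi> < \<gamma>) \<Longrightarrow> P \<gamma>"
  shows "P (LEAST \<gamma> :: ord1. P \<gamma>)"
  using countable_bounded_ord1[OF assms(1)] assms(2) LeastI by metis

text \<open>
  Ordinal arithmetic by transfinite recursion on the right argument:
  \<open>\<alpha> + \<beta> = max \<alpha> (sup {\<alpha> + \<delta> + 1 | \<delta> < \<beta>})\<close> and \<open>\<alpha> * \<beta> = sup {\<alpha> * \<delta> + \<alpha> | \<delta> < \<beta>}\<close>.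
  So \<open>2 * \<alpha>\<close> is \<open>\<alpha>\<close> copies of \<open>2\<close> in a row; in particular \<open>2 * \<alpha> = \<alpha>\<close> for limit \<open>\<alpha>\<close>.
\<close>

instantiation ord1 :: "{zero, one, plus}"
begin

definition zero_ord1 :: ord1 where
  "0 = (LEAST \<gamma> :: ord1. True)"

definition one_ord1 :: ord1 where
  "1 = (LEAST \<gamma> :: ord1. 0 < \<gamma>)"

function plus_ord1 :: "ord1 \<Rightarrow> ord1 \<Rightarrow> ord1" where
  "plus_ord1 \<alpha> \<beta> = (LEAST \<gamma>. \<alpha> \<le> \<gamma> \<and> (\<forall>\<delta>\<in>{..<\<beta>}. plus_ord1 \<alpha> \<delta> < \<gamma>))"
  by auto
termination
proof (relation "inv_image {(\<delta>, \<beta>). \<delta> < \<beta>} snd")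
  show "wf (inv_image {(\<delta>, \<beta>). \<delta> < \<beta>} (snd :: ord1 \<times> ord1 \<Rightarrow> ord1))"
    by (intro wf_inv_image wf)
qed simp

instance ..

end

declare plus_ord1.simps[simp del]

instantiation ord1 :: times
begin

function times_ord1 :: "ord1 \<Rightarrow> ord1 \<Rightarrow> ord1" where
  "times_ord1 \<alpha> \<beta> = (LEAST \<gamma>. \<forall>\<delta>\<in>{..<\<beta>}. times_ord1 \<alpha> \<delta> + \<alpha> \<le> \<gamma>)"
  by auto
termination
proof (relation "inv_image {(\<delta>, \<beta>). \<delta> < \<beta>} snd")
  show "wf (inv_image {(\<delta>, \<beta>). \<delta> < \<beta>} (snd :: ord1 \<times> ord1 \<Rightarrow> ord1))"
    by (intro wf_inv_image wf)
qed simp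

instance ..

end

declare times_ord1.simps[simp del]

lemma zero_le_ord1: "0 \<le> (\<alpha> :: ord1)"
  unfolding zero_ord1_def by (rule Least_le) simp

lemma not_less_zero_ord1: "\<not> \<alpha> < (0 :: ord1)"
  using zero_le_ord1[of \<alpha>] by (rule leD)

lemma plus_le_iff_ord1: "\<alpha> + \<beta> \<le> \<gamma> \<longleftrightarrow> \<alpha> \<le> \<gamma> \<and> (\<forall>\<delta><\<beta>. \<alpha> + \<delta> < (\<gamma> :: ord1))"
proof -
  let ?P = "\<lambda>\<gamma>. \<alpha> \<le> \<gamma> \<and> (\<forall>\<delta>\<in>{..<\<beta>}. \<alpha> + \<delta> < \<gamma>)"
  have "?P (\<alpha> + \<beta>)"
    unfolding plus_ord1.simps[of \<alpha> \<beta>]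
    by (rule Least_ord1[of "insert \<alpha> ((+) \<alpha> ` {..<\<beta>})"]) (auto simp: countable_lessThan_ord1)
  moreover have "?P \<gamma> \<Longrightarrow> \<alpha> + \<beta> \<le> \<gamma>"
    unfolding plus_ord1.simps[of \<alpha> \<beta>] by (rule Least_le)
  ultimately show ?thesis by (auto intro: less_le_trans order_trans)
qed

lemma times_le_iff_ord1: "\<alpha> * \<beta> \<le> \<gamma> \<longleftrightarrow> (\<forall>\<delta><\<beta>. \<alpha> * \<delta> + \<alpha> \<le> (\<gamma> :: ord1))"
proof -
  let ?P = "\<lambda>\<gamma>. \<forall>\<delta>\<in>{..<\<beta>}. \<alpha> * \<delta> + \<alpha> \<le> \<gamma>"
  have "?P (\<alpha> * \<beta>)"
    unfolding times_ord1.simps[of \<alpha> \<beta>]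
    by (rule Least_ord1[of "(\<lambda>\<delta>. \<alpha> * \<delta> + \<alpha>) ` {..<\<beta>}"])
      (auto simp: countable_lessThan_ord1 intro: less_imp_le)
  moreover have "?P \<gamma> \<Longrightarrow> \<alpha> * \<beta> \<le> \<gamma>"
    unfolding times_ord1.simps[of \<alpha> \<beta>] by (rule Least_le)
  ultimately show ?thesis by (auto intro: order_trans)
qed

instance ord1 :: semigroup_add
proof
  fix a b c :: ord1
  have mono: "x + y < x + z" if "y < z" for x y z :: ord1
    using plus_le_iff_ord1[of x z "x + z"] that by auto
  show "a + b + c = a + (b + c)"
  proof (induction c rule: less_induct)
    case (less c)
    have "a + b + c \<le> \<gamma> \<longleftrightarrow> a + (b + c) \<le> \<gamma>" for \<gamma>
    proof
      assume L: "a + b + c \<le> \<gamma>"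
      have ab: "a + b \<le> \<gamma>" and abc: "\<And>\<epsilon>. \<epsilon> < c \<Longrightarrow> a + (b + \<epsilon>) < \<gamma>"
        using L less plus_le_iff_ord1[of "a + b" c \<gamma>] by auto
      have "a + \<delta> < \<gamma>" if \<delta>: "\<delta> < b + c" for \<delta>
      proof (cases "\<delta> < b")
        case True
        then show ?thesis using ab plus_le_iff_ord1 by blast
      next
        case False
        then obtain \<epsilon> where "\<epsilon> < c" "\<delta> \<le> b + \<epsilon>"
          using \<delta> plus_le_iff_ord1[of b c \<delta>] by (auto simp flip: not_le)
        then show ?thesis by (metis abc le_less less_trans mono)
      qed
      then show "a + (b + c) \<le> \<gamma>" using ab plus_le_iff_ord1 by blast
    next
      assume R: "a + (b + c) \<le> \<gamma>"
      have "b \<le> b + c" using plus_le_iff_ord1[of b c "b + c"] by simp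
      then have "a + b \<le> a + (b + c)" by (metis le_less mono)
      moreover have "a + b + \<epsilon> < \<gamma>" if "\<epsilon> < c" for \<epsilon>
        using less[OF that] mono[OF mono[OF that, of b], of a] R by simp
      ultimately show "a + b + c \<le> \<gamma>" using R plus_le_iff_ord1[of "a + b" c \<gamma>] by auto
    qed
    then show ?case by (meson order.antisym order.refl)
  qed
qed

instance ord1 :: numeral ..

lemma zero_less_one_ord1: "0 < (1 :: ord1)"
  unfolding one_ord1_def by (rule Least_ord1[of "{0}" "\<lambda>\<gamma>. 0 < \<gamma>"]) auto

lemma plus_zero_ord1: "\<beta> + 0 = (\<beta> :: ord1)"
proof (rule order.antisym)
  show "\<beta> + 0 \<le> \<beta>" by (simp add: plus_le_iff_ord1 not_less_zero_ord1)
  show "\<beta> \<le> \<beta> + 0" using plus_le_iff_ord1[of \<beta> 0 "\<beta> + 0"] by blast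
qed

lemma less_one_iff_ord1: "\<epsilon> < 1 \<longleftrightarrow> \<epsilon> = (0 :: ord1)"
proof
  assume "\<epsilon> < 1"
  then have "\<not> 0 < \<epsilon>" unfolding one_ord1_def by (rule not_less_Least)
  then show "\<epsilon> = 0" using zero_le_ord1[of \<epsilon>] by (simp add: le_less)
qed (simp add: zero_less_one_ord1)

lemma less_plus_one_iff_ord1: "\<delta> < \<beta> + 1 \<longleftrightarrow> \<delta> \<le> (\<beta> :: ord1)"
proof -
  have "\<beta> + 1 \<le> \<delta> \<longleftrightarrow> \<beta> < \<delta>"
    unfolding plus_le_iff_ord1[of \<beta> 1 \<delta>] less_one_iff_ord1
    by (auto simp: plus_zero_ord1)
  then show ?thesis using not_le by blast
qed

lemma times_zero_ord1: "\<alpha> * 0 = (0 :: ord1)"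
  using times_le_iff_ord1[of \<alpha> 0 0] zero_le_ord1[of "\<alpha> * 0"] not_less_zero_ord1
  by (auto intro: order.antisym)

lemma times_plus_one_ord1: "\<alpha> * (\<beta> + 1) = \<alpha> * \<beta> + (\<alpha> :: ord1)"
proof (rule order.antisym)
  have "\<alpha> * \<delta> \<le> \<alpha> * \<beta>" if "\<delta> \<le> \<beta>" for \<delta>
    using that times_le_iff_ord1[of \<alpha> \<beta> "\<alpha> * \<beta>"] times_le_iff_ord1[of \<alpha> \<delta> "\<alpha> * \<beta>"] by auto
  moreover have "\<xi> + \<alpha> \<le> \<eta> + \<alpha>" if "\<xi> \<le> \<eta>" for \<xi> \<eta> :: ord1
  proof -
    have "\<xi> + \<epsilon> \<le> \<eta> + \<epsilon>" for \<epsilon>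
    proof (induction \<epsilon> rule: less_induct)
      case (less \<epsilon>)
      then show ?case
        using that plus_le_iff_ord1[of \<eta> \<epsilon> "\<eta> + \<epsilon>"] plus_le_iff_ord1[of \<xi> \<epsilon> "\<eta> + \<epsilon>"]
        by (auto intro: order_trans le_less_trans)
    qed
    then show ?thesis .
  qed
  ultimately show "\<alpha> * (\<beta> + 1) \<le> \<alpha> * \<beta> + \<alpha>"
    by (simp add: times_le_iff_ord1[of \<alpha> "\<beta> + 1"] less_plus_one_iff_ord1)
  show "\<alpha> * \<beta> + \<alpha> \<le> \<alpha> * (\<beta> + 1)"
    using times_le_iff_ord1[of \<alpha> "\<beta> + 1" "\<alpha> * (\<beta> + 1)"] less_plus_one_iff_ord1 by auto
qed


section \<open>Structures and linear orders\<close>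

text \<open>
  The language has one binary relation symbol, interpreted as the reflexive order in a linear
  order. A structure is a pair of a carrier, possibly empty, and a relation on it.
\<close>

type_synonym 'a struct = "'a set \<times> 'a rel"

definition is_struct :: "'a struct \<Rightarrow> bool" where
  "is_struct M \<longleftrightarrow> snd M \<subseteq> fst M \<times> fst M"

definition lin_order :: "'a struct \<Rightarrow> bool" where
  "lin_order L \<longleftrightarrow> linear_order_on (fst L) (snd L)"

definition isomorphic :: "'a struct \<Rightarrow> 'b struct \<Rightarrow> bool" where
  "isomorphic M N \<longleftrightarrow> (\<exists>f. bij_betw f (fst M) (fst N) \<and>
     (\<forall>x\<in>fst M. \<forall>y\<in>fst M. (x, y) \<in> snd M \<longleftrightarrow> (f x, f y) \<in> snd N))"

definition scattered :: "'a struct \<Rightarrow> bool" where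
  "scattered L \<longleftrightarrow> \<not> (\<exists>f :: rat \<Rightarrow> 'a. (\<forall>p. f p \<in> fst L) \<and> (\<forall>p q. p \<le> q \<longleftrightarrow> (f p, f q) \<in> snd L))"

definition sum_order :: "'i :: linorder set \<Rightarrow> ('i \<Rightarrow> 'a struct) \<Rightarrow> ('i \<times> 'a) struct" where
  "sum_order I L =
     (Sigma I (\<lambda>i. fst (L i)),
      {((i, x), (j, y)). i \<in> I \<and> j \<in> I \<and> x \<in> fst (L i) \<and> y \<in> fst (L j) \<and>
         (i < j \<or> i = j \<and> (x, y) \<in> snd (L i))})"


section \<open>Hausdorff rank\<close>

text \<open>
  \<open>HR \<alpha>\<close> is the class \<open>HR\<^sub>\<alpha>\<close>, restricted to orders on sets of elements of a type \<open>'a\<close>. All summands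
  are taken over the same type \<open>'a\<close>, which is no restriction, as every summand embeds into the sum.
  The index set \<open>\<zeta>\<close> is \<open>UNIV :: int set\<close>.
\<close>

inductive HR :: "ord1 \<Rightarrow> 'a struct \<Rightarrow> bool" where
  finite: "lin_order L \<Longrightarrow> finite (fst L) \<Longrightarrow> HR 0 L"
| zeta_sum: "0 < \<alpha> \<Longrightarrow> (\<And>i :: int. \<exists>\<beta><\<alpha>. HR \<beta> (L i)) \<Longrightarrow>
    lin_order K \<Longrightarrow> isomorphic K (sum_order UNIV L) \<Longrightarrow> HR \<alpha> K"
| finite_sum: "0 < \<alpha> \<Longrightarrow> (\<And>i :: nat. i < n \<Longrightarrow> HR \<alpha> (L i)) \<Longrightarrow>
    lin_order K \<Longrightarrow> isomorphic K (sum_order {..<n} L) \<Longrightarrow> HR \<alpha> K"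

text \<open>\<open>has_hausdorff_rank L \<alpha>\<close> is \<open>r(L) = \<alpha>\<close>; the function \<open>r\<close> is partial.\<close>

definition has_hausdorff_rank :: "'a struct \<Rightarrow> ord1 \<Rightarrow> bool" where
  "has_hausdorff_rank L \<alpha> \<longleftrightarrow> HR \<alpha> L \<and> (\<forall>\<beta><\<alpha>. \<not> HR \<beta> L)"


section \<open>Infinitary formulas\<close>

text \<open>
  Variables are natural numbers. \<open>Conj I F\<close> and \<open>Disj I F\<close> are the conjunction and disjunction of
  the countable family \<open>(F i)\<^sub>i\<close> with \<open>i \<in> I\<close>; \<open>F\<close> is irrelevant outside \<open>I\<close>.
\<close>

datatype form =
    Eq nat nat
  | Le nat nat
  | Neg form
  | Conj "nat set" "nat \<Rightarrow> form"
  | Disj "nat set" "nat \<Rightarrow> form"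
  | All nat form
  | Ex nat form

primrec free_vars :: "form \<Rightarrow> nat set" where
  "free_vars (Eq m n) = {m, n}"
| "free_vars (Le m n) = {m, n}"
| "free_vars (Neg \<phi>) = free_vars \<phi>"
| "free_vars (Conj I F) = (\<Union>i\<in>I. free_vars (F i))"
| "free_vars (Disj I F) = (\<Union>i\<in>I. free_vars (F i))"
| "free_vars (All n \<phi>) = free_vars \<phi> - {n}"
| "free_vars (Ex n \<phi>) = free_vars \<phi> - {n}"

primrec sat :: "'a struct \<Rightarrow> (nat \<Rightarrow> 'a) \<Rightarrow> form \<Rightarrow> bool" where
  "sat M v (Eq m n) \<longleftrightarrow> v m = v n"
| "sat M v (Le m n) \<longleftrightarrow> (v m, v n) \<in> snd M"
| "sat M v (Neg \<phi>) \<longleftrightarrow> \<not> sat M v \<phi>"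
| "sat M v (Conj I F) \<longleftrightarrow> (\<forall>i\<in>I. sat M v (F i))"
| "sat M v (Disj I F) \<longleftrightarrow> (\<exists>i\<in>I. sat M v (F i))"
| "sat M v (All n \<phi>) \<longleftrightarrow> (\<forall>a\<in>fst M. sat M (v(n := a)) \<phi>)"
| "sat M v (Ex n \<phi>) \<longleftrightarrow> (\<exists>a\<in>fst M. sat M (v(n := a)) \<phi>)"

definition sentence :: "form \<Rightarrow> bool" where
  "sentence \<phi> \<longleftrightarrow> free_vars \<phi> = {}"

text \<open>
  The assignment is not required to take values in the carrier, which may be empty; the truth value
  of a sentence does not depend on it.
\<close>

definition models :: "'a struct \<Rightarrow> form \<Rightarrow> bool" where
  "models M \<phi> \<longleftrightarrow> (\<forall>v. sat M v \<phi>)"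

inductive finitary_qf :: "form \<Rightarrow> bool" where
  "finitary_qf (Eq m n)"
| "finitary_qf (Le m n)"
| "finitary_qf \<phi> \<Longrightarrow> finitary_qf (Neg \<phi>)"
| "finite I \<Longrightarrow> (\<And>i. i \<in> I \<Longrightarrow> finitary_qf (F i)) \<Longrightarrow> finitary_qf (Conj I F)"
| "finite I \<Longrightarrow> (\<And>i. i \<in> I \<Longrightarrow> finitary_qf (F i)) \<Longrightarrow> finitary_qf (Disj I F)"

text \<open>
  The lists \<open>xs\<close> below are the quantified tuples of variables, possibly empty and possibly of
  different lengths for different \<open>i\<close>.
\<close>

inductive is_Sigma :: "ord1 \<Rightarrow> form \<Rightarrow> bool" and is_Pi :: "ord1 \<Rightarrow> form \<Rightarrow> bool" where
  Sigma_zero: "finitary_qf \<phi> \<Longrightarrow> is_Sigma 0 \<phi>"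
| Pi_zero: "finitary_qf \<phi> \<Longrightarrow> is_Pi 0 \<phi>"
| Sigma_pos: "0 < \<alpha> \<Longrightarrow> (\<And>i. i \<in> I \<Longrightarrow> \<exists>xs \<psi>. F i = foldr Ex xs \<psi> \<and> (\<exists>\<beta><\<alpha>. is_Pi \<beta> \<psi>)) \<Longrightarrow>
    is_Sigma \<alpha> (Disj I F)"
| Pi_pos: "0 < \<alpha> \<Longrightarrow> (\<And>i. i \<in> I \<Longrightarrow> \<exists>xs \<psi>. F i = foldr All xs \<psi> \<and> (\<exists>\<beta><\<alpha>. is_Sigma \<beta> \<psi>)) \<Longrightarrow>
    is_Pi \<alpha> (Conj I F)"

text \<open>
  Countable structures are represented by the structures whose carrier is a set of natural numbers:
  every countable structure is isomorphic to one of these, and truth of sentences is invariant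
  under isomorphism.
\<close>

definition is_scott_sentence :: "form \<Rightarrow> 'a struct \<Rightarrow> bool" where
  "is_scott_sentence \<phi> M \<longleftrightarrow> sentence \<phi> \<and>
     (\<forall>N :: nat struct. is_struct N \<longrightarrow> (models N \<phi> \<longleftrightarrow> isomorphic M N))"

end

theory Submission
  imports Defs
begin

text \<open>
  Let \<open>E\<^sub>0\<close> be equality and let \<open>x E\<^sub>\<alpha> y\<close> hold if, for some \<open>\<beta> < \<alpha>\<close>, the interval between \<open>x\<close> and \<open>y\<close> meets only
  finitely many \<open>E\<^sub>\<beta>\<close>-classes. These are convex equivalence relations, \<open>E\<^sub>\<alpha>\<close> is \<open>\<Sigma>\<^bsub>2\<alpha>\<^esub>\<close>-definable, and an order
  in \<open>HR\<^sub>\<alpha>\<close> has only finitely many \<open>E\<^sub>\<alpha>\<close>-classes; no more than this is used about the order.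

  The part of the \<open>E\<^sub>\<alpha>\<close>-class of \<open>x\<close> above \<open>x\<close> is the ordered sum, over \<open>\<beta> < \<alpha>\<close> and \<open>k \<ge> 1\<close>, of the sets of the
  \<open>y\<close> for which \<open>[x, y]\<close> meets exactly \<open>k + 1\<close> classes of \<open>E\<^sub>\<beta>\<close>, and each of them is empty or an \<open>E\<^sub>\<beta>\<close>-class.
  So its isomorphism type is determined by those of its summands. By induction the isomorphism type of an upper part is
  \<open>\<Pi>\<^bsub>2\<alpha>+1\<^esub>\<close>-definable from \<open>x\<close>, and that of an \<open>E\<^sub>\<beta>\<close>-class is \<open>\<Sigma>\<^bsub>2\<beta>+2\<^esub>\<close>.

  For the Scott sentence, number the \<open>E\<^sub>\<alpha>\<close>-classes from the left. It suffices to find, for the \<open>i\<close>-th class,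
  a \<open>\<Pi>\<^bsub>2\<alpha>\<^esub>\<close> condition \<open>p\<close> with a solution in that class such that every solution in it has the right upper
  and lower parts: then "there is a solution, and every solution has the right upper and lower parts" is
  \<open>\<Pi>\<^bsub>2\<alpha>+2\<^esub>\<close>. Summands with \<open>\<beta> + 1 < \<alpha>\<close> can be described by \<open>p\<close> outright. If \<open>\<alpha> = \<beta> + 1\<close>, then \<open>p\<close> can exclude the types
  of \<open>E\<^sub>\<beta>\<close>-classes of \<open>L\<close> which are wrong at the \<open>k\<close>-th place, so that a summand is right or empty; a solution in the
  last or in the first \<open>E\<^sub>\<beta>\<close>-class, if there is one, removes the second alternative.
\<close>

section \<open>Definable predicates\<close>

lemma less_succ_ord1: "(\<beta> :: ord1) < \<beta> + 1"
  by (simp add: less_plus_one_iff_ord1)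

lemma plus_two_ord1: "(\<beta> :: ord1) + 2 = \<beta> + 1 + 1"
  by (metis add.assoc numeral_Bit0 numeral_One)

lemma double_succ_le_ord1: "\<beta> < \<alpha> \<Longrightarrow> 2 * \<beta> + 1 + 1 \<le> (2 * \<alpha> :: ord1)"
  using times_le_iff_ord1[of 2 \<alpha> "2 * \<alpha>"] by (simp add: plus_two_ord1)

text \<open>Strictness comes from 2\<beta> + 2 = 2(\<beta> + 1) and the preceding bound at \<beta> +
  1. It allows a \<Sigma> condition of level 2\<beta>+2 inside a \<Pi> condition of level 2\<alpha>;
  for \<alpha> = \<beta> + 1 there is no such room.\<close>

lemma double_succ_less_ord1: "\<beta> + 1 < \<alpha> \<Longrightarrow> 2 * \<beta> + 1 + 1 < (2 * \<alpha> :: ord1)"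
  using double_succ_le_ord1[of "\<beta> + 1" \<alpha>] times_plus_one_ord1[of 2 \<beta>] less_succ_ord1
  by (metis (no_types) less_le_trans order.strict_trans plus_two_ord1)

lemma pos_succ_ord1: "0 < (\<beta> :: ord1) + 1"
  using less_succ_ord1 zero_le_ord1 by (metis le_less_trans)

type_synonym predicate = "nat struct \<Rightarrow> (nat \<Rightarrow> nat) \<Rightarrow> bool"

definition valid :: "nat \<Rightarrow> nat struct \<Rightarrow> (nat \<Rightarrow> nat) \<Rightarrow> bool" where
  "valid n N v \<longleftrightarrow> lin_order N \<and> (\<forall>i<n. v i \<in> fst N)"

text \<open>A block of \<open>k\<close> quantifiers: the new variables occupy the \<open>k\<close>
  positions from \<open>n\<close> on, and the values of \<open>w\<close> beyond them are
  arbitrary.\<close>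

definition extends :: "nat \<Rightarrow> nat \<Rightarrow> nat struct \<Rightarrow> (nat \<Rightarrow> nat) \<Rightarrow> (nat \<Rightarrow> nat) \<Rightarrow> bool" where
  "extends n k N v w \<longleftrightarrow> (\<forall>i<n. w i = v i) \<and> (\<forall>i. n \<le> i \<and> i < n + k \<longrightarrow> w i \<in> fst N)"

lemma extends_0: "extends n 0 N v w \<longleftrightarrow> (\<forall>i<n. w i = v i)"
  by (auto simp: extends_def)

inductive Qf :: "nat \<Rightarrow> predicate \<Rightarrow> bool" where
  eq: "i < n \<Longrightarrow> j < n \<Longrightarrow> Qf n (\<lambda>N v. v i = v j)"
| le: "i < n \<Longrightarrow> j < n \<Longrightarrow> Qf n (\<lambda>N v. (v i, v j) \<in> snd N)"
| neg: "Qf n P \<Longrightarrow> Qf n (\<lambda>N v. \<not> P N v)"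
| conj: "Qf n P \<Longrightarrow> Qf n Q \<Longrightarrow> Qf n (\<lambda>N v. P N v \<and> Q N v)"
| true: "Qf n (\<lambda>N v. True)"

text \<open>
  \<open>Sg \<alpha> n P\<close> says that on linear orders the \<open>n\<close>-ary predicate \<open>P\<close> is \<open>\<Sigma>\<^sub>\<alpha>\<close>-definable. Closing this
  class under the connectives needs no care about bound variables; \<open>\<Pi>\<^sub>\<alpha>\<close>-definability is \<open>Sg\<close> of the
  negation.
\<close>

inductive Sg :: "ord1 \<Rightarrow> nat \<Rightarrow> predicate \<Rightarrow> bool" where
  zero: "Qf n Q \<Longrightarrow> (\<And>N v. valid n N v \<Longrightarrow> P N v \<longleftrightarrow> Q N v) \<Longrightarrow> Sg 0 n P"
| pos: "0 < \<alpha> \<Longrightarrow> countable S \<Longrightarrow>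
    (\<And>k Q. (k, Q) \<in> S \<Longrightarrow> \<exists>\<beta><\<alpha>. Sg \<beta> (n + k) (\<lambda>N w. \<not> Q N w)) \<Longrightarrow>
    (\<And>N v. valid n N v \<Longrightarrow> P N v \<longleftrightarrow> (\<exists>(k, Q)\<in>S. \<exists>w. extends n k N v w \<and> Q N w)) \<Longrightarrow> Sg \<alpha> n P"

abbreviation Pi :: "ord1 \<Rightarrow> nat \<Rightarrow> predicate \<Rightarrow> bool" where
  "Pi \<alpha> n P \<equiv> Sg \<alpha> n (\<lambda>N v. \<not> P N v)"

section \<open>Closure properties of definable predicates\<close>

lemma Sg_cong:
  assumes "Sg \<alpha> n P" "\<And>N v. valid n N v \<Longrightarrow> P' N v \<longleftrightarrow> P N v"
  shows "Sg \<alpha> n P'"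
  using assms(1)
proof cases
  case (zero Q)
  have "Sg 0 n P'" by (rule Sg.zero[OF zero(2)]) (use zero(3) assms(2) in blast)
  then show ?thesis using zero(1) by simp
next
  case (pos S)
  show ?thesis by (rule Sg.pos[OF pos(1,2) pos(3)]) (simp_all only: pos(4) assms(2))
qed

lemma Qf_local: "Qf n P \<Longrightarrow> \<forall>i<n. v i = v' i \<Longrightarrow> P N v \<longleftrightarrow> P N v'"
  by (induction rule: Qf.induct) auto

lemma valid_local: "\<forall>i<n. v i = v' i \<Longrightarrow> valid n N v \<longleftrightarrow> valid n N v'"
  by (auto simp: valid_def)

text \<open>Assignments are total, so the values from position \<open>n\<close> on must be shown not
  to matter. At positive levels the witnesses for \<open>v\<close> and \<open>v'\<close> are the
  same, as \<open>extends\<close> reads \<open>v\<close> only below \<open>n\<close>.\<close>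

lemma Sg_local:
  assumes "Sg \<alpha> n P" "valid n N v" "\<forall>i<n. v i = v' i"
  shows "P N v \<longleftrightarrow> P N v'"
  using assms(1)
proof cases
  case (zero Q)
  have "valid n N v'" using assms(2,3) valid_local by blast
  then show ?thesis
    using zero(3)[OF assms(2)] zero(3)[of N v'] Qf_local[OF zero(2) assms(3)] by simp
next
  case (pos S)
  have "extends n k N v w = extends n k N v' w" for k w
    using assms(3) by (simp add: extends_def)
  then show ?thesis using pos(4)[of N v] pos(4)[of N v'] assms(2,3) valid_local[of n v v' N] by simp
qed

lemma Qf_ren: "Qf n P \<Longrightarrow> \<forall>i<n. f i < m \<Longrightarrow> Qf m (\<lambda>N v. P N (v \<circ> f))"
  by (induction rule: Qf.induct) (auto intro: Qf.intros)

text \<open>Positions serve as variable names, so substituting free variables by \<open>f\<close>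
  also has to move the quantified block from the positions starting at \<open>n\<close> to those
  starting at \<open>m\<close>; \<open>g k\<close> does both.\<close>

lemma Sg_ren:
  assumes "Sg \<alpha> n P" "\<forall>i<n. f i < m"
  shows "Sg \<alpha> m (\<lambda>N v. P N (v \<circ> f))"
  using assms
proof (induction arbitrary: f m rule: Sg.induct)
  case (zero n Q P)
  have "valid n N (v \<circ> f)" if "valid m N v" for N v
    using that zero(3) by (auto simp: valid_def)
  then show ?case by (intro Sg.zero[OF Qf_ren[OF zero(1,3)]] zero(2))
next
  case (pos \<alpha> S n P)
  define g where "g k i = (if i < n then f i else m + (i - n))" for k i :: nat
  let ?S = "(\<lambda>(k, Q). (k, \<lambda>N w. Q N (w \<circ> g k))) ` S"
  show ?case
  proof (rule Sg.pos[OF pos.hyps(1), of ?S])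
    show "countable ?S" using pos.hyps(2) by blast
    fix k Q' assume "(k, Q') \<in> ?S"
    then obtain Q where Q: "(k, Q) \<in> S" "Q' = (\<lambda>N w. Q N (w \<circ> g k))" by auto
    have "\<forall>i<n + k. g k i < m + k" using pos.prems by (auto simp: g_def intro: trans_less_add1)
    then show "\<exists>\<beta><\<alpha>. Sg \<beta> (m + k) (\<lambda>N w. \<not> Q' N w)" unfolding Q(2) using pos.IH[OF Q(1)] by blast
  next
    fix N v assume v: "valid m N v"
    have "(\<exists>w. extends n k N (v \<circ> f) w \<and> Q N w) \<longleftrightarrow> (\<exists>w. extends m k N v w \<and> Q N (w \<circ> g k))" for k Q
    proof
      assume "\<exists>w. extends n k N (v \<circ> f) w \<and> Q N w"
      then obtain w where w: "extends n k N (v \<circ> f) w" "Q N w" by blast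
      \<comment> \<open>The inverse relabelling: \<open>?w \<circ> g k\<close> equals
        \<open>w\<close> at every position, even beyond the block, so \<open>Q\<close> is
        transferred by rewriting alone.\<close>
      let ?w = "\<lambda>i. if i < m then v i else w (i - m + n)"
      have "?w \<circ> g k = w" using w(1) pos.prems by (auto simp: fun_eq_iff g_def extends_def)
      moreover have "w (i - m + n) \<in> fst N" if "m \<le> i" "i < m + k" for i
      proof -
        have "n \<le> i - m + n \<and> i - m + n < n + k" using that by linarith
        then show ?thesis using w(1) unfolding extends_def by blast
      qed
      then have "extends m k N v ?w" unfolding extends_def by (metis not_le)
      ultimately show "\<exists>w. extends m k N v w \<and> Q N (w \<circ> g k)" using w(2) by metis
    next
      assume "\<exists>w. extends m k N v w \<and> Q N (w \<circ> g k)"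
      then obtain w where w: "extends m k N v w" "Q N (w \<circ> g k)" by blast
      have "w (m + (i - n)) \<in> fst N" if "n \<le> i" "i < n + k" for i
      proof -
        have "m \<le> m + (i - n) \<and> m + (i - n) < m + k" using that by linarith
        then show ?thesis using w(1) unfolding extends_def by blast
      qed
      then have "extends n k N (v \<circ> f) (w \<circ> g k)"
        using w(1) pos.prems unfolding extends_def g_def comp_def by (metis not_le)
      then show "\<exists>w. extends n k N (v \<circ> f) w \<and> Q N w" using w(2) by blast
    qed
    moreover have "valid n N (v \<circ> f)" using v pos.prems by (auto simp: valid_def)
    ultimately show "P N (v \<circ> f) \<longleftrightarrow> (\<exists>(k, Q)\<in>?S. \<exists>w. extends m k N v w \<and> Q N w)"
      using pos.hyps(3) by (simp add: case_prod_beta)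
  qed
qed

text \<open>A quantifier-free predicate is a single disjunct with an empty block; between positive
  levels the same set \<open>S\<close> of disjuncts serves.\<close>

lemma Sg_mono:
  assumes "Sg \<beta> n P" "\<beta> \<le> \<alpha>"
  shows "Sg \<alpha> n P"
proof (cases "\<alpha> = \<beta>")
  case False
  then have "\<beta> < \<alpha>" using assms(2) by simp
  then have "0 < \<alpha>" by (rule le_less_trans[OF zero_le_ord1])
  from assms(1) show ?thesis
  proof cases
    case (zero Q)
    show ?thesis
    proof (rule Sg.pos[OF \<open>0 < \<alpha>\<close>, of "{(0, Q)}"])
      fix k Q' assume "(k, Q') \<in> {(0 :: nat, Q)}"
      then have "k = 0" "Q' = Q" by auto
      then have "Qf (n + k) (\<lambda>N w. \<not> Q' N w)" using Qf.neg[OF zero(2)] by simp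
      then have "Sg 0 (n + k) (\<lambda>N w. \<not> Q' N w)" by (rule Sg.zero) (rule refl)
      then show "\<exists>\<beta><\<alpha>. Sg \<beta> (n + k) (\<lambda>N w. \<not> Q' N w)" using \<open>0 < \<alpha>\<close> by (intro exI[of _ 0] conjI)
    next
      fix N v assume "valid n N v"
      moreover have "Q N w \<longleftrightarrow> Q N v" if "extends n 0 N v w" for w
        using that Qf_local[OF zero(2), of w v] by (simp add: extends_0)
      moreover have "extends n 0 N v v" by (simp add: extends_0)
      ultimately have "P N v \<longleftrightarrow> (\<exists>w. extends n 0 N v w \<and> Q N w)"
        using zero(3) by blast
      then show "P N v \<longleftrightarrow> (\<exists>(k, Q)\<in>{(0, Q)}. \<exists>w. extends n k N v w \<and> Q N w)" by simp
    qed simp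
  next
    case (pos S)
    show ?thesis
    proof (rule Sg.pos[OF \<open>0 < \<alpha>\<close> pos(2) _ pos(4)])
      show "\<exists>\<beta><\<alpha>. Pi \<beta> (n + k) Q" if kQ: "(k, Q) \<in> S" for k Q
      proof -
        obtain \<gamma> where "\<gamma> < \<beta>" "Pi \<gamma> (n + k) Q" using pos(3)[OF kQ] by (elim exE conjE)
        then show ?thesis using \<open>\<beta> < \<alpha>\<close> by (intro exI[of _ \<gamma>] conjI less_trans[of \<gamma> \<beta> \<alpha>])
      qed
    qed
  qed
qed (use assms in simp)

text \<open>One disjunct with an empty block. An extension by an empty block agrees with
  \<open>v\<close> only below \<open>n\<close>, whence the appeal to
  \<open>Sg_local\<close>.\<close>

lemma Pi_less_Sg:
  assumes "Pi \<beta> n P" "\<beta> < \<alpha>"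
  shows "Sg \<alpha> n P"
proof (rule Sg.pos[of _ "{(0, P)}"])
  show "0 < \<alpha>" using assms(2) zero_le_ord1 by (rule le_less_trans[rotated])
  fix N v assume v: "valid n N v"
  have "P N w \<longleftrightarrow> P N v" if "extends n 0 N v w" for w
    using that Sg_local[OF assms(1) v, of w] by (simp add: extends_0)
  moreover have "extends n 0 N v v" by (simp add: extends_0)
  ultimately have "P N v \<longleftrightarrow> (\<exists>w. extends n 0 N v w \<and> P N w)" by blast
  then show "P N v \<longleftrightarrow> (\<exists>(k, Q)\<in>{(0, P)}. \<exists>w. extends n k N v w \<and> Q N w)" by simp
next
  fix k Q assume "(k, Q) \<in> {(0 :: nat, P)}"
  then have "k = 0" "Q = P" by auto
  then show "\<exists>\<beta><\<alpha>. Pi \<beta> (n + k) Q" using assms by (intro exI[of _ \<beta>]) simp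
qed simp

lemma Sg_less_Pi: "Sg \<beta> n P \<Longrightarrow> \<beta> < \<alpha> \<Longrightarrow> Pi \<alpha> n P"
  using Pi_less_Sg[of \<beta> n "\<lambda>N v. \<not> P N v"] by simp

lemma Sg_posE:
  assumes "Sg \<alpha> n P" "0 < \<alpha>"
  obtains S where "countable S" "\<And>k Q. (k, Q) \<in> S \<Longrightarrow> \<exists>\<beta><\<alpha>. Pi \<beta> (n + k) Q"
    "\<And>N v. valid n N v \<Longrightarrow> P N v \<longleftrightarrow> (\<exists>(k, Q)\<in>S. \<exists>w. extends n k N v w \<and> Q N w)"
  using assms(1)
proof cases
  case zero
  then show ?thesis using assms(2) by simp
next
  case (pos S)
  then show ?thesis by (intro that[OF pos(2,3,4)])
qed

lemma Sg_Union:
  assumes "0 < \<alpha>" "countable I" "\<And>i. i \<in> I \<Longrightarrow> Sg \<alpha> n (P i)"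
  shows "Sg \<alpha> n (\<lambda>N v. \<exists>i\<in>I. P i N v)"
proof -
  let ?R = "\<lambda>i S. countable S \<and> (\<forall>k Q. (k, Q) \<in> S \<longrightarrow> (\<exists>\<beta><\<alpha>. Pi \<beta> (n + k) Q)) \<and>
    (\<forall>N v. valid n N v \<longrightarrow> P i N v = (\<exists>(k, Q)\<in>S. \<exists>w. extends n k N v w \<and> Q N w))"
  have "\<exists>S. ?R i S" if "i \<in> I" for i
  proof (rule Sg_posE[OF assms(3)[OF that] assms(1)])
    fix S assume "countable S" "\<And>k Q. (k, Q) \<in> S \<Longrightarrow> \<exists>\<beta><\<alpha>. Pi \<beta> (n + k) Q"
      "\<And>N v. valid n N v \<Longrightarrow> P i N v \<longleftrightarrow> (\<exists>(k, Q)\<in>S. \<exists>w. extends n k N v w \<and> Q N w)"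
    then show ?thesis by (intro exI[of _ S] conjI allI impI)
  qed
  then have "\<forall>i\<in>I. \<exists>S. ?R i S" by (rule ballI)
  then obtain S where "\<forall>i\<in>I. ?R i (S i)" by (rule bchoice[THEN exE])
  then have S: "countable (S i)" "(k, Q) \<in> S i \<Longrightarrow> \<exists>\<beta><\<alpha>. Pi \<beta> (n + k) Q"
    "valid n N v \<Longrightarrow> P i N v = (\<exists>(k, Q)\<in>S i. \<exists>w. extends n k N v w \<and> Q N w)"
    if "i \<in> I" for i k Q N v
    using that by blast+
  show ?thesis
  proof (rule Sg.pos[OF assms(1), of "\<Union>i\<in>I. S i"])
    show "countable (\<Union>i\<in>I. S i)" using assms(2) S(1) by blast
    show "\<exists>\<beta><\<alpha>. Pi \<beta> (n + k) Q" if "(k, Q) \<in> (\<Union>i\<in>I. S i)" for k Q using that S(2) by blast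
    show "(\<exists>i\<in>I. P i N v) \<longleftrightarrow> (\<exists>(k, Q)\<in>\<Union>i\<in>I. S i. \<exists>w. extends n k N v w \<and> Q N w)"
      if "valid n N v" for N v
      using S(3)[OF _ that] by simp
  qed
qed

lemma Sg_qf: "Qf n P \<Longrightarrow> Sg \<alpha> n P"
  using Sg_mono[of 0 n P \<alpha>] Sg.zero[of n P P] zero_le_ord1 by blast

lemma Pi_qf: "Qf n P \<Longrightarrow> Pi \<alpha> n P"
  by (intro Sg_qf Qf.neg)

lemma Pi_True: "Pi \<alpha> n (\<lambda>N v. True)"
  by (intro Pi_qf Qf.true)

text \<open>At positive levels a union of two families; at level 0 De Morgan, since
  \<open>Qf\<close> has no disjunction of its own.\<close>

lemma Sg_disj:
  assumes "Sg \<alpha> n P" "Sg \<alpha> n Q"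
  shows "Sg \<alpha> n (\<lambda>N v. P N v \<or> Q N v)"
proof (cases "\<alpha> = 0")
  case False
  then have "0 < \<alpha>" using zero_le_ord1[of \<alpha>] by simp
  have "Sg \<alpha> n (\<lambda>N v. \<exists>b\<in>{True, False}. if b then P N v else Q N v)"
  proof (rule Sg_Union[OF \<open>0 < \<alpha>\<close>])
    show "Sg \<alpha> n (\<lambda>N v. if b then P N v else Q N v)" for b using assms by (cases b) simp_all
  qed simp
  then show ?thesis by (rule Sg_cong) auto
next
  case True
  obtain P' Q' where *: "Qf n P'" "\<And>N v. valid n N v \<Longrightarrow> P N v = P' N v"
     "Qf n Q'" "\<And>N v. valid n N v \<Longrightarrow> Q N v = Q' N v"
    using assms True by (auto elim!: Sg.cases simp: not_less_zero_ord1)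
  show ?thesis unfolding True
    by (rule Sg.zero[OF Qf.neg[OF Qf.conj[OF Qf.neg[OF *(1)] Qf.neg[OF *(3)]]]]) (simp add: *(2,4))
qed

text \<open>Two existential blocks merge into one of length \<open>k + k'\<close>: the first block
  comes first, and \<open>r k\<close> lets the second predicate read its own block \<open>k\<close>
  positions later. Each pair of disjuncts gives one disjunct, at the larger of the two lower
  levels.\<close>

lemma Sg_conj:
  assumes "Sg \<alpha> n P" "Sg \<alpha> n P'"
  shows "Sg \<alpha> n (\<lambda>N v. P N v \<and> P' N v)"
proof (cases "\<alpha> = 0")
  case True
  obtain R R' where *: "Qf n R" "\<And>N v. valid n N v \<Longrightarrow> P N v = R N v"
     "Qf n R'" "\<And>N v. valid n N v \<Longrightarrow> P' N v = R' N v"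
    using assms True by (auto elim!: Sg.cases simp: not_less_zero_ord1)
  show ?thesis unfolding True
    by (rule Sg.zero[OF Qf.conj[OF *(1,3)]]) (simp add: *(2,4))
next
  case False
  then have \<alpha>: "0 < \<alpha>" using zero_le_ord1[of \<alpha>] by simp
  obtain S where S: "countable S" "\<And>k Q. (k, Q) \<in> S \<Longrightarrow> \<exists>\<beta><\<alpha>. Pi \<beta> (n + k) Q"
    "\<And>N v. valid n N v \<Longrightarrow> P N v = (\<exists>(k, Q)\<in>S. \<exists>w. extends n k N v w \<and> Q N w)"
    by (rule Sg_posE[OF assms(1) \<alpha>], rule that)
  obtain S' where S': "countable S'" "\<And>k Q. (k, Q) \<in> S' \<Longrightarrow> \<exists>\<beta><\<alpha>. Pi \<beta> (n + k) Q"
    "\<And>N v. valid n N v \<Longrightarrow> P' N v = (\<exists>(k, Q)\<in>S'. \<exists>w. extends n k N v w \<and> Q N w)"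
    by (rule Sg_posE[OF assms(2) \<alpha>], rule that)
  define r where "r k i = (if i < n then i else i + k)" for k i :: nat
  let ?h = "\<lambda>((k, Q), (k', Q')). (k + k', \<lambda>N w. Q N w \<and> Q' N (w \<circ> r k))"
  let ?T = "?h ` (S \<times> S')"
  show ?thesis
  proof (rule Sg.pos[OF \<alpha>, of ?T])
    show "countable ?T" using S(1) S'(1) by blast
    fix l R assume "(l, R) \<in> ?T"
    then obtain k Q k' Q' where Q: "(k, Q) \<in> S" "(k', Q') \<in> S'" "l = k + k'"
      "R = (\<lambda>N w. Q N w \<and> Q' N (w \<circ> r k))" by auto
    obtain \<beta> \<beta>' where b: "\<beta> < \<alpha>" "Sg \<beta> (n + k) (\<lambda>N w. \<not> Q N w)"
       "\<beta>' < \<alpha>" "Sg \<beta>' (n + k') (\<lambda>N w. \<not> Q' N w)" using S(2)[OF Q(1)] S'(2)[OF Q(2)] by blast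
    have "Sg (max \<beta> \<beta>') (n + l) (\<lambda>N w. \<not> Q N (w \<circ> id))"
      by (rule Sg_ren[OF Sg_mono[OF b(2)]]) (auto simp: Q(3))
    moreover have "Sg (max \<beta> \<beta>') (n + l) (\<lambda>N w. \<not> Q' N (w \<circ> r k))"
      by (rule Sg_ren[OF Sg_mono[OF b(4)]]) (auto simp: Q(3) r_def)
    ultimately have "Sg (max \<beta> \<beta>') (n + l) (\<lambda>N w. \<not> Q N (w \<circ> id) \<or> \<not> Q' N (w \<circ> r k))"
      by (rule Sg_disj)
    moreover have "max \<beta> \<beta>' < \<alpha>" using b by simp
    ultimately show "\<exists>\<beta><\<alpha>. Sg \<beta> (n + l) (\<lambda>N w. \<not> R N w)"
      unfolding Q(4) by (intro exI[of _ "max \<beta> \<beta>'"]) simp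
  next
    fix N v assume v: "valid n N v"
    let ?B = "\<lambda>s. \<exists>w. extends n (fst s) N v w \<and> snd s N w"
    have "((\<exists>w. extends n k N v w \<and> Q N w) \<and> (\<exists>w. extends n k' N v w \<and> Q' N w)) \<longleftrightarrow>
      (\<exists>w. extends n (k + k') N v w \<and> Q N w \<and> Q' N (w \<circ> r k))"
      if Q: "(k, Q) \<in> S" "(k', Q') \<in> S'" for k Q k' Q'
    proof (safe, goal_cases)
      case (1 w w')
      \<comment> \<open>\<open>w\<close> on the free variables and the first block, then
        \<open>w'\<close> delayed by \<open>k\<close>. \<open>Q\<close> accepts it by locality, and
        \<open>?w \<circ> r k\<close> is exactly \<open>w'\<close>.\<close>
      let ?w = "\<lambda>i. if i < n + k then w i else w' (i - k)"
      obtain \<beta> where "Sg \<beta> (n + k) (\<lambda>N w. \<not> Q N w)" using S(2)[OF Q(1)] by blast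
      moreover have "valid (n + k) N w" using 1 v unfolding valid_def extends_def by (metis leI)
      ultimately have "Q N ?w" using 1(2) Sg_local[of \<beta> "n + k" "\<lambda>N w. \<not> Q N w" N w ?w] by auto
      moreover have "?w \<circ> r k = w'"
        using 1(1,3) by (auto simp: fun_eq_iff r_def extends_def)
      moreover have "w' (i - k) \<in> fst N" if "n + k \<le> i" "i < n + (k + k')" for i
      proof -
        have "n \<le> i - k \<and> i - k < n + k'" using that by linarith
        then show ?thesis using 1(3) unfolding extends_def by blast
      qed
      then have "extends n (k + k') N v ?w"
        using 1(1) unfolding extends_def by (auto simp: not_less)
      ultimately show ?case using 1(4) by metis
    next
      case (2 w)
      then show ?case by (intro exI[of _ w]) (auto simp: extends_def)
    next
      case (3 w)
      then show ?case by (intro exI[of _ "w \<circ> r k"]) (auto simp: extends_def r_def)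
    qed
    then have step: "(?B s \<and> ?B s') \<longleftrightarrow> ?B (?h (s, s'))" if "s \<in> S" "s' \<in> S'" for s s'
      using that by (cases s; cases s') simp
    have "(P N v \<and> P' N v) \<longleftrightarrow> (\<exists>s\<in>S. \<exists>s'\<in>S'. ?B s \<and> ?B s')"
      unfolding S(3)[OF v] S'(3)[OF v] case_prod_beta by blast
    also have "\<dots> \<longleftrightarrow> (\<exists>s\<in>S. \<exists>s'\<in>S'. ?B (?h (s, s')))"
      by (intro bex_cong refl step)
    also have "\<dots> \<longleftrightarrow> (\<exists>t\<in>?T. ?B t)" by blast
    finally show "(P N v \<and> P' N v) \<longleftrightarrow> (\<exists>(k, Q)\<in>?T. \<exists>w. extends n k N v w \<and> Q N w)"
      by (simp only: case_prod_unfold)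
  qed
qed

text \<open>The quantified variable sits at position \<open>n\<close>, immediately before the blocks
  of \<open>P\<close>, so it lengthens each of them by one at the front.\<close>

lemma Sg_Ex:
  assumes "0 < \<alpha>" "Sg \<alpha> (Suc n) P"
  shows "Sg \<alpha> n (\<lambda>N v. \<exists>a\<in>fst N. P N (v(n := a)))"
proof (rule Sg_posE[OF assms(2,1)])
  fix S assume S: "countable S" "\<And>k Q. (k, Q) \<in> S \<Longrightarrow> \<exists>\<beta><\<alpha>. Pi \<beta> (Suc n + k) Q"
    "\<And>N v. valid (Suc n) N v \<Longrightarrow> P N v = (\<exists>(k, Q)\<in>S. \<exists>w. extends (Suc n) k N v w \<and> Q N w)"
  let ?S = "(\<lambda>(k, Q). (Suc k, Q)) ` S"
  show ?thesis
  proof (rule Sg.pos[OF assms(1), of ?S])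
    show "countable ?S" using S(1) by blast
    show "\<exists>\<beta><\<alpha>. Sg \<beta> (n + k) (\<lambda>N w. \<not> Q N w)" if kQ: "(k, Q) \<in> ?S" for k Q
    proof -
      obtain l where "(l, Q) \<in> S" "k = Suc l" using kQ by auto
      then show ?thesis using S(2)[of l Q] by simp
    qed
  next
    fix N v assume v: "valid n N v"
    have step: "(\<exists>a\<in>fst N. \<exists>w. extends (Suc n) k N (v(n := a)) w \<and> Q N w) \<longleftrightarrow>
      (\<exists>w. extends n (Suc k) N v w \<and> Q N w)" for k Q
    proof safe
      fix a w assume "a \<in> fst N" "extends (Suc n) k N (v(n := a)) w" "Q N w"
      moreover from this have "extends n (Suc k) N v w"
        unfolding extends_def by (simp add: less_Suc_eq) (metis Suc_leI order_le_less)
      ultimately show "\<exists>w. extends n (Suc k) N v w \<and> Q N w" by blast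
    next
      fix w assume "extends n (Suc k) N v w" "Q N w"
      moreover from this have "w n \<in> fst N" "extends (Suc n) k N (v(n := w n)) w"
        by (auto simp: extends_def less_Suc_eq)
      ultimately show "\<exists>a\<in>fst N. \<exists>w. extends (Suc n) k N (v(n := a)) w \<and> Q N w" by blast
    qed
    have "valid (Suc n) N (v(n := a))" if "a \<in> fst N" for a
      using that v by (auto simp: valid_def less_Suc_eq)
    then have "(\<exists>a\<in>fst N. P N (v(n := a))) \<longleftrightarrow>
      (\<exists>s\<in>S. \<exists>a\<in>fst N. \<exists>w. extends (Suc n) (fst s) N (v(n := a)) w \<and> snd s N w)"
      using S(3) by (simp add: case_prod_beta) blast
    also have "\<dots> \<longleftrightarrow> (\<exists>s\<in>S. \<exists>w. extends n (Suc (fst s)) N v w \<and> snd s N w)"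
      by (intro bex_cong refl step)
    finally show "(\<exists>a\<in>fst N. P N (v(n := a))) \<longleftrightarrow>
      (\<exists>(k, Q)\<in>?S. \<exists>w. extends n k N v w \<and> Q N w)"
      by (simp add: case_prod_beta)
  qed
qed

lemma Pi_conj: "Pi \<alpha> n P \<Longrightarrow> Pi \<alpha> n Q \<Longrightarrow> Pi \<alpha> n (\<lambda>N v. P N v \<and> Q N v)"
  using Sg_disj[of \<alpha> n "\<lambda>N v. \<not> P N v" "\<lambda>N v. \<not> Q N v"] by simp

lemma Pi_disj: "Pi \<alpha> n P \<Longrightarrow> Pi \<alpha> n Q \<Longrightarrow> Pi \<alpha> n (\<lambda>N v. P N v \<or> Q N v)"
  using Sg_conj[of \<alpha> n "\<lambda>N v. \<not> P N v" "\<lambda>N v. \<not> Q N v"] by simp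

lemma Pi_Inter:
  "0 < \<alpha> \<Longrightarrow> countable I \<Longrightarrow> (\<And>i. i \<in> I \<Longrightarrow> Pi \<alpha> n (P i)) \<Longrightarrow> Pi \<alpha> n (\<lambda>N v. \<forall>i\<in>I. P i N v)"
  using Sg_Union[of \<alpha> I n "\<lambda>i N v. \<not> P i N v"] by simp

lemma Pi_All: "0 < \<alpha> \<Longrightarrow> Pi \<alpha> (Suc n) P \<Longrightarrow> Pi \<alpha> n (\<lambda>N v. \<forall>a\<in>fst N. P N (v(n := a)))"
  using Sg_Ex[of \<alpha> n "\<lambda>N v. \<not> P N v"] by simp

section \<open>From definable predicates to formulas\<close>

lemma sat_foldr_Ex: "sat N v (foldr Ex xs \<psi>) \<longleftrightarrow>
    (\<exists>u. (\<forall>x. x \<notin> set xs \<longrightarrow> u x = v x) \<and> (\<forall>x\<in>set xs. u x \<in> fst N) \<and> sat N u \<psi>)"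
proof (induction xs arbitrary: v)
  case Nil
  then show ?case by (auto simp flip: fun_eq_iff)
next
  case (Cons y xs)
  show ?case
  proof
    assume "sat N v (foldr Ex (y # xs) \<psi>)"
    then obtain a u where "a \<in> fst N" "\<forall>x. x \<notin> set xs \<longrightarrow> u x = (v(y := a)) x"
      "\<forall>x\<in>set xs. u x \<in> fst N" "sat N u \<psi>" using Cons.IH by auto
    then show "\<exists>u. (\<forall>x. x \<notin> set (y # xs) \<longrightarrow> u x = v x) \<and> (\<forall>x\<in>set (y # xs). u x \<in> fst N) \<and> sat N u \<psi>"
      by (intro exI[of _ u]) (simp, metis fun_upd_apply)
  next
    assume "\<exists>u. (\<forall>x. x \<notin> set (y # xs) \<longrightarrow> u x = v x) \<and> (\<forall>x\<in>set (y # xs). u x \<in> fst N) \<and> sat N u \<psi>"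
    then obtain u where u: "\<forall>x. x \<notin> set (y # xs) \<longrightarrow> u x = v x" "\<forall>x\<in>set (y # xs). u x \<in> fst N" "sat N u \<psi>"
      by blast
    then have "sat N (v(y := u y)) (foldr Ex xs \<psi>)" unfolding Cons.IH by (intro exI[of _ u]) auto
    then show "sat N v (foldr Ex (y # xs) \<psi>)" using u by auto
  qed
qed

lemma sat_foldr_All: "sat N v (foldr All xs \<psi>) \<longleftrightarrow> \<not> sat N v (foldr Ex xs (Neg \<psi>))"
  by (induction xs arbitrary: v) auto

lemma free_vars_foldr_Ex: "free_vars (foldr Ex xs \<psi>) = free_vars \<psi> - set xs"
  by (induction xs) auto

lemma free_vars_foldr_All: "free_vars (foldr All xs \<psi>) = free_vars \<psi> - set xs"
  by (induction xs) auto

lemma Qf_realize: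
  "Qf n P \<Longrightarrow> \<exists>\<phi>. finitary_qf \<phi> \<and> free_vars \<phi> \<subseteq> f ` {..<n} \<and> (\<forall>N v. sat N v \<phi> \<longleftrightarrow> P N (v \<circ> f))"
proof (induction rule: Qf.induct)
  case (eq i n j)
  then show ?case by (intro exI[of _ "Eq (f i) (f j)"]) (auto intro: finitary_qf.intros)
next
  case (le i n j)
  then show ?case by (intro exI[of _ "Le (f i) (f j)"]) (auto intro: finitary_qf.intros)
next
  case (neg n P)
  then obtain \<phi> where "finitary_qf \<phi>" "free_vars \<phi> \<subseteq> f ` {..<n}" "\<forall>N v. sat N v \<phi> \<longleftrightarrow> P N (v \<circ> f)" by blast
  then show ?case by (intro exI[of _ "Neg \<phi>"]) (simp add: finitary_qf.intros comp_def)
next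
  case (conj n P Q)
  then obtain \<phi> \<psi> where "finitary_qf \<phi>" "free_vars \<phi> \<subseteq> f ` {..<n}" "\<forall>N v. sat N v \<phi> \<longleftrightarrow> P N (v \<circ> f)"
    "finitary_qf \<psi>" "free_vars \<psi> \<subseteq> f ` {..<n}" "\<forall>N v. sat N v \<psi> \<longleftrightarrow> Q N (v \<circ> f)" by metis
  then show ?case by (intro exI[of _ "Conj {0, 1} (\<lambda>i. if i = 0 then \<phi> else \<psi>)"])
     (simp add: finitary_qf.intros comp_def)
next
  case (true n)
  then show ?case by (intro exI[of _ "Conj {} (\<lambda>i. Eq 0 0)"]) (auto intro: finitary_qf.intros)
qed

text \<open>Both formulas are built together because disjuncts at level \<alpha> need \<Pi> formulas
  below \<alpha> and conjuncts need \<Sigma> formulas. The naming \<open>f\<close> of the variables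
  is arbitrary since the induction passes to the naming \<open>g\<close>, which is fresh on the
  quantified block.\<close>

lemma Sg_realize:
  assumes "Sg \<alpha> n P"
  shows "(\<exists>\<phi>. is_Sigma \<alpha> \<phi> \<and> free_vars \<phi> \<subseteq> f ` {..<n} \<and>
           (\<forall>N v. valid n N (v \<circ> f) \<longrightarrow> (sat N v \<phi> \<longleftrightarrow> P N (v \<circ> f)))) \<and>
         (\<exists>\<phi>. is_Pi \<alpha> \<phi> \<and> free_vars \<phi> \<subseteq> f ` {..<n} \<and>
           (\<forall>N v. valid n N (v \<circ> f) \<longrightarrow> (sat N v \<phi> \<longleftrightarrow> \<not> P N (v \<circ> f))))"
  using assms
proof (induction arbitrary: f rule: Sg.induct)
  case (zero n Q P)
  obtain \<phi> where "finitary_qf \<phi>" "free_vars \<phi> \<subseteq> f ` {..<n}" "\<forall>N v. sat N v \<phi> \<longleftrightarrow> Q N (v \<circ> f)"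
    using Qf_realize[OF zero(1)] by blast
  moreover obtain \<psi> where "finitary_qf \<psi>" "free_vars \<psi> \<subseteq> f ` {..<n}" "\<forall>N v. sat N v \<psi> \<longleftrightarrow> \<not> Q N (v \<circ> f)"
    using Qf_realize[OF Qf.neg[OF zero(1)]] by blast
  ultimately show ?case using zero(2)
    by (intro conjI exI[of _ \<phi>] exI[of _ \<psi>]) (simp_all add: Sigma_zero Pi_zero comp_def)
next
  case (pos \<alpha> S n P)
  \<comment> \<open>All names in use lie below \<open>m\<close>, so those from \<open>m + n\<close>
    on are fresh; with this offset \<open>g\<close> names position \<open>i\<close> of a block by
    \<open>m + i\<close>.\<close>
  obtain m where m: "\<forall>i<n. f i < m"
    using finite_nat_set_iff_bounded[of "f ` {..<n}"] by auto
  define g where "g i = (if i < n then f i else m + i)" for i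
  define X where "X k = [m + n..<m + n + k]" for k
  let ?real = "\<lambda>k R \<psi>. free_vars \<psi> \<subseteq> g ` {..<n + k} \<and>
     (\<forall>N v. valid (n + k) N (v \<circ> g) \<longrightarrow> (sat N v \<psi> \<longleftrightarrow> R N (v \<circ> g)))"
  have ex: "(\<exists>\<psi>. (\<exists>\<beta><\<alpha>. is_Pi \<beta> \<psi>) \<and> ?real k Q \<psi>) \<and> (\<exists>\<psi>. (\<exists>\<beta><\<alpha>. is_Sigma \<beta> \<psi>) \<and> ?real k (\<lambda>N v. \<not> Q N v) \<psi>)"
    if kQ: "(k, Q) \<in> S" for k Q
  proof -
    obtain \<beta> where "\<beta> < \<alpha>" and IH: "(\<exists>\<psi>. is_Sigma \<beta> \<psi> \<and> ?real k (\<lambda>N v. \<not> Q N v) \<psi>) \<and>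
      (\<exists>\<psi>. is_Pi \<beta> \<psi> \<and> ?real k (\<lambda>N v. \<not> \<not> Q N v) \<psi>)"
      using pos.IH[OF kQ] by blast
    then show ?thesis unfolding not_not by blast
  qed
  have "\<forall>s\<in>S. \<exists>\<psi>. (\<exists>\<beta><\<alpha>. is_Pi \<beta> \<psi>) \<and> ?real (fst s) (snd s) \<psi>"
    using ex by (intro ballI) simp
  then obtain p where p: "\<forall>s\<in>S. (\<exists>\<beta><\<alpha>. is_Pi \<beta> (p s)) \<and> ?real (fst s) (snd s) (p s)"
    by (rule bchoice[THEN exE])
  have "\<forall>s\<in>S. \<exists>\<psi>. (\<exists>\<beta><\<alpha>. is_Sigma \<beta> \<psi>) \<and> ?real (fst s) (\<lambda>N v. \<not> snd s N v) \<psi>"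
    using ex by (intro ballI) simp
  then obtain q where q: "\<forall>s\<in>S. (\<exists>\<beta><\<alpha>. is_Sigma \<beta> (q s)) \<and> ?real (fst s) (\<lambda>N v. \<not> snd s N v) (q s)"
    by (rule bchoice[THEN exE])
  \<comment> \<open>\<open>Conj\<close> and \<open>Disj\<close> are indexed by natural numbers, so
    the countable set \<open>S\<close> is enumerated; \<open>IS\<close> translates quantifiers over
    indices back.\<close>
  let ?s = "from_nat_into S" and ?I = "to_nat_on S ` S"
  have I: "?s i \<in> S" if "i \<in> ?I" for i using that pos.hyps(2) by auto
  have IS: "(\<exists>i\<in>?I. R (?s i)) \<longleftrightarrow> (\<exists>s\<in>S. R s)" for R using pos.hyps(2) by auto
  let ?A = "Disj ?I (\<lambda>i. foldr Ex (X (fst (?s i))) (p (?s i)))"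
  let ?B = "Conj ?I (\<lambda>i. foldr All (X (fst (?s i))) (q (?s i)))"
  have "is_Sigma \<alpha> ?A"
  proof (rule Sigma_pos[OF pos.hyps(1)])
    fix i assume "i \<in> ?I"
    then have "\<exists>\<beta><\<alpha>. is_Pi \<beta> (p (?s i))" using I p by blast
    then show "\<exists>xs \<psi>. foldr Ex (X (fst (?s i))) (p (?s i)) = foldr Ex xs \<psi> \<and> (\<exists>\<beta><\<alpha>. is_Pi \<beta> \<psi>)"
      by (intro exI[of _ "X (fst (?s i))"] exI[of _ "p (?s i)"] conjI refl)
  qed
  moreover have "is_Pi \<alpha> ?B"
  proof (rule Pi_pos[OF pos.hyps(1)])
    fix i assume "i \<in> ?I"
    then have "\<exists>\<beta><\<alpha>. is_Sigma \<beta> (q (?s i))" using I q by blast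
    then show "\<exists>xs \<psi>. foldr All (X (fst (?s i))) (q (?s i)) = foldr All xs \<psi> \<and> (\<exists>\<beta><\<alpha>. is_Sigma \<beta> \<psi>)"
      by (intro exI[of _ "X (fst (?s i))"] exI[of _ "q (?s i)"] conjI refl)
  qed
  moreover
  have gX: "g ` {..<n + k} - set (X k) \<subseteq> f ` {..<n}" for k by (auto simp: g_def X_def)
  have "free_vars ?A \<subseteq> f ` {..<n}"
  proof -
    have "free_vars (p s) - set (X (fst s)) \<subseteq> f ` {..<n}" if "s \<in> S" for s
      using p that gX[of "fst s"] by blast
    then show ?thesis using I unfolding free_vars.simps free_vars_foldr_Ex by blast
  qed
  moreover have "free_vars ?B \<subseteq> f ` {..<n}"
  proof -
    have "free_vars (q s) - set (X (fst s)) \<subseteq> f ` {..<n}" if "s \<in> S" for s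
      using q that gX[of "fst s"] by blast
    then show ?thesis using I unfolding free_vars.simps free_vars_foldr_All by blast
  qed
  moreover have "(sat N v ?A \<longleftrightarrow> P N (v \<circ> f)) \<and> (sat N v ?B \<longleftrightarrow> \<not> P N (v \<circ> f))" if v: "valid n N (v \<circ> f)" for N v
  proof -
    have blk: "(\<exists>w. extends n k N (v \<circ> f) w \<and> Q N w) \<longleftrightarrow>
      (\<exists>u. (\<forall>x. x \<notin> set (X k) \<longrightarrow> u x = v x) \<and> (\<forall>x\<in>set (X k). u x \<in> fst N) \<and> Q N (u \<circ> g))"
      if kQ: "(k, Q) \<in> S" for k Q
    proof
      assume "\<exists>w. extends n k N (v \<circ> f) w \<and> Q N w"
      then obtain w where w: "extends n k N (v \<circ> f) w" "Q N w" by blast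
      let ?u = "\<lambda>x. if x \<in> set (X k) then w (x - m) else v x"
      have *: "\<forall>i<n + k. w i = (?u \<circ> g) i" using w(1) m by (auto simp: g_def X_def extends_def)
      have "valid (n + k) N w" using w(1) v unfolding valid_def extends_def by (metis leI)
      then have "Q N (?u \<circ> g)" using w(2) pos.IH[OF kQ] Sg_local[OF _ _ *] by blast
      moreover have "\<forall>x\<in>set (X k). ?u x \<in> fst N"
      proof
        fix x assume "x \<in> set (X k)"
        moreover from this have "n \<le> x - m" "x - m < n + k" by (auto simp: X_def)
        ultimately show "?u x \<in> fst N" using w(1) by (auto simp: extends_def)
      qed
      ultimately show "\<exists>u. (\<forall>x. x \<notin> set (X k) \<longrightarrow> u x = v x) \<and> (\<forall>x\<in>set (X k). u x \<in> fst N) \<and> Q N (u \<circ> g)"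
        by (intro exI[of _ ?u]) auto
    next
      assume "\<exists>u. (\<forall>x. x \<notin> set (X k) \<longrightarrow> u x = v x) \<and> (\<forall>x\<in>set (X k). u x \<in> fst N) \<and> Q N (u \<circ> g)"
      then obtain u where u: "\<forall>x. x \<notin> set (X k) \<longrightarrow> u x = v x" "\<forall>x\<in>set (X k). u x \<in> fst N" "Q N (u \<circ> g)" by blast
      have "f i \<notin> set (X k)" if "i < n" for i using m that by (auto simp: X_def)
      then have "extends n k N (v \<circ> f) (u \<circ> g)" using u(1,2) by (auto simp: extends_def g_def X_def)
      then show "\<exists>w. extends n k N (v \<circ> f) w \<and> Q N w" using u(3) by blast
    qed
    have val: "valid (n + k) N (u \<circ> g)"
      if "\<forall>x. x \<notin> set (X k) \<longrightarrow> u x = v x" "\<forall>x\<in>set (X k). u x \<in> fst N" for u k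
    proof -
      have "f i \<notin> set (X k)" if "i < n" for i using m that by (auto simp: X_def)
      then show ?thesis using that v by (auto simp: valid_def g_def X_def)
    qed
    let ?B' = "\<lambda>s. \<exists>w. extends n (fst s) N (v \<circ> f) w \<and> snd s N w"
    have P: "P N (v \<circ> f) \<longleftrightarrow> (\<exists>s\<in>S. ?B' s)" unfolding pos.hyps(3)[OF v] case_prod_unfold ..
    have pq: "sat N v (foldr Ex (X (fst s)) (p s)) \<longleftrightarrow> ?B' s"
      "sat N v (foldr All (X (fst s)) (q s)) \<longleftrightarrow> \<not> ?B' s" if s: "s \<in> S" for s
    proof -
      have S: "(fst s, snd s) \<in> S" using s by simp
      have "sat N u (p s) = snd s N (u \<circ> g)" "sat N u (q s) = (\<not> snd s N (u \<circ> g))"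
        if "\<forall>x. x \<notin> set (X (fst s)) \<longrightarrow> u x = v x" "\<forall>x\<in>set (X (fst s)). u x \<in> fst N" for u
        using val[OF that] p q s by blast+
      then show "sat N v (foldr Ex (X (fst s)) (p s)) \<longleftrightarrow> ?B' s"
        "sat N v (foldr All (X (fst s)) (q s)) \<longleftrightarrow> \<not> ?B' s"
        unfolding blk[OF S] sat_foldr_All sat_foldr_Ex sat.simps by blast+
    qed
    have "sat N v ?A \<longleftrightarrow> (\<exists>s\<in>S. ?B' s)"
      unfolding sat.simps IS[of "\<lambda>s. sat N v (foldr Ex (X (fst s)) (p s))"] using pq(1) by blast
    moreover have "\<not> sat N v ?B \<longleftrightarrow> (\<exists>s\<in>S. ?B' s)"
      using IS[of "\<lambda>s. \<not> sat N v (foldr All (X (fst s)) (q s))"] pq(2) unfolding sat.simps by blast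
    ultimately show ?thesis unfolding P by blast
  qed
  ultimately have fin: "is_Sigma \<alpha> ?A \<and> free_vars ?A \<subseteq> f ` {..<n} \<and>
      (\<forall>N v. valid n N (v \<circ> f) \<longrightarrow> (sat N v ?A \<longleftrightarrow> P N (v \<circ> f)))"
    "is_Pi \<alpha> ?B \<and> free_vars ?B \<subseteq> f ` {..<n} \<and>
      (\<forall>N v. valid n N (v \<circ> f) \<longrightarrow> (sat N v ?B \<longleftrightarrow> \<not> P N (v \<circ> f)))"
    by (intro conjI allI impI; simp only:)+
  show ?case by (rule conjI; rule exI) (rule fin)+
qed

lemma Pi_realize:
  assumes "Pi \<alpha> n P"
  obtains \<phi> where "is_Pi \<alpha> \<phi>" "free_vars \<phi> \<subseteq> {..<n}" "\<And>N v. valid n N v \<Longrightarrow> sat N v \<phi> \<longleftrightarrow> P N v"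
  using conjunct2[OF Sg_realize[OF assms, of id]] by auto

section \<open>Iterated condensations\<close>

abbreviation le :: "'a struct \<Rightarrow> 'a \<Rightarrow> 'a \<Rightarrow> bool" where
  "le N x y \<equiv> (x, y) \<in> snd N"

text \<open>Lower parts are treated as upper parts of the reversed order, so that most arguments are
  given for one direction only.\<close>

definition dual :: "'a struct \<Rightarrow> 'a struct" where
  "dual N = (fst N, (snd N)\<inverse>)"

lemma fst_dual [simp]: "fst (dual N) = fst N"
  and le_dual [simp]: "le (dual N) x y \<longleftrightarrow> le N y x"
  and dual_dual [simp]: "dual (dual N) = N"
  by (simp_all add: dual_def)

lemma lin_order_dual [simp]: "lin_order (dual N) \<longleftrightarrow> lin_order N"
  by (simp add: lin_order_def dual_def)

text \<open>One block of three bounded quantifiers is the form in which these axioms enter the Scott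
  sentence in \<open>Pi_sentence\<close>.\<close>

lemma lin_order_iff: "lin_order N \<longleftrightarrow> snd N \<subseteq> fst N \<times> fst N \<and>
    (\<forall>x\<in>fst N. \<forall>y\<in>fst N. \<forall>z\<in>fst N. le N x x \<and> (le N x y \<or> le N y x) \<and>
      (le N x y \<and> le N y x \<longrightarrow> x = y) \<and> (le N x y \<and> le N y z \<longrightarrow> le N x z))"
  (is "_ \<longleftrightarrow> ?A \<and> ?B")
proof
  assume "lin_order N"
  then have N: "?A" "refl_on (fst N) (snd N)" "trans (snd N)" "antisym (snd N)" "total_on (fst N) (snd N)"
    by (simp_all add: lin_order_def order_on_defs)
  show "?A \<and> ?B"
  proof (intro conjI ballI impI N(1))
    fix x y z assume "x \<in> fst N" "y \<in> fst N"
    then show "le N x x" "le N x y \<or> le N y x"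
      using N(2,5) unfolding refl_on_def total_on_def by metis+
    show "x = y" if "le N x y \<and> le N y x" using that N(4) by (simp add: antisym_def)
    show "le N x z" if "le N x y \<and> le N y z" using that N(3) by (meson transD)
  qed
next
  assume N: "?A \<and> ?B"
  have "refl_on (fst N) (snd N)" "total_on (fst N) (snd N)"
    using N unfolding refl_on_def total_on_def by blast+
  moreover have "trans (snd N)"
  proof (rule transI)
    fix x y z assume "le N x y" "le N y z"
    moreover from this have "x \<in> fst N" "y \<in> fst N" "z \<in> fst N" using N by blast+
    ultimately show "le N x z" using N by blast
  qed
  moreover have "antisym (snd N)"
  proof (rule antisymI)
    fix x y assume "le N x y" "le N y x"
    moreover from this have "x \<in> fst N" "y \<in> fst N" using N by blast+
    ultimately show "x = y" using N by blast
  qed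
  ultimately show "lin_order N" using N by (simp add: lin_order_def order_on_defs)
qed

lemma lin_orderD:
  assumes "lin_order N"
  shows "x \<in> fst N \<Longrightarrow> le N x x"
    and "le N x y \<Longrightarrow> x \<in> fst N" and "le N x y \<Longrightarrow> y \<in> fst N"
    and "x \<in> fst N \<Longrightarrow> y \<in> fst N \<Longrightarrow> le N x y \<or> le N y x"
    and "le N x y \<Longrightarrow> le N y x \<Longrightarrow> x = y"
    and "le N x y \<Longrightarrow> le N y z \<Longrightarrow> le N x z"
  using assms unfolding lin_order_iff by blast+

text \<open>
  For a convex equivalence relation \<open>R\<close>, \<open>cnt N R k x y\<close> says that the interval \<open>[x, y]\<close> meets at
  least \<open>k + 1\<close> classes of \<open>R\<close>.
\<close>

primrec cnt :: "'a struct \<Rightarrow> ('a \<Rightarrow> 'a \<Rightarrow> bool) \<Rightarrow> nat \<Rightarrow> 'a \<Rightarrow> 'a \<Rightarrow> bool" where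
  "cnt N R 0 x y \<longleftrightarrow> le N x y"
| "cnt N R (Suc k) x y \<longleftrightarrow> (\<exists>z. cnt N R k x z \<and> le N z y \<and> \<not> R z y)"

text \<open>
  If \<open>x < y\<close> then \<open>cnt N R k y x\<close> is false; so only the interval between \<open>x\<close> and \<open>y\<close>, in whatever order they
  come, is restricted.
\<close>

function E :: "'a struct \<Rightarrow> ord1 \<Rightarrow> 'a \<Rightarrow> 'a \<Rightarrow> bool" where
  "E N \<alpha> = (\<lambda>x y. x = y \<or> (\<exists>\<beta>\<in>{..<\<alpha>}. \<exists>k. \<not> cnt N (E N \<beta>) k x y \<and> \<not> cnt N (E N \<beta>) k y x))"
  by auto
termination
proof (relation "inv_image {(\<delta>, \<beta>). \<delta> < \<beta>} snd")
  show "wf (inv_image {(\<delta>, \<beta>). \<delta> < \<beta>} (snd :: 'a struct \<times> ord1 \<Rightarrow> ord1))"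
    by (intro wf_inv_image wf)
qed auto

declare E.simps [simp del]

lemma E_iff: "E N \<alpha> x y \<longleftrightarrow> x = y \<or> (\<exists>\<beta><\<alpha>. \<exists>k. \<not> cnt N (E N \<beta>) k x y \<and> \<not> cnt N (E N \<beta>) k y x)"
  unfolding E.simps[of N \<alpha>] by auto

lemma E_refl [simp]: "E N \<alpha> x x" by (simp add: E_iff)

lemma E_sym: "E N \<alpha> x y \<longleftrightarrow> E N \<alpha> y x" unfolding E_iff[of N \<alpha>] by metis

lemma E_mono: "E N \<beta> x y \<Longrightarrow> \<beta> \<le> \<alpha> \<Longrightarrow> E N \<alpha> x y"
  unfolding E_iff[of N \<alpha>] E_iff[of N \<beta>] by (meson less_le_trans)

lemma cnt_antimono: "cnt N R k x y \<Longrightarrow> (\<And>x y. R' x y \<Longrightarrow> R x y) \<Longrightarrow> cnt N R' k x y"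
  by (induction k arbitrary: y) auto

lemma cnt_E_antimono: "cnt N (E N \<alpha>) k x y \<Longrightarrow> \<beta> \<le> \<alpha> \<Longrightarrow> cnt N (E N \<beta>) k x y"
  by (erule cnt_antimono) (rule E_mono)

text \<open>Transitivity is confined to the carrier: in a linear order, a point outside it is
  related by \<open>E N \<alpha>\<close> with \<alpha> > 0 to everything, since all its counts
  fail.\<close>

definition convex_equiv :: "'a struct \<Rightarrow> ('a \<Rightarrow> 'a \<Rightarrow> bool) \<Rightarrow> bool" where
  "convex_equiv N R \<longleftrightarrow> (\<forall>x. R x x) \<and> (\<forall>x y. R x y \<longrightarrow> R y x) \<and>
     (\<forall>x\<in>fst N. \<forall>y\<in>fst N. \<forall>z\<in>fst N. R x y \<longrightarrow> R y z \<longrightarrow> R x z) \<and>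
     (\<forall>x y z. le N x y \<longrightarrow> le N y z \<longrightarrow> R x z \<longrightarrow> R x y \<and> R y z)"

lemma cnt_le: "lin_order N \<Longrightarrow> cnt N R k x y \<Longrightarrow> le N x y"
proof (induction k arbitrary: y)
  case (Suc k)
  then obtain z where "le N x z" "le N z y" by auto
  then show ?case by (rule lin_orderD(6)[OF Suc.prems(1)])
qed simp

section \<open>Counting the classes of a convex equivalence relation\<close>

context
  fixes N :: "'a struct" and R :: "'a \<Rightarrow> 'a \<Rightarrow> bool"
  assumes lin: "lin_order N" and R: "convex_equiv N R"
begin

lemma R_sym: "R x y \<Longrightarrow> R y x"
  and R_trans: "x \<in> fst N \<Longrightarrow> y \<in> fst N \<Longrightarrow> z \<in> fst N \<Longrightarrow> R x y \<Longrightarrow> R y z \<Longrightarrow> R x z"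
  and R_convex1: "le N x y \<Longrightarrow> le N y z \<Longrightarrow> R x z \<Longrightarrow> R x y"
  and R_convex2: "le N x y \<Longrightarrow> le N y z \<Longrightarrow> R x z \<Longrightarrow> R y z"
  using R unfolding convex_equiv_def by blast+

text \<open>By convexity, a last witness not related to \<open>y\<close> is not related to anything
  above \<open>y\<close> either.\<close>

lemma cnt_right: "cnt N R k x y \<Longrightarrow> le N y y' \<Longrightarrow> cnt N R k x y'"
proof (cases k)
  case 0
  then show "cnt N R k x y \<Longrightarrow> le N y y' \<Longrightarrow> ?thesis" using lin_orderD(6)[OF lin, of x y y'] by simp
next
  case (Suc l)
  assume y: "cnt N R k x y" "le N y y'"
  then obtain z where "cnt N R l x z" "le N z y" "\<not> R z y" using Suc by auto
  then show ?thesis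
    using Suc R_convex1[of z y y'] lin_orderD(6)[OF lin, of z y y'] y(2) by auto
qed

lemma cnt_left: "cnt N R k x y \<Longrightarrow> le N x' x \<Longrightarrow> cnt N R k x' y"
proof (induction k arbitrary: y)
  case 0
  then show ?case using lin_orderD(6)[OF lin, of x' x y] by simp
qed auto

text \<open>A count of \<open>k\<close> is a chain of \<open>k\<close> steps between unrelated
  neighbours that starts at or above \<open>x\<close> and ends at the right endpoint; chains can be
  cut and concatenated.\<close>

lemma cnt_add: "cnt N R (k + l) x z \<longleftrightarrow> (\<exists>y. cnt N R k x y \<and> cnt N R l y z)"
proof (induction l arbitrary: z)
  case 0
  show ?case
  proof
    assume "cnt N R (k + 0) x z"
    then have "cnt N R k x z" by simp
    moreover from this have "le N z z" by (intro lin_orderD(1,3)[OF lin] cnt_le[OF lin])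
    ultimately show "\<exists>y. cnt N R k x y \<and> cnt N R 0 y z" by auto
  qed (auto intro: cnt_right)
qed auto

lemma cnt_Suc_imp: "cnt N R (Suc k) x y \<Longrightarrow> cnt N R k x y"
  using cnt_right by (simp only: cnt.simps) blast

lemma cnt_le_imp: "cnt N R l x y \<Longrightarrow> k \<le> l \<Longrightarrow> cnt N R k x y"
proof (induction l)
  case (Suc l)
  then show ?case using cnt_Suc_imp[of l] by (cases "k = Suc l") (simp_all del: cnt.simps)
qed simp

lemma cnt_1_iff: "cnt N R (Suc 0) x y \<longleftrightarrow> le N x y \<and> \<not> R x y"
proof
  assume "le N x y \<and> \<not> R x y"
  then show "cnt N R (Suc 0) x y" using lin_orderD(1)[OF lin, of x] lin_orderD(2)[OF lin, of x y] by auto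
qed (use R_convex2[of x _ y] lin_orderD(6)[OF lin, of x _ y] in auto)

lemma cnt_Suc_left: "cnt N R (Suc k) x z \<longleftrightarrow> (\<exists>y. le N x y \<and> \<not> R x y \<and> cnt N R k y z)"
  using cnt_add[of "Suc 0" k x z] cnt_1_iff by simp

text \<open>Let \<open>w\<close> be the point after \<open>k\<close> steps. If
  \<open>y \<le> w\<close>, the remaining steps lie above \<open>y\<close>; if \<open>y\<close> is
  above \<open>w\<close> in another class, it provides one more step; if it is in the class of
  \<open>w\<close>, the next step leaves the class of \<open>y\<close> as well.\<close>

lemma cnt_split:
  assumes "cnt N R (Suc (k + l)) x z" "y \<in> fst N"
  shows "cnt N R (Suc k) x y \<or> cnt N R (Suc l) y z"
proof -
  obtain w where w: "cnt N R k x w" "cnt N R (Suc l) w z"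
    using assms(1) cnt_add[of k "Suc l" x z] by auto
  obtain u where u: "le N w u" "\<not> R w u" "cnt N R l u z" using w(2) cnt_Suc_left by blast
  have wN: "w \<in> fst N" using u(1) lin_orderD(2)[OF lin] by blast
  consider "le N y w" | "le N w y" "\<not> R w y" | "le N w y" "R w y"
    using lin_orderD(4)[OF lin wN assms(2)] by blast
  then show ?thesis
  proof cases
    case 1
    then show ?thesis using w(2) cnt_left by blast
  next
    case 2
    then show ?thesis using w(1) by auto
  next
    case 3
    have uN: "u \<in> fst N" using u(1) lin_orderD(3)[OF lin] by blast
    have "\<not> le N u y" using R_convex1[OF u(1) _ 3(2)] u(2) by blast
    then have "le N y u" using lin_orderD(4)[OF lin uN assms(2)] by blast
    moreover have "\<not> R y u" using R_trans[OF wN assms(2) uN 3(2)] u(2) by blast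
    ultimately show ?thesis using u(3) cnt_Suc_left by blast
  qed
qed

text \<open>The count must be positive: with count 0 the endpoint could move within its class to the
  other side of \<open>x\<close>.\<close>

lemma cnt_class_right:
  assumes "cnt N R (Suc k) x y" "R y y'" "y' \<in> fst N"
  shows "cnt N R (Suc k) x y'"
proof -
  obtain z where z: "cnt N R k x z" "le N z y" "\<not> R z y" using assms(1) by auto
  have N: "z \<in> fst N" "y \<in> fst N" using lin_orderD(2,3)[OF lin z(2)] by auto
  have "\<not> R z y'" using R_trans[OF N(1) assms(3) N(2) _ R_sym[OF assms(2)]] z(3) by blast
  moreover have "\<not> le N y' z"
    using R_convex2[of y' z y] R_sym[OF assms(2)] z(2,3) by blast
  then have "le N z y'" using lin_orderD(4)[OF lin N(1) assms(3)] by blast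
  ultimately show ?thesis using z(1) by auto
qed

lemma cnt_class_left:
  assumes "cnt N R (Suc k) x y" "R x x'" "x' \<in> fst N"
  shows "cnt N R (Suc k) x' y"
proof -
  obtain z where z: "le N x z" "\<not> R x z" "cnt N R k z y" using assms(1) cnt_Suc_left by blast
  have N: "z \<in> fst N" "x \<in> fst N" using lin_orderD(2,3)[OF lin z(1)] by auto
  have "\<not> R x' z" using R_trans[OF N(2) assms(3) N(1) assms(2)] z(2) by blast
  moreover have "\<not> le N z x'"
    using R_convex1[of x z x'] assms(2) z(1,2) by blast
  then have "le N x' z" using lin_orderD(4)[OF lin N(1) assms(3)] by blast
  ultimately show ?thesis using z(3) cnt_Suc_left by blast
qed

text \<open>\<open>cnt\<close> recurses at the upper end; reversal needs the recursion at the lower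
  end, which is \<open>cnt_Suc_left\<close>.\<close>

lemma cnt_dual: "cnt (dual N) R k x y \<longleftrightarrow> cnt N R k y x"
proof (induction k arbitrary: y)
  case (Suc k)
  show ?case unfolding cnt.simps(2)[of "dual N"] Suc cnt_Suc_left[of k y x]
    using R_sym by auto
qed simp

end

lemma E_le_iff:
  assumes "lin_order N" "le N x y"
  shows "E N \<alpha> x y \<longleftrightarrow> x = y \<or> (\<exists>\<beta><\<alpha>. \<exists>k. \<not> cnt N (E N \<beta>) k x y)"
  unfolding E_iff[of N \<alpha>] using cnt_le[OF assms(1), of _ _ y x] lin_orderD(5)[OF assms] by blast

text \<open>Convexity is monotonicity of counts at the smaller levels. For transitivity both bounds
  are first brought to the larger of the two levels, where counts only decrease, and then combined
  by \<open>cnt_split\<close>.\<close>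

lemma E_convex_equiv:
  assumes lin: "lin_order N"
  shows "convex_equiv N (E N \<alpha>)"
proof (induction \<alpha> rule: less_induct)
  case (less \<alpha>)
  note lo = lin_orderD[OF lin]
  have conv: "E N \<alpha> x y \<and> E N \<alpha> y z" if xyz: "le N x y" "le N y z" "E N \<alpha> x z" for x y z
  proof (cases "x = z")
    case True
    then have "x = y" "y = z" using lo(5)[of x y] xyz(1,2) by simp_all
    then show ?thesis using xyz(3) by simp
  next
    case False
    have "le N x z" using xyz(1,2) by (rule lo(6))
    then obtain \<beta> k where "\<beta> < \<alpha>" "\<not> cnt N (E N \<beta>) k x z"
      using xyz(3) False E_le_iff[OF lin, of x z] by blast
    moreover from this have "\<not> cnt N (E N \<beta>) k x y" "\<not> cnt N (E N \<beta>) k y z"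
      using cnt_right[OF lin less] cnt_left[OF lin less] xyz(1,2) by blast+
    ultimately show ?thesis using E_le_iff[OF lin xyz(1)] E_le_iff[OF lin xyz(2)] by blast
  qed
  have tr: "E N \<alpha> x z" if xyz: "le N x y" "le N y z" "E N \<alpha> x y" "E N \<alpha> y z" for x y z
  proof (cases "x = y \<or> y = z")
    case True
    then show ?thesis using xyz by blast
  next
    case False
    then obtain \<beta> k \<gamma> l where *: "\<beta> < \<alpha>" "\<not> cnt N (E N \<beta>) k x y" "\<gamma> < \<alpha>" "\<not> cnt N (E N \<gamma>) l y z"
      using xyz(3,4) E_le_iff[OF lin xyz(1)] E_le_iff[OF lin xyz(2)] by meson
    let ?m = "max \<beta> \<gamma>"
    have m: "?m < \<alpha>" using * by simp
    have "\<not> cnt N (E N ?m) k x y" "\<not> cnt N (E N ?m) l y z"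
      using * cnt_E_antimono[of N ?m _ _ _ \<beta>] cnt_E_antimono[of N ?m _ _ _ \<gamma>] by auto
    then have "\<not> cnt N (E N ?m) (Suc k) x y" "\<not> cnt N (E N ?m) (Suc l) y z"
      using cnt_Suc_imp[OF lin less[OF m]] by blast+
    then have "\<not> cnt N (E N ?m) (Suc (k + l)) x z"
      using cnt_split[OF lin less[OF m]] lo(3)[OF xyz(1)] by blast
    then show ?thesis using E_le_iff[OF lin lo(6)[OF xyz(1,2)]] m by blast
  qed
  have "E N \<alpha> x z" if xyz: "x \<in> fst N" "y \<in> fst N" "z \<in> fst N" "E N \<alpha> x y" "E N \<alpha> y z" for x y z
  proof -
    have sym: "E N \<alpha> y x" "E N \<alpha> z y" using xyz E_sym by metis+
    \<comment> \<open>The arrangements of three points: \<open>tr\<close> settles those with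
      \<open>y\<close> in the middle, \<open>conv\<close> the other four.\<close>
    consider "le N x y" "le N y z" | "le N z y" "le N y x" | "le N x z" "le N z y" | "le N z x" "le N x y"
      | "le N y x" "le N x z" | "le N y z" "le N z x"
      using xyz(1-3) lo(4) by blast
    then show ?thesis
      using tr[of x y z] tr[of z y x] conv[of x z y] conv[of z x y] conv[of y x z] conv[of y z x]
        xyz sym E_sym[of N \<alpha> x z] by cases blast+
  qed
  then show ?case unfolding convex_equiv_def using conv E_sym by (metis E_refl)
qed

lemma E_dual: "lin_order N \<Longrightarrow> E (dual N) \<alpha> = E N \<alpha>"
proof (induction \<alpha> rule: less_induct)
  case (less \<alpha>)
  have "cnt (dual N) (E (dual N) \<beta>) k x y = cnt N (E N \<beta>) k y x" if "\<beta> < \<alpha>" for \<beta> k x y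
    using less.IH[OF that less.prems] cnt_dual[OF less.prems E_convex_equiv[OF less.prems]] by simp
  then show ?case unfolding fun_eq_iff E_iff[of N \<alpha>] E_iff[of "dual N" \<alpha>] by metis
qed

subsection \<open>Isomorphisms between convex subsets\<close>

definition iso_on :: "'a struct \<Rightarrow> 'a set \<Rightarrow> 'b struct \<Rightarrow> 'b set \<Rightarrow> ('a \<Rightarrow> 'b) \<Rightarrow> bool" where
  "iso_on N A M B f \<longleftrightarrow> bij_betw f A B \<and> (\<forall>x\<in>A. \<forall>y\<in>A. le N x y \<longleftrightarrow> le M (f x) (f y))"

definition eqv :: "'a struct \<Rightarrow> 'a set \<Rightarrow> 'b struct \<Rightarrow> 'b set \<Rightarrow> bool" where
  "eqv N A M B \<longleftrightarrow> (\<exists>f. iso_on N A M B f)"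

lemma isomorphic_iff_eqv: "isomorphic M N \<longleftrightarrow> eqv M (fst M) N (fst N)"
  by (simp add: isomorphic_def eqv_def iso_on_def)

lemma eqv_dual: "eqv (dual N) A (dual M) B \<longleftrightarrow> eqv N A M B"
  unfolding eqv_def iso_on_def by auto

lemma eqv_refl: "eqv N A N A"
  unfolding eqv_def iso_on_def by (rule exI[of _ id]) auto

lemma eqv_sym: "eqv N A M B \<Longrightarrow> eqv M B N A"
  unfolding eqv_def iso_on_def
proof (elim exE conjE)
  fix f assume f: "bij_betw f A B" "\<forall>x\<in>A. \<forall>y\<in>A. le N x y \<longleftrightarrow> le M (f x) (f y)"
  let ?g = "inv_into A f"
  have "bij_betw ?g B A" using f(1) by (rule bij_betw_inv_into)
  moreover have "le M x y \<longleftrightarrow> le N (?g x) (?g y)" if "x \<in> B" "y \<in> B" for x y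
    using f that bij_betw_inv_into_right[OF f(1)] bij_betwE[OF bij_betw_inv_into[OF f(1)]] by simp
  ultimately show "\<exists>g. bij_betw g B A \<and> (\<forall>x\<in>B. \<forall>y\<in>B. le M x y \<longleftrightarrow> le N (g x) (g y))" by blast
qed

lemma eqv_trans: "eqv N A M B \<Longrightarrow> eqv M B K C \<Longrightarrow> eqv N A K C"
  unfolding eqv_def iso_on_def
proof (elim exE conjE)
  fix f g assume f: "bij_betw f A B" "\<forall>x\<in>A. \<forall>y\<in>A. le N x y \<longleftrightarrow> le M (f x) (f y)"
    and g: "bij_betw g B C" "\<forall>x\<in>B. \<forall>y\<in>B. le M x y \<longleftrightarrow> le K (g x) (g y)"
  have "bij_betw (g \<circ> f) A C" using f(1) g(1) by (rule bij_betw_trans)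
  moreover have "\<forall>x\<in>A. \<forall>y\<in>A. le N x y \<longleftrightarrow> le K ((g \<circ> f) x) ((g \<circ> f) y)"
    using f g bij_betwE[OF f(1)] by auto
  ultimately show "\<exists>h. bij_betw h A C \<and> (\<forall>x\<in>A. \<forall>y\<in>A. le N x y \<longleftrightarrow> le K (h x) (h y))" by blast
qed

lemma eqv_empty: "eqv N {} M B \<longleftrightarrow> B = {}"
  unfolding eqv_def iso_on_def by (auto simp: bij_betw_def)

lemma eqv_singleton: "lin_order N \<Longrightarrow> lin_order M \<Longrightarrow> x \<in> fst N \<Longrightarrow> a \<in> fst M \<Longrightarrow> eqv N {x} M {a}"
  unfolding eqv_def iso_on_def by (rule exI[of _ "\<lambda>_. a"]) (auto simp: lin_orderD(1) bij_betw_def)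

lemma iso_on_subset: "iso_on N A M B f \<Longrightarrow> A' \<subseteq> A \<Longrightarrow> f ` A' = B' \<Longrightarrow> iso_on N A' M B' f"
  unfolding iso_on_def by (auto intro: bij_betw_subset)

definition convex :: "'a struct \<Rightarrow> 'a set \<Rightarrow> bool" where
  "convex N A \<longleftrightarrow> A \<subseteq> fst N \<and> (\<forall>x\<in>A. \<forall>z\<in>A. \<forall>y. le N x y \<longrightarrow> le N y z \<longrightarrow> y \<in> A)"

text \<open>The witnesses of a count lie between its endpoints, so convexity keeps them in
  \<open>A\<close> and \<open>B\<close>.\<close>

lemma cnt_iso:
  assumes "lin_order N" "lin_order M" "convex N A" "convex M B" "iso_on N A M B f"
    and R: "\<And>x y. x \<in> A \<Longrightarrow> y \<in> A \<Longrightarrow> R x y \<longleftrightarrow> R' (f x) (f y)"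
    and "x \<in> A" "y \<in> A"
  shows "cnt N R k x y \<longleftrightarrow> cnt M R' k (f x) (f y)"
  using assms(8)
proof (induction k arbitrary: y)
  case 0
  then show ?case using assms(5,7) by (simp add: iso_on_def)
next
  case (Suc k)
  have f: "bij_betw f A B" "\<And>x y. x \<in> A \<Longrightarrow> y \<in> A \<Longrightarrow> le N x y \<longleftrightarrow> le M (f x) (f y)"
    using assms(5) by (auto simp: iso_on_def)
  have fA: "f z \<in> B" if "z \<in> A" for z using f(1) that by (auto simp: bij_betw_def)
  show ?case
  proof
    assume "cnt N R (Suc k) x y"
    then obtain z where z: "cnt N R k x z" "le N z y" "\<not> R z y" by auto
    have "z \<in> A" using cnt_le[OF assms(1) z(1)] z(2) assms(3,7) Suc.prems unfolding convex_def by blast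
    then show "cnt M R' (Suc k) (f x) (f y)" using z Suc f(2) R by auto
  next
    assume "cnt M R' (Suc k) (f x) (f y)"
    then obtain w where w: "cnt M R' k (f x) w" "le M w (f y)" "\<not> R' w (f y)" by auto
    have "w \<in> B" using cnt_le[OF assms(2) w(1)] w(2) assms(4) fA[OF assms(7)] fA[OF Suc.prems]
      unfolding convex_def by blast
    then obtain z where z: "z \<in> A" "w = f z" using f(1) by (auto simp: bij_betw_def)
    then have "cnt N R k x z" "le N z y" "\<not> R z y"
      using w Suc.IH[OF z(1)] Suc.prems f(2) R by auto
    then show "cnt N R (Suc k) x y" by auto
  qed
qed

text \<open>Hence the restriction of \<open>E\<^sub>\<alpha>\<close> to a convex set depends only on
  the isomorphism type of that set.\<close>

lemma E_iso:
  assumes "lin_order N" "lin_order M" "convex N A" "convex M B" "iso_on N A M B f"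
  shows "x \<in> A \<Longrightarrow> y \<in> A \<Longrightarrow> E N \<alpha> x y \<longleftrightarrow> E M \<alpha> (f x) (f y)"
proof (induction \<alpha> arbitrary: x y rule: less_induct)
  case (less \<alpha>)
  have "cnt N (E N \<beta>) k u v \<longleftrightarrow> cnt M (E M \<beta>) k (f u) (f v)" if "\<beta> < \<alpha>" "u \<in> A" "v \<in> A" for \<beta> k u v
    by (rule cnt_iso[where R = "E N \<beta>" and R' = "E M \<beta>", OF assms less.IH[OF that(1)]]) (use that in auto)
  moreover have "f x = f y \<longleftrightarrow> x = y"
    using assms(5) less.prems unfolding iso_on_def bij_betw_def inj_on_def by blast
  ultimately show ?case unfolding E_iff[of N \<alpha>] E_iff[of M \<alpha>] using less.prems by blast
qed

lemma cnt_E_iso: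
  assumes "lin_order N" "lin_order M" "convex N A" "convex M B" "iso_on N A M B f" "x \<in> A" "y \<in> A"
  shows "cnt N (E N \<alpha>) k x y \<longleftrightarrow> cnt M (E M \<alpha>) k (f x) (f y)"
  by (rule cnt_iso[where R = "E N \<alpha>" and R' = "E M \<alpha>", OF assms(1-5) E_iso[OF assms(1-5)] assms(6,7)])

text \<open>Ordered sums of isomorphic summands are isomorphic. Instead of an order on the index
  set, \<open>sep\<close> asks that any two pieces lie in the same relative position on both sides,
  which also makes them disjoint.\<close>

lemma eqv_glue:
  assumes "lin_order N" "lin_order M" "\<And>i. i \<in> I \<Longrightarrow> P i \<subseteq> fst N" "\<And>i. i \<in> I \<Longrightarrow> Q i \<subseteq> fst M"
    and eqv: "\<And>i. i \<in> I \<Longrightarrow> eqv N (P i) M (Q i)"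
    and sep: "\<And>i j. i \<in> I \<Longrightarrow> j \<in> I \<Longrightarrow> i \<noteq> j \<Longrightarrow>
      (\<forall>x\<in>P i. \<forall>y\<in>P j. x \<noteq> y \<and> le N x y) \<and> (\<forall>x\<in>Q i. \<forall>y\<in>Q j. x \<noteq> y \<and> le M x y) \<or>
      (\<forall>x\<in>P i. \<forall>y\<in>P j. x \<noteq> y \<and> le N y x) \<and> (\<forall>x\<in>Q i. \<forall>y\<in>Q j. x \<noteq> y \<and> le M y x)"
  shows "eqv N (\<Union>i\<in>I. P i) M (\<Union>i\<in>I. Q i)"
proof -
  have "\<forall>i\<in>I. \<exists>f. iso_on N (P i) M (Q i) f" using eqv by (simp add: eqv_def)
  then obtain f where f: "\<And>i. i \<in> I \<Longrightarrow> iso_on N (P i) M (Q i) (f i)" by metis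
  have "\<forall>x\<in>\<Union>i\<in>I. P i. \<exists>i. i \<in> I \<and> x \<in> P i" by blast
  then obtain idx where idx: "\<And>i x. i \<in> I \<Longrightarrow> x \<in> P i \<Longrightarrow> idx x \<in> I \<and> x \<in> P (idx x)"
    by (metis UN_I)
  have idx_eq: "idx x = i" if "i \<in> I" "x \<in> P i" for x i
    using idx[OF that] sep[of "idx x" i] that by blast
  define g where "g x = f (idx x) x" for x
  have gQ: "g x \<in> Q i" if "i \<in> I" "x \<in> P i" for x i
    using f[OF that(1)] that idx_eq[OF that] by (auto simp: g_def iso_on_def bij_betw_def)
  have le: "le N x y \<longleftrightarrow> le M (g x) (g y)" if "i \<in> I" "x \<in> P i" "j \<in> I" "y \<in> P j" for x y i j
  proof (cases "i = j")
    case True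
    then show ?thesis using f[OF that(1)] that idx_eq that by (simp add: g_def iso_on_def)
  next
    case False
    have "x \<noteq> y" and ne: "g x \<noteq> g y" using sep[OF that(1,3) False] that gQ[OF that(1,2)] gQ[OF that(3,4)] by blast+
    have *: "le N x y \<and> le M (g x) (g y) \<or> le N y x \<and> le M (g y) (g x)"
      using sep[OF that(1,3) False] that gQ[OF that(1,2)] gQ[OF that(3,4)] by blast
    then show ?thesis using lin_orderD(5)[OF assms(1)] lin_orderD(5)[OF assms(2)] \<open>x \<noteq> y\<close> ne by blast
  qed
  have "inj_on g (\<Union>i\<in>I. P i)"
  proof (rule inj_onI)
    fix x y assume xy: "x \<in> (\<Union>i\<in>I. P i)" "y \<in> (\<Union>i\<in>I. P i)" "g x = g y"
    then obtain i j where ij: "i \<in> I" "x \<in> P i" "j \<in> I" "y \<in> P j" by blast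
    have "le N x x" "le N y y" using ij assms(3) lin_orderD(1)[OF assms(1)] by blast+
    then have "le N x y" "le N y x" using le ij xy(3) by metis+
    then show "x = y" using lin_orderD(5)[OF assms(1)] by blast
  qed
  moreover have "g ` (\<Union>i\<in>I. P i) = (\<Union>i\<in>I. Q i)"
  proof
    show "g ` (\<Union>i\<in>I. P i) \<subseteq> (\<Union>i\<in>I. Q i)" using gQ by blast
    show "(\<Union>i\<in>I. Q i) \<subseteq> g ` (\<Union>i\<in>I. P i)"
    proof
      fix b assume "b \<in> (\<Union>i\<in>I. Q i)"
      then obtain i where i: "i \<in> I" "b \<in> Q i" by blast
      then obtain x where "x \<in> P i" "b = f i x" using f[OF i(1)] unfolding iso_on_def bij_betw_def by blast
      then show "b \<in> g ` (\<Union>i\<in>I. P i)" using i(1) idx_eq[OF i(1)] unfolding g_def by blast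
    qed
  qed
  ultimately show ?thesis using le unfolding eqv_def iso_on_def bij_betw_def by (intro exI[of _ g]) blast
qed

section \<open>Classes of the condensations\<close>

text \<open>In a linear order, index 0 gives only the part of the class of \<open>x\<close> from
  \<open>x\<close> upwards. An index \<open>Suc k\<close> gives a whole class further up or nothing,
  so the summands of an upper part have successor indices.\<close>

definition nth_class :: "'a struct \<Rightarrow> ord1 \<Rightarrow> nat \<Rightarrow> 'a \<Rightarrow> 'a set" where
  "nth_class N \<beta> k x = {y. cnt N (E N \<beta>) k x y \<and> \<not> cnt N (E N \<beta>) (Suc k) x y}"

definition class_of :: "'a struct \<Rightarrow> ord1 \<Rightarrow> 'a \<Rightarrow> 'a set" where
  "class_of N \<alpha> x = {y \<in> fst N. E N \<alpha> x y}"

definition upper_class :: "'a struct \<Rightarrow> ord1 \<Rightarrow> 'a \<Rightarrow> 'a set" where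
  "upper_class N \<alpha> x = {y. x \<noteq> y \<and> le N x y \<and> E N \<alpha> x y}"

context
  fixes N :: "'a struct"
  assumes lin: "lin_order N"
begin

lemmas lo = lin_orderD[OF lin]
  and E_equiv = lin E_convex_equiv[OF lin]

lemma E_trans: "x \<in> fst N \<Longrightarrow> y \<in> fst N \<Longrightarrow> z \<in> fst N \<Longrightarrow> E N \<alpha> x y \<Longrightarrow> E N \<alpha> y z \<Longrightarrow> E N \<alpha> x z"
  by (rule R_trans[OF E_equiv])

lemma class_of_eq: "x \<in> fst N \<Longrightarrow> y \<in> fst N \<Longrightarrow> E N \<alpha> x y \<Longrightarrow> class_of N \<alpha> x = class_of N \<alpha> y"
  unfolding class_of_def using E_trans[of x y _ \<alpha>] E_trans[of y x _ \<alpha>] E_sym[of N \<alpha> x y] by blast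

lemma nth_class_le: "y \<in> nth_class N \<beta> k x \<Longrightarrow> le N x y"
  unfolding nth_class_def using cnt_le[OF lin] by blast

lemma nth_class_subset: "nth_class N \<beta> k x \<subseteq> fst N"
  using nth_class_le lo(3) by blast

text \<open>Of two unrelated points the upper one would be a class further away. Conversely a point
  may move within its class because the count is positive.\<close>

lemma nth_class_eq_class_of:
  assumes y: "y \<in> nth_class N \<beta> (Suc k) x"
  shows "nth_class N \<beta> (Suc k) x = class_of N \<beta> y"
proof -
  have yN: "y \<in> fst N" using nth_class_subset y by blast
  have *: "E N \<beta> u v" if "le N u v" "u \<in> nth_class N \<beta> (Suc k) x" "v \<in> nth_class N \<beta> (Suc k) x" for u v
    using that unfolding nth_class_def by auto
  show ?thesis
  proof
    show "nth_class N \<beta> (Suc k) x \<subseteq> class_of N \<beta> y"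
    proof
      fix z assume z: "z \<in> nth_class N \<beta> (Suc k) x"
      then have zN: "z \<in> fst N" using nth_class_subset by blast
      have "E N \<beta> y z" using *[OF _ y z] *[OF _ z y] lo(4)[OF yN zN] E_sym by metis
      then show "z \<in> class_of N \<beta> y" using zN by (simp add: class_of_def)
    qed
    show "class_of N \<beta> y \<subseteq> nth_class N \<beta> (Suc k) x"
    proof
      fix z assume "z \<in> class_of N \<beta> y"
      then have z: "z \<in> fst N" "E N \<beta> y z" by (simp_all add: class_of_def)
      then have z': "E N \<beta> z y" using E_sym by metis
      show "z \<in> nth_class N \<beta> (Suc k) x"
        using y cnt_class_right[OF E_equiv _ z(2,1)] cnt_class_right[OF E_equiv _ z' yN]
        unfolding nth_class_def by blast
    qed
  qed
qed

lemma not_E_of_cnt: "cnt N (E N \<beta>) (Suc k) x y \<Longrightarrow> \<not> E N \<beta> x y"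
  using cnt_le_imp[OF E_equiv, of \<beta> "Suc k" x y "Suc 0"] cnt_1_iff[OF E_equiv] by simp

lemma E_of_not_cnt: "le N x y \<Longrightarrow> \<not> cnt N (E N \<beta>) k x y \<Longrightarrow> \<beta> < \<alpha> \<Longrightarrow> E N \<alpha> x y"
  using E_le_iff[OF lin, of x y \<alpha>] by blast

lemma nth_class_E: "y \<in> nth_class N \<beta> k x \<Longrightarrow> \<beta> < \<alpha> \<Longrightarrow> E N \<alpha> x y"
  using E_of_not_cnt[OF nth_class_le[of y \<beta> k x], of \<beta> "Suc k" \<alpha>] unfolding nth_class_def by blast

text \<open>The least \<delta> at which \<open>x\<close> and \<open>y\<close> are related supplies
  \<beta> < \<delta> such that the interval meets finitely many
  \<open>E\<^sub>\<beta>\<close>-classes, and by minimality more than one.\<close>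

lemma E_nth_class:
  assumes "le N x y" "x \<noteq> y" "E N \<alpha> x y"
  obtains \<beta> k where "\<beta> < \<alpha>" "y \<in> nth_class N \<beta> (Suc k) x"
proof -
  define \<delta> where "\<delta> = (LEAST \<delta>. E N \<delta> x y)"
  have "E N \<delta> x y" unfolding \<delta>_def by (rule LeastI[of _ \<alpha>]) (rule assms(3))
  then obtain \<beta> k0 where \<beta>: "\<beta> < \<delta>" "\<not> cnt N (E N \<beta>) k0 x y"
    using E_le_iff[OF lin assms(1)] assms(2) by blast
  have "\<not> E N \<beta> x y" using \<beta>(1) unfolding \<delta>_def by (rule not_less_Least)
  define m where "m = (LEAST k. \<not> cnt N (E N \<beta>) k x y)"
  have m: "\<not> cnt N (E N \<beta>) m x y" unfolding m_def by (rule LeastI[of _ k0]) (rule \<beta>(2))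
  have less_m: "cnt N (E N \<beta>) k x y" if "k < m" for k
    using not_less_Least[of k "\<lambda>k. \<not> cnt N (E N \<beta>) k x y"] that unfolding m_def by blast
  \<comment> \<open>The interval meets exactly \<open>m\<close> classes of
    \<open>E\<^sub>\<beta>\<close>, so \<open>m\<close> is at least 2.\<close>
  have "m \<noteq> 0" using m assms(1) by (cases m) auto
  moreover have "m \<noteq> Suc 0" using m cnt_1_iff[OF E_equiv, of \<beta> x y] assms(1) \<open>\<not> E N \<beta> x y\<close> by metis
  ultimately obtain k where "m = Suc (Suc k)" by (metis not0_implies_Suc)
  then have "y \<in> nth_class N \<beta> (Suc k) x" using m less_m[of "Suc k"] by (simp add: nth_class_def del: cnt.simps)
  moreover have "\<delta> \<le> \<alpha>" unfolding \<delta>_def by (rule Least_le) (rule assms(3))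
  ultimately show ?thesis using that \<beta>(1) by (metis less_le_trans)
qed

lemma upper_class_eq: "upper_class N \<alpha> x = (\<Union>(\<beta>, k)\<in>{..<\<alpha>} \<times> UNIV. nth_class N \<beta> (Suc k) x)"
proof
  show "upper_class N \<alpha> x \<subseteq> (\<Union>(\<beta>, k)\<in>{..<\<alpha>} \<times> UNIV. nth_class N \<beta> (Suc k) x)"
  proof
    fix y assume "y \<in> upper_class N \<alpha> x"
    then obtain \<beta> k where "\<beta> < \<alpha>" "y \<in> nth_class N \<beta> (Suc k) x" unfolding upper_class_def using E_nth_class by blast
    then show "y \<in> (\<Union>(\<beta>, k)\<in>{..<\<alpha>} \<times> UNIV. nth_class N \<beta> (Suc k) x)" by blast
  qed
  show "(\<Union>(\<beta>, k)\<in>{..<\<alpha>} \<times> UNIV. nth_class N \<beta> (Suc k) x) \<subseteq> upper_class N \<alpha> x"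
  proof clarify
    fix \<beta> k y assume y: "\<beta> < \<alpha>" "y \<in> nth_class N \<beta> (Suc k) x"
    have "\<not> E N \<beta> x y" using y(2) not_E_of_cnt unfolding nth_class_def by blast
    then show "y \<in> upper_class N \<alpha> x" using nth_class_le[OF y(2)] nth_class_E[OF y(2,1)] unfolding upper_class_def by auto
  qed
qed

text \<open>The summands are ordered lexicographically, first by level: a point of a summand at a
  smaller level is related to \<open>x\<close> at level \<open>\<beta>'\<close>, a point of a
  summand at level \<open>\<beta>'\<close> is not.\<close>

lemma nth_class_less:
  assumes "y \<in> nth_class N \<beta> (Suc k) x" "y' \<in> nth_class N \<beta>' (Suc k') x" "\<beta> < \<beta>' \<or> \<beta> = \<beta>' \<and> k < k'"
  shows "y \<noteq> y' \<and> le N y y'"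
proof (rule ccontr)
  have N: "y \<in> fst N" "y' \<in> fst N" using assms nth_class_subset by blast+
  assume "\<not> (y \<noteq> y' \<and> le N y y')"
  then have le: "le N y' y" using lo(1,4) N by blast
  have *: "cnt N (E N \<beta>') (Suc k') x y'" using assms(2) by (simp add: nth_class_def)
  show False
  proof (cases "\<beta> = \<beta>'")
    case True
    then have "cnt N (E N \<beta>) (Suc k') x y" using cnt_right[OF E_equiv * le] by simp
    moreover have "Suc (Suc k) \<le> Suc k'" using True assms(3) by simp
    ultimately have "cnt N (E N \<beta>) (Suc (Suc k)) x y" by (rule cnt_le_imp[OF E_equiv])
    then show False using assms(1) unfolding nth_class_def by blast
  next
    case False
    then have "E N \<beta>' x y" using nth_class_E assms(1,3) by blast
    then have "E N \<beta>' x y'" using R_convex1[OF E_equiv nth_class_le[OF assms(2)] le] by blast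
    then show False using not_E_of_cnt[OF *] by blast
  qed
qed

lemma nth_class_closer:
  assumes "y \<in> nth_class N \<beta> (Suc k) x"
  shows "\<exists>z. z \<in> nth_class N \<beta> k x"
proof -
  obtain z where z: "cnt N (E N \<beta>) k x z" "le N z y" "\<not> E N \<beta> z y"
    using assms unfolding nth_class_def by auto
  have "\<not> cnt N (E N \<beta>) (Suc k) x z"
    using z(2,3) assms unfolding nth_class_def cnt.simps(2)[of _ _ "Suc k"] by blast
  then show ?thesis using z(1) unfolding nth_class_def by blast
qed

text \<open>\<open>cnt_add\<close> bounds the count from below, \<open>cnt_split\<close> from above.
  Iterated in \<open>weak_full\<close> to fill all places above a point when there is no last
  class.\<close>

lemma nth_class_add:
  assumes "y \<in> nth_class N \<beta> (Suc k) x" "z \<in> nth_class N \<beta> (Suc 0) y"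
  shows "z \<in> nth_class N \<beta> (Suc (Suc k)) x"
proof -
  have "y \<in> fst N" using nth_class_subset assms(1) by blast
  moreover have "cnt N (E N \<beta>) (Suc k + Suc 0) x z"
    using assms cnt_add[OF E_equiv] unfolding nth_class_def by blast
  moreover have "\<not> cnt N (E N \<beta>) (Suc (Suc k)) x y" "\<not> cnt N (E N \<beta>) (Suc (Suc 0)) y z"
    using assms unfolding nth_class_def by blast+
  ultimately have "cnt N (E N \<beta>) (Suc (Suc k)) x z" "\<not> cnt N (E N \<beta>) (Suc (Suc k + Suc 0)) x z"
    using cnt_split[OF E_equiv, of \<beta> "Suc k" "Suc 0" x z y] by (simp_all only: add_Suc_right add_0_right) blast
  then show ?thesis unfolding nth_class_def by (simp only: add_Suc_right add_0_right mem_Collect_eq) blast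
qed

lemma convex_insert_upper_class: "x \<in> fst N \<Longrightarrow> convex N (insert x (upper_class N \<alpha> x))"
  unfolding convex_def
proof (intro conjI ballI allI impI)
  assume x: "x \<in> fst N"
  show "insert x (upper_class N \<alpha> x) \<subseteq> fst N" using x lo(3) unfolding upper_class_def by blast
  fix u v w assume u: "u \<in> insert x (upper_class N \<alpha> x)" "w \<in> insert x (upper_class N \<alpha> x)" "le N u v" "le N v w"
  have "le N x u" "le N x w" "E N \<alpha> x w" using u(1,2) lo(1)[OF x] by (auto simp: upper_class_def)
  then have "le N x v" using lo(6) u(3) by blast
  moreover have "E N \<alpha> x v" using R_convex1[OF E_equiv \<open>le N x v\<close> u(4)] \<open>E N \<alpha> x w\<close> by blast
  ultimately show "v \<in> insert x (upper_class N \<alpha> x)" by (auto simp: upper_class_def)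
qed

end

section \<open>Comparing classes in two orders\<close>

context
  fixes N :: "'a struct" and M :: "'b struct"
  assumes lin: "lin_order N" "lin_order M"
begin

lemma upper_class_eqvI:
  assumes "\<And>\<beta> k. \<beta> < \<alpha> \<Longrightarrow> eqv N (nth_class N \<beta> (Suc k) x) M (nth_class M \<beta> (Suc k) a)"
  shows "eqv N (upper_class N \<alpha> x) M (upper_class M \<alpha> a)"
  unfolding upper_class_eq[OF lin(1)] upper_class_eq[OF lin(2)]
proof (rule eqv_glue[OF lin])
  fix i j :: "ord1 \<times> nat"
  assume "i \<in> {..<\<alpha>} \<times> UNIV" "j \<in> {..<\<alpha>} \<times> UNIV" "i \<noteq> j"
  obtain \<beta> k \<gamma> l where ij: "i = (\<beta>, k)" "j = (\<gamma>, l)" by fastforce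
  have sep: "(\<forall>u\<in>nth_class N \<beta> (Suc k) x. \<forall>v\<in>nth_class N \<gamma> (Suc l) x. u \<noteq> v \<and> le N u v) \<and>
      (\<forall>u\<in>nth_class M \<beta> (Suc k) a. \<forall>v\<in>nth_class M \<gamma> (Suc l) a. u \<noteq> v \<and> le M u v)"
    if "\<beta> < \<gamma> \<or> \<beta> = \<gamma> \<and> k < l" for \<beta> \<gamma> k l
    using nth_class_less[OF lin(1) _ _ that] nth_class_less[OF lin(2) _ _ that] by blast
  have "(\<beta> < \<gamma> \<or> \<beta> = \<gamma> \<and> k < l) \<or> (\<gamma> < \<beta> \<or> \<gamma> = \<beta> \<and> l < k)"
    using \<open>i \<noteq> j\<close> unfolding ij by (auto simp: neq_iff)
  then show "(\<forall>u\<in>case i of (\<beta>, k) \<Rightarrow> nth_class N \<beta> (Suc k) x. \<forall>v\<in>case j of (\<beta>, k) \<Rightarrow> nth_class N \<beta> (Suc k) x. u \<noteq> v \<and> le N u v) \<and>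
      (\<forall>u\<in>case i of (\<beta>, k) \<Rightarrow> nth_class M \<beta> (Suc k) a. \<forall>v\<in>case j of (\<beta>, k) \<Rightarrow> nth_class M \<beta> (Suc k) a. u \<noteq> v \<and> le M u v) \<or>
      (\<forall>u\<in>case i of (\<beta>, k) \<Rightarrow> nth_class N \<beta> (Suc k) x. \<forall>v\<in>case j of (\<beta>, k) \<Rightarrow> nth_class N \<beta> (Suc k) x. u \<noteq> v \<and> le N v u) \<and>
      (\<forall>u\<in>case i of (\<beta>, k) \<Rightarrow> nth_class M \<beta> (Suc k) a. \<forall>v\<in>case j of (\<beta>, k) \<Rightarrow> nth_class M \<beta> (Suc k) a. u \<noteq> v \<and> le M v u)"
    unfolding ij prod.case using sep[of \<beta> \<gamma> k l] sep[of \<gamma> \<beta> l k] by blast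
qed (use assms in \<open>auto dest!: subsetD[OF nth_class_subset[OF lin(1)]] subsetD[OF nth_class_subset[OF lin(2)]]\<close>)

text \<open>A summand is defined by counting from \<open>x\<close>, so the isomorphism is first
  extended by sending \<open>x\<close> to \<open>a\<close>. The enlarged sets are convex, hence
  counts are preserved.\<close>

lemma upper_class_eqvD:
  assumes "eqv N (upper_class N \<alpha> x) M (upper_class M \<alpha> a)" "x \<in> fst N" "a \<in> fst M" "\<beta> < \<alpha>"
  shows "eqv N (nth_class N \<beta> (Suc k) x) M (nth_class M \<beta> (Suc k) a)"
proof -
  let ?A = "insert x (upper_class N \<alpha> x)" and ?B = "insert a (upper_class M \<alpha> a)"
  obtain g where g: "iso_on N (upper_class N \<alpha> x) M (upper_class M \<alpha> a) g" using assms(1) by (auto simp: eqv_def)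
  define f where "f y = (if y = x then a else g y)" for y
  have x: "x \<notin> upper_class N \<alpha> x" "a \<notin> upper_class M \<alpha> a" by (auto simp: upper_class_def)
  have fx: "f x = a" by (simp add: f_def)
  have fR: "f y = g y" if "y \<in> upper_class N \<alpha> x" for y using that x by (auto simp: f_def)
  have gR: "g y \<in> upper_class M \<alpha> a" if "y \<in> upper_class N \<alpha> x" for y
    using that g by (auto simp: iso_on_def bij_betw_def)
  have "bij_betw f (upper_class N \<alpha> x) (upper_class M \<alpha> a)"
    using g fR bij_betw_cong[of "upper_class N \<alpha> x" f g] by (auto simp: iso_on_def)
  then have "bij_betw f ?A ?B" using x fx notIn_Un_bij_betw[of x "upper_class N \<alpha> x" f "upper_class M \<alpha> a"] by simp
  moreover have "le N u v \<longleftrightarrow> le M (f u) (f v)" if "u \<in> ?A" "v \<in> ?A" for u v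
  proof -
    consider "u = x" "v = x" | "u = x" "v \<in> upper_class N \<alpha> x" | "u \<in> upper_class N \<alpha> x" "v = x" | "u \<in> upper_class N \<alpha> x" "v \<in> upper_class N \<alpha> x"
      using \<open>u \<in> ?A\<close> \<open>v \<in> ?A\<close> by blast
    then show ?thesis
    proof cases
      case 1
      then show ?thesis using fx assms(2,3) lin_orderD(1)[OF lin(1)] lin_orderD(1)[OF lin(2)] by simp
    next
      case 2
      then show ?thesis using fx fR gR[OF 2(2)] by (simp add: upper_class_def)
    next
      case 3
      then show ?thesis using fx fR gR[OF 3(1)] lin_orderD(5)[OF lin(1), of x u] lin_orderD(5)[OF lin(2), of a "g u"]
        by (auto simp: upper_class_def)
    next
      case 4
      then show ?thesis using fR g by (simp add: iso_on_def)
    qed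
  qed
  ultimately have f: "iso_on N ?A M ?B f" by (simp add: iso_on_def)
  have cnt: "cnt N (E N \<beta>) j x y \<longleftrightarrow> cnt M (E M \<beta>) j a (f y)" if "y \<in> ?A" for y j
    using cnt_E_iso[OF lin convex_insert_upper_class[OF lin(1) assms(2)] convex_insert_upper_class[OF lin(2) assms(3)] f _ that] fx
    by simp
  have nth_class: "nth_class N \<beta> (Suc k) x \<subseteq> ?A" "nth_class M \<beta> (Suc k) a \<subseteq> ?B"
    unfolding upper_class_eq[OF lin(1)] upper_class_eq[OF lin(2)] using assms(4) by blast+
  have iff: "f y \<in> nth_class M \<beta> (Suc k) a \<longleftrightarrow> y \<in> nth_class N \<beta> (Suc k) x" if "y \<in> ?A" for y
    unfolding nth_class_def mem_Collect_eq cnt[OF that] ..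
  have "f ` nth_class N \<beta> (Suc k) x = nth_class M \<beta> (Suc k) a"
  proof
    show "f ` nth_class N \<beta> (Suc k) x \<subseteq> nth_class M \<beta> (Suc k) a" using iff nth_class(1) by blast
    show "nth_class M \<beta> (Suc k) a \<subseteq> f ` nth_class N \<beta> (Suc k) x"
    proof
      fix b assume b: "b \<in> nth_class M \<beta> (Suc k) a"
      then obtain y where "y \<in> ?A" "b = f y" using nth_class(2) f unfolding iso_on_def bij_betw_def by blast
      then show "b \<in> f ` nth_class N \<beta> (Suc k) x" using iff b by blast
    qed
  qed
  then have "iso_on N (nth_class N \<beta> (Suc k) x) M (nth_class M \<beta> (Suc k) a) f" using iso_on_subset[OF f nth_class(1)] by blast
  then show ?thesis unfolding eqv_def by blast
qed

lemma class_of_eqvI: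
  assumes "x \<in> fst N" "a \<in> fst M" "eqv N (upper_class N \<alpha> x) M (upper_class M \<alpha> a)"
    "eqv N (upper_class (dual N) \<alpha> x) M (upper_class (dual M) \<alpha> a)"
  shows "eqv N (class_of N \<alpha> x) M (class_of M \<alpha> a)"
proof -
  have class_of: "class_of K \<alpha> y = (\<Union>i\<in>{0, 1, 2 :: nat}. if i = 0 then upper_class (dual K) \<alpha> y else if i = 1 then {y} else upper_class K \<alpha> y)"
    if K: "lin_order K" "y \<in> fst K" for K :: "'c struct" and y
  proof -
    have "z \<in> class_of K \<alpha> y \<longleftrightarrow> z \<in> upper_class (dual K) \<alpha> y \<or> z = y \<or> z \<in> upper_class K \<alpha> y" for z
      using K lin_orderD(2,3)[OF K(1), of y z] lin_orderD(2,3)[OF K(1), of z y] lin_orderD(4)[OF K(1), of y z]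
        E_dual[OF K(1), of \<alpha>] by (auto simp: class_of_def upper_class_def)
    then show ?thesis by auto
  qed
  have sep: "u \<noteq> v \<and> le K u v"
    if K: "lin_order K" "y \<in> fst K" and ij: "i < j" "u \<in> (if i = 0 then upper_class (dual K) \<alpha> y else if i = 1 then {y} else upper_class K \<alpha> y)"
      "v \<in> (if j = 0 then upper_class (dual K) \<alpha> y else if j = 1 then {y} else upper_class K \<alpha> y)" "i < 3" "j < 3"
    for K :: "'c struct" and u v y and i j :: nat
  proof -
    have "i = 0 \<and> j = 1 \<or> i = 0 \<and> j = 2 \<or> i = 1 \<and> j = 2" using ij(1,4,5) by linarith
    then show ?thesis
      using ij(2,3) lin_orderD(6)[OF K(1), of u y v] lin_orderD(5)[OF K(1), of u y]
      by (auto simp: upper_class_def)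
  qed
  show ?thesis unfolding class_of[OF lin(1) assms(1)] class_of[OF lin(2) assms(2)]
  proof (rule eqv_glue[OF lin], goal_cases)
    case (1 i)
    then show ?case using assms(1) lin_orderD(2)[OF lin(1), of _ x] lin_orderD(3)[OF lin(1), of x] by (auto simp: upper_class_def)
  next
    case (2 i)
    then show ?case using assms(2) lin_orderD(2)[OF lin(2), of _ a] lin_orderD(3)[OF lin(2), of a] by (auto simp: upper_class_def)
  next
    case (3 i)
    then show ?case using assms eqv_singleton[OF lin] by simp
  next
    case (4 i j)
    then have *: "i < 3" "j < 3" "i < j \<or> j < i" by auto
    from *(3) show ?case
    proof
      assume "i < j"
      show ?thesis
        by (rule disjI1, intro conjI ballI)
          (use sep[OF lin(1) assms(1) \<open>i < j\<close> _ _ *(1,2)] sep[OF lin(2) assms(2) \<open>i < j\<close> _ _ *(1,2)] in blast)+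
    next
      assume "j < i"
      show ?thesis
        by (rule disjI2, intro conjI ballI)
          (use sep[OF lin(1) assms(1) \<open>j < i\<close> _ _ *(2,1)] sep[OF lin(2) assms(2) \<open>j < i\<close> _ _ *(2,1)] in blast)+
    qed
  qed
qed

lemma class_of_eqvD:
  assumes "eqv N (class_of N \<alpha> x) M (class_of M \<alpha> a)" "x \<in> fst N" "a \<in> fst M"
  shows "\<exists>y\<in>fst N. E N \<alpha> x y \<and> eqv N (upper_class N \<alpha> y) M (upper_class M \<alpha> a) \<and> eqv N (upper_class (dual N) \<alpha> y) M (upper_class (dual M) \<alpha> a)"
proof -
  obtain f where f: "iso_on N (class_of N \<alpha> x) M (class_of M \<alpha> a) f" using assms(1) by (auto simp: eqv_def)
  have "a \<in> class_of M \<alpha> a" using assms(3) by (simp add: class_of_def)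
  \<comment> \<open>The point playing the role of \<open>a\<close>; the isomorphism then splits at
    \<open>y\<close> and \<open>a\<close> into upper and lower parts.\<close>
  then obtain y where y: "y \<in> class_of N \<alpha> x" "f y = a" using f unfolding iso_on_def bij_betw_def by force
  then have yN: "y \<in> fst N" "E N \<alpha> x y" by (auto simp: class_of_def)
  have Cy: "class_of N \<alpha> x = class_of N \<alpha> y" using class_of_eq[OF lin(1) assms(2) yN] .
  have f1: "f u = a \<longleftrightarrow> u = y" "le M a (f u) \<longleftrightarrow> le N y u" "le M (f u) a \<longleftrightarrow> le N u y" if "u \<in> class_of N \<alpha> x" for u
  proof -
    have "inj_on f (class_of N \<alpha> x)" and le: "\<forall>v\<in>class_of N \<alpha> x. \<forall>w\<in>class_of N \<alpha> x. le N v w \<longleftrightarrow> le M (f v) (f w)"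
      using f by (simp_all add: iso_on_def bij_betw_def)
    then show "f u = a \<longleftrightarrow> u = y" using inj_on_eq_iff[of f "class_of N \<alpha> x" u y] that y by simp
    show "le M a (f u) \<longleftrightarrow> le N y u" "le M (f u) a \<longleftrightarrow> le N u y"
      using le that y(1) unfolding y(2)[symmetric] by blast+
  qed
  have fC: "f ` class_of N \<alpha> x = class_of M \<alpha> a" using f by (simp add: iso_on_def bij_betw_def)
  have upper_class: "upper_class K \<beta> z = {u \<in> class_of K \<beta> z. u \<noteq> z \<and> le K z u}"
    "upper_class (dual K) \<beta> z = {u \<in> class_of K \<beta> z. u \<noteq> z \<and> le K u z}" if "lin_order K" for K :: "'c struct" and \<beta> z
    using lin_orderD(2)[OF that, of _ z] lin_orderD(3)[OF that, of z] E_dual[OF that] by (auto simp: upper_class_def class_of_def)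
  have "f ` {u \<in> class_of N \<alpha> x. u \<noteq> y \<and> le N y u} = {u \<in> f ` class_of N \<alpha> x. u \<noteq> a \<and> le M a u}"
    "f ` {u \<in> class_of N \<alpha> x. u \<noteq> y \<and> le N u y} = {u \<in> f ` class_of N \<alpha> x. u \<noteq> a \<and> le M u a}"
    by (intro set_eqI iffI; clarsimp simp: f1; fail)+
  then have "f ` upper_class N \<alpha> y = upper_class M \<alpha> a" "f ` upper_class (dual N) \<alpha> y = upper_class (dual M) \<alpha> a"
    using fC unfolding upper_class[OF lin(1)] upper_class[OF lin(2)] Cy by simp_all
  moreover have "upper_class N \<alpha> y \<subseteq> class_of N \<alpha> x" "upper_class (dual N) \<alpha> y \<subseteq> class_of N \<alpha> x"
    unfolding upper_class[OF lin(1)] Cy by auto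
  ultimately have "eqv N (upper_class N \<alpha> y) M (upper_class M \<alpha> a)" "eqv N (upper_class (dual N) \<alpha> y) M (upper_class (dual M) \<alpha> a)"
    unfolding eqv_def using iso_on_subset[OF f] by (metis (no_types))+
  then show ?thesis using yN by blast
qed

text \<open>The representative \<open>a\<close> is fixed and its counterpart \<open>y\<close> is
  quantified. With parts of \<Pi> level 2\<alpha>+1, the type of a class becomes \<Sigma> of level
  2\<alpha>+2.\<close>

lemma class_of_eqv_iff:
  assumes "x \<in> fst N" "a \<in> fst M"
  shows "eqv N (class_of N \<alpha> x) M (class_of M \<alpha> a) \<longleftrightarrow> (\<exists>y\<in>fst N. E N \<alpha> x y \<and>
    eqv N (upper_class N \<alpha> y) M (upper_class M \<alpha> a) \<and> eqv N (upper_class (dual N) \<alpha> y) M (upper_class (dual M) \<alpha> a))"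
  using class_of_eqvD[OF _ assms] class_of_eqvI[OF _ assms(2)] class_of_eq[OF lin(1) assms(1)] by metis

lemma nth_class_eqv_class_of_iff:
  assumes "a \<in> fst M"
  shows "eqv N (nth_class N \<beta> (Suc k) x) M (class_of M \<beta> a) \<longleftrightarrow> (\<exists>y\<in>nth_class N \<beta> (Suc k) x. eqv N (class_of N \<beta> y) M (class_of M \<beta> a))"
proof
  assume l: "eqv N (nth_class N \<beta> (Suc k) x) M (class_of M \<beta> a)"
  have "a \<in> class_of M \<beta> a" using assms by (simp add: class_of_def)
  then have "nth_class N \<beta> (Suc k) x \<noteq> {}" using l eqv_empty[of N M "class_of M \<beta> a"] by auto
  then obtain y where "y \<in> nth_class N \<beta> (Suc k) x" by blast
  then show "\<exists>y\<in>nth_class N \<beta> (Suc k) x. eqv N (class_of N \<beta> y) M (class_of M \<beta> a)" using l nth_class_eq_class_of[OF lin(1)] by metis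
qed (use nth_class_eq_class_of[OF lin(1)] in metis)

end

section \<open>Definability of the condensations and of their classes\<close>

lemma Qf_dual: "Qf n P \<Longrightarrow> Qf n (\<lambda>N v. P (dual N) v)"
  by (induction rule: Qf.induct) (auto intro: Qf.intros)

lemma Sg_dual: "Sg \<alpha> n P \<Longrightarrow> Sg \<alpha> n (\<lambda>N v. P (dual N) v)"
proof (induction rule: Sg.induct)
  case (zero n Q P)
  show ?case
    by (rule Sg.zero[OF Qf_dual[OF zero(1)]]) (use zero(2) in \<open>simp add: valid_def\<close>)
next
  case (pos \<alpha> S n P)
  let ?h = "\<lambda>(k, Q). (k, \<lambda>N w. Q (dual N) w)"
  show ?case
  proof (rule Sg.pos[OF pos.hyps(1), of "?h ` S"])
    show "countable (?h ` S)" using pos.hyps(2) by blast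
    fix k Q' assume "(k, Q') \<in> ?h ` S"
    then obtain Q where Q: "(k, Q) \<in> S" "Q' = (\<lambda>N w. Q (dual N) w)" by auto
    show "\<exists>\<beta><\<alpha>. Pi \<beta> (n + k) Q'" unfolding Q(2) using pos.IH[OF Q(1)] by blast
  next
    fix N :: "nat struct" and v assume "valid n N v"
    then have "valid n (dual N) v" by (simp add: valid_def)
    then show "P (dual N) v \<longleftrightarrow> (\<exists>(k, Q)\<in>?h ` S. \<exists>w. extends n k N v w \<and> Q N w)"
      using pos.hyps(3)[of "dual N" v] by (simp add: case_prod_unfold extends_def)
  qed
qed

lemma Sg_le: "i < n \<Longrightarrow> j < n \<Longrightarrow> Sg \<alpha> n (\<lambda>N v. le N (v i) (v j))"
  by (intro Sg_qf Qf.le)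

lemma pos_double_ord1: "0 < \<alpha> \<Longrightarrow> 0 < (2 * \<alpha> :: ord1)"
  using double_succ_le_ord1[of 0 \<alpha>] pos_succ_ord1 by (metis less_le_trans)

text \<open>The bound on \<open>E\<^sub>\<beta>\<close> is an assumption so that the lemma can be
  used inside the induction of \<open>Sg_E\<close>. Each step puts a \<Pi> condition of level
  2\<beta> under an existential quantifier.\<close>

lemma Sg_cnt_aux:
  assumes "\<And>n i j. i < n \<Longrightarrow> j < n \<Longrightarrow> Sg (2 * \<beta>) n (\<lambda>N v. E N \<beta> (v i) (v j))"
  shows "i < n \<Longrightarrow> j < n \<Longrightarrow> Sg (2 * \<beta> + 1) n (\<lambda>N v. cnt N (E N \<beta>) k (v i) (v j))"
proof (induction k arbitrary: n i j)
  case 0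
  then show ?case using Sg_le by simp
next
  case (Suc k)
  have "Sg (2 * \<beta> + 1) (Suc n) (\<lambda>N v. cnt N (E N \<beta>) k (v i) (v n) \<and> le N (v n) (v j) \<and> \<not> E N \<beta> (v n) (v j))"
  proof (intro Sg_conj Suc.IH Sg_le)
    show "Sg (2 * \<beta> + 1) (Suc n) (\<lambda>N v. \<not> E N \<beta> (v n) (v j))"
      by (rule Sg_less_Pi[OF assms less_succ_ord1]) (use Suc.prems in auto)
  qed (use Suc.prems in auto)
  from Sg_Ex[OF pos_succ_ord1 this] show ?case
  proof (rule Sg_cong)
    fix N v assume "valid n N v"
    then have "z \<in> fst N" if "le N z (v j)" for z
      using that lin_orderD(2)[of N] by (simp add: valid_def)
    then show "cnt N (E N \<beta>) (Suc k) (v i) (v j) \<longleftrightarrow>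
      (\<exists>a\<in>fst N. cnt N (E N \<beta>) k ((v(n := a)) i) ((v(n := a)) n) \<and>
        le N ((v(n := a)) n) ((v(n := a)) j) \<and> \<not> E N \<beta> ((v(n := a)) n) ((v(n := a)) j))"
      using Suc.prems by auto
  qed
qed

text \<open>A countable disjunction over \<beta> < \<alpha> of negated counts, which are \<Pi> of
  level 2\<beta>+1 < 2\<alpha>.\<close>

lemma Sg_E: "i < n \<Longrightarrow> j < n \<Longrightarrow> Sg (2 * \<alpha>) n (\<lambda>N v. E N \<alpha> (v i) (v j))"
proof (induction \<alpha> arbitrary: n i j rule: less_induct)
  case (less \<alpha>)
  have eq: "Sg \<gamma> n (\<lambda>N v. v i = v j)" for \<gamma> using less.prems by (intro Sg_qf Qf.eq)
  show ?case
  proof (cases "\<alpha> = 0")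
    case True
    then show ?thesis using eq by (simp add: E_iff[of _ 0] not_less_zero_ord1)
  next
    case False
    then have "0 < 2 * \<alpha>" using zero_le_ord1[of \<alpha>] by (intro pos_double_ord1) simp
    have "Sg (2 * \<alpha>) n (\<lambda>N v. v i = v j \<or> (\<exists>p\<in>{..<\<alpha>} \<times> UNIV.
      \<not> cnt N (E N (fst p)) (snd p) (v i) (v j) \<and> \<not> cnt N (E N (fst p)) (snd p) (v j) (v i)))"
    proof (intro Sg_disj eq Sg_Union[OF \<open>0 < 2 * \<alpha>\<close>] Sg_conj)
      show "countable ({..<\<alpha>} \<times> (UNIV :: nat set))" using countable_lessThan_ord1 by blast
      fix p assume "p \<in> {..<\<alpha>} \<times> (UNIV :: nat set)"
      then have p: "fst p < \<alpha>" by auto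
      then have "2 * fst p + 1 < 2 * \<alpha>" using double_succ_le_ord1[of "fst p" \<alpha>] less_succ_ord1 by (metis less_le_trans)
      then show "Pi (2 * \<alpha>) n (\<lambda>N v. cnt N (E N (fst p)) (snd p) (v i) (v j))"
        "Pi (2 * \<alpha>) n (\<lambda>N v. cnt N (E N (fst p)) (snd p) (v j) (v i))"
        using Sg_less_Pi[OF Sg_cnt_aux[OF less.IH[OF p]]] less.prems by blast+
    qed
    then show ?thesis by (rule Sg_cong) (auto simp: E_iff[of _ \<alpha>])
  qed
qed

lemma Sg_cnt: "i < n \<Longrightarrow> j < n \<Longrightarrow> Sg (2 * \<beta> + 1) n (\<lambda>N v. cnt N (E N \<beta>) k (v i) (v j))"
  by (rule Sg_cnt_aux[OF Sg_E])

text \<open>A difference of two \<Sigma> conditions of level 2\<beta>+1, hence one level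
  higher.\<close>

lemma Sg_nth_class: "i < n \<Longrightarrow> j < n \<Longrightarrow> Sg (2 * \<beta> + 1 + 1) n (\<lambda>N v. v j \<in> nth_class N \<beta> k (v i))"
  unfolding nth_class_def mem_Collect_eq
  by (rule Sg_conj[OF Sg_mono[OF Sg_cnt less_imp_le[OF less_succ_ord1]] Sg_less_Pi[OF Sg_cnt less_succ_ord1]])

lemma Sg_nth_class_nonempty:
  assumes "i < n"
  shows "Sg (2 * \<beta> + 1 + 1) n (\<lambda>N v. nth_class N \<beta> k (v i) \<noteq> {})"
proof -
  have "Sg (2 * \<beta> + 1 + 1) (Suc n) (\<lambda>N v. v n \<in> nth_class N \<beta> k (v i))"
    using assms by (intro Sg_nth_class) auto
  from Sg_Ex[OF pos_succ_ord1 this] show ?thesis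
  proof (rule Sg_cong)
    fix N v assume "valid n N v"
    then have "nth_class N \<beta> k (v i) \<subseteq> fst N" by (intro nth_class_subset) (simp add: valid_def)
    then show "nth_class N \<beta> k (v i) \<noteq> {} \<longleftrightarrow> (\<exists>a\<in>fst N. (v(n := a)) n \<in> nth_class N \<beta> k ((v(n := a)) i))"
      using assms by (simp, blast)
  qed
qed

context
  fixes \<beta> :: ord1
  assumes Pi_upper_class_\<beta>: "\<And>(M :: 'a struct) a n i. lin_order M \<Longrightarrow> countable (fst M) \<Longrightarrow> a \<in> fst M \<Longrightarrow> i < n \<Longrightarrow>
    Pi (2 * \<beta> + 1) n (\<lambda>N v. eqv N (upper_class N \<beta> (v i)) M (upper_class M \<beta> a))"
begin

text \<open>The assumption of the context is the induction hypothesis of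
  \<open>Pi_upper_class\<close>. Applied to \<open>dual M\<close> and reversed by
  \<open>Sg_dual\<close>, it covers lower parts too.\<close>

lemma Sg_class_of_aux:
  fixes M :: "'a struct"
  assumes M: "lin_order M" "countable (fst M)" "a \<in> fst M" and i: "i < n"
  shows "Sg (2 * \<beta> + 1 + 1) n (\<lambda>N v. eqv N (class_of N \<beta> (v i)) M (class_of M \<beta> a))"
proof -
  have "Pi (2 * \<beta> + 1) (Suc n) (\<lambda>N v. eqv N (upper_class N \<beta> (v n)) (dual M) (upper_class (dual M) \<beta> a))"
    using M by (intro Pi_upper_class_\<beta>) auto
  from Sg_dual[OF this] have "Pi (2 * \<beta> + 1) (Suc n) (\<lambda>N v. eqv N (upper_class (dual N) \<beta> (v n)) M (upper_class (dual M) \<beta> a))"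
    unfolding eqv_dual .
  moreover have "Pi (2 * \<beta> + 1) (Suc n) (\<lambda>N v. eqv N (upper_class N \<beta> (v n)) M (upper_class M \<beta> a))"
    using M by (intro Pi_upper_class_\<beta>) auto
  moreover have "Sg (2 * \<beta> + 1 + 1) (Suc n) (\<lambda>N v. E N \<beta> (v i) (v n))"
    by (rule Sg_mono[OF Sg_mono[OF Sg_E less_imp_le[OF less_succ_ord1]] less_imp_le[OF less_succ_ord1]])
      (use i in auto)
  ultimately have "Sg (2 * \<beta> + 1 + 1) (Suc n) (\<lambda>N v. E N \<beta> (v i) (v n) \<and>
    eqv N (upper_class N \<beta> (v n)) M (upper_class M \<beta> a) \<and> eqv N (upper_class (dual N) \<beta> (v n)) M (upper_class (dual M) \<beta> a))"
    by (intro Sg_conj) (assumption | rule Pi_less_Sg[OF _ less_succ_ord1])+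
  from Sg_Ex[OF pos_succ_ord1 this] show ?thesis
  proof (rule Sg_cong)
    fix N v assume "valid n N v"
    then show "eqv N (class_of N \<beta> (v i)) M (class_of M \<beta> a) \<longleftrightarrow> (\<exists>b\<in>fst N. E N \<beta> ((v(n := b)) i) ((v(n := b)) n) \<and>
        eqv N (upper_class N \<beta> ((v(n := b)) n)) M (upper_class M \<beta> a) \<and>
        eqv N (upper_class (dual N) \<beta> ((v(n := b)) n)) M (upper_class (dual M) \<beta> a))"
      using i class_of_eqv_iff[of N M "v i" a \<beta>] M by (simp add: valid_def)
  qed
qed

lemma Sg_nth_class_class_of_aux:
  fixes M :: "'a struct"
  assumes M: "lin_order M" "countable (fst M)" "a \<in> fst M" and i: "i < n"
  shows "Sg (2 * \<beta> + 1 + 1) n (\<lambda>N v. eqv N (nth_class N \<beta> (Suc k) (v i)) M (class_of M \<beta> a))"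
proof -
  have "Sg (2 * \<beta> + 1 + 1) (Suc n) (\<lambda>N v. v n \<in> nth_class N \<beta> (Suc k) (v i) \<and> eqv N (class_of N \<beta> (v n)) M (class_of M \<beta> a))"
    using i M by (intro Sg_conj Sg_nth_class Sg_class_of_aux) auto
  from Sg_Ex[OF pos_succ_ord1 this] show ?thesis
  proof (rule Sg_cong)
    fix N v assume "valid n N v"
    then have N: "lin_order N" by (simp add: valid_def)
    show "eqv N (nth_class N \<beta> (Suc k) (v i)) M (class_of M \<beta> a) \<longleftrightarrow> (\<exists>b\<in>fst N. (v(n := b)) n \<in> nth_class N \<beta> (Suc k) ((v(n := b)) i) \<and>
        eqv N (class_of N \<beta> ((v(n := b)) n)) M (class_of M \<beta> a))"
      using i nth_class_eqv_class_of_iff[OF N M(1,3), of \<beta> k "v i"] nth_class_subset[OF N, of \<beta> "Suc k" "v i"] by auto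
  qed
qed

text \<open>If the place is empty in \<open>M\<close>, emptiness in \<open>N\<close> negates a
  \<Sigma> condition of level 2\<beta>+2. Otherwise it is a class of \<open>M\<close>, the condition
  is itself \<Sigma> of that level, and the strict bound on \<gamma> makes it \<Pi>.\<close>

lemma Pi_nth_class_eqv_aux:
  fixes M :: "'a struct"
  assumes M: "lin_order M" "countable (fst M)" "a \<in> fst M" and i: "i < n" and \<gamma>: "2 * \<beta> + 1 + 1 < \<gamma>"
  shows "Pi \<gamma> n (\<lambda>N v. eqv N (nth_class N \<beta> (Suc k) (v i)) M (nth_class M \<beta> (Suc k) a))"
proof (cases "nth_class M \<beta> (Suc k) a = {}")
  case True
  then have eq: "eqv N (nth_class N \<beta> (Suc k) x) M (nth_class M \<beta> (Suc k) a) \<longleftrightarrow> \<not> nth_class N \<beta> (Suc k) x \<noteq> {}" for N :: "nat struct" and x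
    using eqv_empty[of M N "nth_class N \<beta> (Suc k) x"] eqv_sym[of N _ M] eqv_sym[of M _ N] by auto
  show ?thesis unfolding eq
    using Sg_mono[OF Sg_nth_class_nonempty[OF i, of \<beta> "Suc k"] less_imp_le[OF \<gamma>]] by simp
next
  case False
  then obtain b where b: "b \<in> nth_class M \<beta> (Suc k) a" by blast
  then have "b \<in> fst M" using nth_class_subset[OF M(1)] by blast
  then show ?thesis unfolding nth_class_eq_class_of[OF M(1) b]
    by (intro Sg_less_Pi[OF Sg_nth_class_class_of_aux[OF M(1,2) _ i] \<gamma>])
qed

end

text \<open>A countable conjunction over the places of the upper part, each of level 2\<beta>+2
  \<le> 2\<alpha>, so that one further level suffices.\<close>

lemma Pi_upper_class:
  fixes M :: "'a struct"
  shows "lin_order M \<Longrightarrow> countable (fst M) \<Longrightarrow> a \<in> fst M \<Longrightarrow> i < n \<Longrightarrow>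
    Pi (2 * \<alpha> + 1) n (\<lambda>N v. eqv N (upper_class N \<alpha> (v i)) M (upper_class M \<alpha> a))"
proof (induction \<alpha> arbitrary: M a n i rule: less_induct)
  case (less \<alpha>)
  let ?I = "{..<\<alpha>} \<times> (UNIV :: nat set)"
  have "Pi (2 * \<alpha> + 1) n (\<lambda>N v. \<forall>p\<in>?I. eqv N (nth_class N (fst p) (Suc (snd p)) (v i)) M (nth_class M (fst p) (Suc (snd p)) a))"
  proof (rule Pi_Inter[OF pos_succ_ord1])
    show "countable ?I" using countable_lessThan_ord1 by blast
    fix p assume "p \<in> ?I"
    then have p: "fst p < \<alpha>" by auto
    then have "2 * fst p + 1 + 1 < 2 * \<alpha> + 1" using double_succ_le_ord1 less_succ_ord1 by (metis le_less_trans)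
    then show "Pi (2 * \<alpha> + 1) n (\<lambda>N v. eqv N (nth_class N (fst p) (Suc (snd p)) (v i)) M (nth_class M (fst p) (Suc (snd p)) a))"
      by (intro Pi_nth_class_eqv_aux[OF less.IH[OF p] less.prems])
  qed
  then show ?case
  proof (rule Sg_cong)
    fix N v assume "valid n N v"
    then have N: "lin_order N" "v i \<in> fst N" using less.prems(4) by (auto simp: valid_def)
    show "(\<not> eqv N (upper_class N \<alpha> (v i)) M (upper_class M \<alpha> a)) \<longleftrightarrow>
      \<not> (\<forall>p\<in>?I. eqv N (nth_class N (fst p) (Suc (snd p)) (v i)) M (nth_class M (fst p) (Suc (snd p)) a))"
      using upper_class_eqvI[OF N(1) less.prems(1), of \<alpha> "v i" a] upper_class_eqvD[OF N(1) less.prems(1) _ N(2) less.prems(3), of \<alpha>]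
      by auto
  qed
qed

lemma Sg_nth_class_class_of:
  fixes M :: "'a struct"
  assumes "lin_order M" "countable (fst M)" "a \<in> fst M" "i < n"
  shows "Sg (2 * \<beta> + 1 + 1) n (\<lambda>N v. eqv N (nth_class N \<beta> (Suc k) (v i)) M (class_of M \<beta> a))"
  by (rule Sg_nth_class_class_of_aux[OF Pi_upper_class assms])

lemma Pi_nth_class_eqv:
  fixes M :: "'a struct"
  assumes "lin_order M" "countable (fst M)" "a \<in> fst M" "i < n" "2 * \<beta> + 1 + 1 < \<gamma>"
  shows "Pi \<gamma> n (\<lambda>N v. eqv N (nth_class N \<beta> (Suc k) (v i)) M (nth_class M \<beta> (Suc k) a))"
  by (rule Pi_nth_class_eqv_aux[OF Pi_upper_class assms])

section \<open>The Scott sentence\<close>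

text \<open>A count of \<open>i\<close> means \<open>i + 1\<close> classes, so at least
  \<open>i\<close> classes of \<open>E\<^sub>\<alpha>\<close> lie to the left of that of
  \<open>x\<close>; \<open>up\<close> is the same on the right.\<close>

definition low :: "'a struct \<Rightarrow> ord1 \<Rightarrow> nat \<Rightarrow> 'a \<Rightarrow> bool" where
  "low N \<alpha> i x \<longleftrightarrow> (\<exists>w\<in>fst N. cnt N (E N \<alpha>) i w x)"

definition up :: "'a struct \<Rightarrow> ord1 \<Rightarrow> nat \<Rightarrow> 'a \<Rightarrow> bool" where
  "up N \<alpha> i x \<longleftrightarrow> (\<exists>w\<in>fst N. cnt N (E N \<alpha>) i x w)"

definition ith_class :: "'a struct \<Rightarrow> ord1 \<Rightarrow> nat \<Rightarrow> 'a set" where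
  "ith_class N \<alpha> i = {x \<in> fst N. low N \<alpha> i x \<and> \<not> low N \<alpha> (Suc i) x}"

text \<open>By \<open>upper_class_eqvI\<close> this makes the upper parts of \<open>a\<close> and
  \<open>c\<close> isomorphic.\<close>

definition full :: "'b struct \<Rightarrow> ord1 \<Rightarrow> 'b \<Rightarrow> 'a struct \<Rightarrow> 'a \<Rightarrow> bool" where
  "full L \<alpha> c N a \<longleftrightarrow> (\<forall>\<beta><\<alpha>. \<forall>k. eqv N (nth_class N \<beta> (Suc k) a) L (nth_class L \<beta> (Suc k) c))"

text \<open>
  For \<open>\<alpha> = \<beta> + 1\<close> the condition \<open>full\<close> is \<open>\<Pi>\<^bsub>2\<alpha>+1\<^esub>\<close> only. Excluding the wrong types of \<open>E\<^sub>\<beta>\<close>-classes that occur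
  in \<open>L\<close>, instead of requiring the right ones, is \<open>\<Pi>\<^bsub>2\<alpha>\<^esub>\<close>.
\<close>

definition weak :: "'b struct \<Rightarrow> ord1 \<Rightarrow> 'b \<Rightarrow> 'a struct \<Rightarrow> 'a \<Rightarrow> bool" where
  "weak L \<alpha> c N a \<longleftrightarrow> (\<forall>\<beta><\<alpha>. \<forall>k.
     (\<beta> + 1 < \<alpha> \<longrightarrow> eqv N (nth_class N \<beta> (Suc k) a) L (nth_class L \<beta> (Suc k) c)) \<and>
     (\<forall>b\<in>fst L. eqv N (nth_class N \<beta> (Suc k) a) L (class_of L \<beta> b) \<longrightarrow> eqv L (nth_class L \<beta> (Suc k) c) L (class_of L \<beta> b)))"

definition sides :: "('b struct \<Rightarrow> ord1 \<Rightarrow> 'b \<Rightarrow> 'a struct \<Rightarrow> 'a \<Rightarrow> bool) \<Rightarrow>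
    'b struct \<Rightarrow> ord1 \<Rightarrow> 'b \<Rightarrow> 'a struct \<Rightarrow> 'a \<Rightarrow> bool" where
  "sides P L \<alpha> c N a \<longleftrightarrow> P L \<alpha> c N a \<and> P (dual L) \<alpha> c (dual N) a"

text \<open>
  \<open>good L \<alpha> c\<close> chooses the representative of an \<open>E\<^sub>\<alpha>\<close>-class, \<open>\<alpha> = \<beta> + 1\<close>: it lies in the last or in the
  first \<open>E\<^sub>\<beta>\<close>-class whenever there is one.
\<close>

definition good :: "'a struct \<Rightarrow> ord1 \<Rightarrow> 'a \<Rightarrow> bool" where
  "good L \<alpha> c \<longleftrightarrow> (\<forall>\<beta>. \<alpha> = \<beta> + 1 \<longrightarrow> nth_class L \<beta> (Suc 0) c = {} \<or> nth_class (dual L) \<beta> (Suc 0) c = {} \<or>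
     (\<forall>a\<in>class_of L \<alpha> c. nth_class L \<beta> (Suc 0) a \<noteq> {} \<and> nth_class (dual L) \<beta> (Suc 0) a \<noteq> {}))"

text \<open>The clauses say that there are at most \<open>n\<close> classes, that the
  \<open>i\<close>-th has a point satisfying the weak condition, and that all such points have the
  right parts. Under the existential quantifier the place is fixed by \<open>low\<close> and
  \<open>up\<close>, not by a negation of \<open>low\<close>, which keeps the second clause \<Sigma>
  of level 2\<alpha>+1.\<close>

definition scott :: "'b struct \<Rightarrow> ord1 \<Rightarrow> nat \<Rightarrow> (nat \<Rightarrow> 'b) \<Rightarrow> 'a struct \<Rightarrow> bool" where
  "scott L \<alpha> n c N \<longleftrightarrow> (\<forall>x\<in>fst N. \<forall>y\<in>fst N. \<not> cnt N (E N \<alpha>) n x y) \<and>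
     (\<forall>i\<in>{..<n}. \<exists>a\<in>fst N. low N \<alpha> i a \<and> up N \<alpha> (n - Suc i) a \<and> sides weak L \<alpha> (c i) N a) \<and>
     (\<forall>i\<in>{..<n}. \<forall>a\<in>fst N. low N \<alpha> (Suc i) a \<or> up N \<alpha> (n - i) a \<or>
        \<not> sides weak L \<alpha> (c i) N a \<or> sides full L \<alpha> (c i) N a)"

section \<open>Choice of representatives\<close>

lemma class_of_dual: "lin_order N \<Longrightarrow> class_of (dual N) \<alpha> x = class_of N \<alpha> x"
  by (simp add: class_of_def E_dual)

lemma good_dual: "lin_order L \<Longrightarrow> good (dual L) \<alpha> c \<longleftrightarrow> good L \<alpha> c"
  unfolding good_def by (auto simp: class_of_dual)

lemma succ_inject_ord1: "\<beta> + 1 = \<gamma> + 1 \<Longrightarrow> \<beta> = (\<gamma> :: ord1)"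
  using less_plus_one_iff_ord1 by (metis order.antisym less_succ_ord1)

text \<open>A point with no next \<open>E\<^sub>\<beta>\<close>-class on one side is taken if the
  class has one; if not, the last alternative of \<open>good\<close> holds for any choice.\<close>

lemma exists_good:
  assumes L: "lin_order L" "x \<in> fst L"
  shows "\<exists>c\<in>class_of L \<alpha> x. good L \<alpha> c"
proof (cases "\<exists>\<beta>. \<alpha> = \<beta> + 1")
  case True
  then obtain \<beta> where \<alpha>: "\<alpha> = \<beta> + 1" by blast
  then have \<beta>: "\<gamma> = \<beta>" if "\<alpha> = \<gamma> + 1" for \<gamma> using that succ_inject_ord1 by metis
  show ?thesis
  proof (cases "\<exists>c\<in>class_of L \<alpha> x. nth_class L \<beta> (Suc 0) c = {} \<or> nth_class (dual L) \<beta> (Suc 0) c = {}")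
    case True
    then show ?thesis using \<beta> unfolding good_def by metis
  next
    case False
    moreover have "x \<in> class_of L \<alpha> x" using L(2) by (simp add: class_of_def)
    ultimately show ?thesis using \<beta> unfolding good_def by metis
  qed
next
  case False
  then have "good L \<alpha> x" by (simp add: good_def)
  moreover have "x \<in> class_of L \<alpha> x" using L(2) by (simp add: class_of_def)
  ultimately show ?thesis by blast
qed

text \<open>An unrelated \<open>z\<close> would occupy a place at level \<beta>, since a place at a
  smaller level would make it related; descending with \<open>nth_class_closer\<close> then reaches
  the first place.\<close>

lemma nth_class_empty_E:
  assumes L: "lin_order L" and "nth_class L \<beta> (Suc 0) x = {}" "le L x z" "E L (\<beta> + 1) x z"
  shows "E L \<beta> x z"
proof (rule ccontr)
  assume n: "\<not> E L \<beta> x z"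
  then have "x \<noteq> z" by auto
  then obtain \<gamma> k where "\<gamma> < \<beta> + 1" and z: "z \<in> nth_class L \<gamma> (Suc k) x"
    using E_nth_class[OF L assms(3) _ assms(4)] by blast
  then have "\<gamma> = \<beta>" using nth_class_E[OF L z] n by (auto simp: less_plus_one_iff_ord1 le_less)
  then have "z \<in> nth_class L \<beta> (Suc k) x" using z by simp
  then have "\<exists>z. z \<in> nth_class L \<beta> (Suc 0) x"
  proof (induction k arbitrary: z)
    case (Suc k)
    then show ?case using nth_class_closer[OF L Suc.prems] by blast
  qed blast
  then show False using assms(2) by blast
qed

lemma nth_class_class:
  assumes L: "lin_order L" and "E L \<beta> x y" "x \<in> fst L" "y \<in> fst L"
  shows "nth_class L \<beta> (Suc k) x = nth_class L \<beta> (Suc k) y"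
proof -
  have "cnt L (E L \<beta>) (Suc j) x z \<longleftrightarrow> cnt L (E L \<beta>) (Suc j) y z" for j z
    using cnt_class_left[OF E_equiv[OF L], of \<beta> j x z y] cnt_class_left[OF E_equiv[OF L], of \<beta> j y z x]
      assms(2-4) E_sym[of L \<beta> x y] by blast
  then show ?thesis unfolding nth_class_def by simp
qed

text \<open>An occupied place at \<open>a\<close> would have the type of an
  \<open>E\<^sub>\<beta>\<close>-class of \<open>L\<close>, and \<open>weak\<close> would impose
  this type on the empty place at \<open>c\<close>.\<close>

lemma weak_empty:
  assumes L: "lin_order L" and "weak L (\<beta> + 1) c L a" "nth_class L \<beta> (Suc 0) c = {}"
  shows "nth_class L \<beta> (Suc 0) a = {}"
proof (rule ccontr)
  assume "nth_class L \<beta> (Suc 0) a \<noteq> {}"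
  then obtain y where y: "y \<in> nth_class L \<beta> (Suc 0) a" by blast
  then have yL: "y \<in> fst L" using nth_class_subset[OF L] by blast
  have "eqv L (nth_class L \<beta> (Suc 0) a) L (class_of L \<beta> y)" unfolding nth_class_eq_class_of[OF L y] by (rule eqv_refl)
  then have "eqv L {} L (class_of L \<beta> y)"
    using assms(2) less_succ_ord1 yL unfolding weak_def assms(3)[symmetric] by blast
  then show False using yL by (auto simp: eqv_empty class_of_def)
qed

text \<open>Neither point has an \<open>E\<^sub>\<beta>\<close>-class above its own within the
  common larger class, so both lie in the last one.\<close>

lemma weak_E:
  assumes L: "lin_order L" and "weak L (\<beta> + 1) c L a" "nth_class L \<beta> (Suc 0) c = {}"
    and a: "a \<in> fst L" "c \<in> fst L" "E L (\<beta> + 1) c a"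
  shows "E L \<beta> c a"
proof -
  have "nth_class L \<beta> (Suc 0) a = {}" by (rule weak_empty[OF assms(1-3)])
  then show ?thesis
    using lin_orderD(4)[OF L a(1,2)] nth_class_empty_E[OF L assms(3) _ a(3)] nth_class_empty_E[OF L, of \<beta> a c] a(3)
      E_sym[of L \<beta> a c] E_sym[of L "\<beta> + 1" a c] by blast
qed

text \<open>Places with \<beta> + 1 < \<alpha> are settled by \<open>weak\<close> itself. For
  \<alpha> = \<beta> + 1, if \<open>c\<close> is in a last or first
  \<open>E\<^sub>\<beta>\<close>-class then \<open>a\<close> is in the same one. Otherwise all
  places above \<open>a\<close> are occupied, and their types, which occur in \<open>L\<close>, must
  be the right ones.\<close>

lemma weak_full:
  assumes L: "lin_order L" and c: "good L \<alpha> c" "c \<in> fst L" "a \<in> class_of L \<alpha> c" and w: "sides weak L \<alpha> c L a"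
  shows "full L \<alpha> c L a"
  unfolding full_def
proof (intro allI impI)
  fix \<beta> k assume \<beta>: "\<beta> < \<alpha>"
  have a: "a \<in> fst L" "E L \<alpha> c a" using c(3) by (auto simp: class_of_def)
  have w1: "weak L \<alpha> c L a" "weak (dual L) \<alpha> c (dual L) a" using w by (auto simp: sides_def)
  show "eqv L (nth_class L \<beta> (Suc k) a) L (nth_class L \<beta> (Suc k) c)"
  proof (cases "\<beta> + 1 < \<alpha>")
    case True
    then show ?thesis using w1(1) \<beta> unfolding weak_def by blast
  next
    case False
    then have \<alpha>: "\<alpha> = \<beta> + 1" using \<beta> less_plus_one_iff_ord1[of \<alpha> \<beta>] by (meson leD neqE)
    consider "nth_class L \<beta> (Suc 0) c = {}" | "nth_class (dual L) \<beta> (Suc 0) c = {}" | "\<forall>a\<in>class_of L \<alpha> c. nth_class L \<beta> (Suc 0) a \<noteq> {}"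
      using c(1) \<alpha> unfolding good_def by blast
    then show ?thesis
    proof cases
      case 1
      then have "E L \<beta> c a" using weak_E[OF L] w1(1) a c(2) unfolding \<alpha> by blast
      then show ?thesis using nth_class_class[OF L _ c(2) a(1)] eqv_refl by metis
    next
      case 2
      then have "E (dual L) \<beta> c a"
        using weak_E[of "dual L" \<beta> c a] w1(2) a c(2) L E_dual[OF L] unfolding \<alpha> by simp
      then have "E L \<beta> c a" using E_dual[OF L] by simp
      then show ?thesis using nth_class_class[OF L _ c(2) a(1)] eqv_refl by metis
    next
      case 3
      \<comment> \<open>Every point of the \<open>E\<^sub>\<alpha>\<close>-class has a next
        \<open>E\<^sub>\<beta>\<close>-class, which again lies in that
        \<open>E\<^sub>\<alpha>\<close>-class.\<close>
      have "\<exists>y. y \<in> nth_class L \<beta> (Suc k) a"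
      proof (induction k)
        case 0
        then show ?case using 3 c(3) by blast
      next
        case (Suc k)
        then obtain y where y: "y \<in> nth_class L \<beta> (Suc k) a" by blast
        then have yL: "y \<in> fst L" using nth_class_subset[OF L] by blast
        have "E L \<alpha> c y" using E_trans[OF L c(2) a(1) yL a(2) nth_class_E[OF L y \<beta>]] .
        then have "y \<in> class_of L \<alpha> c" using yL by (simp add: class_of_def)
        then obtain z where "z \<in> nth_class L \<beta> (Suc 0) y" using 3 by blast
        then show ?case using nth_class_add[OF L y] by blast
      qed
      then obtain y where y: "y \<in> nth_class L \<beta> (Suc k) a" by blast
      then have yL: "y \<in> fst L" using nth_class_subset[OF L] by blast
      have "eqv L (nth_class L \<beta> (Suc k) a) L (class_of L \<beta> y)" unfolding nth_class_eq_class_of[OF L y] by (rule eqv_refl)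
      then have "eqv L (nth_class L \<beta> (Suc k) c) L (class_of L \<beta> y)"
        using w1(1) \<beta> yL unfolding weak_def by blast
      then show ?thesis unfolding nth_class_eq_class_of[OF L y] by (rule eqv_sym)
    qed
  qed
qed

lemma sides_weak_full:
  assumes L: "lin_order L" and c: "good L \<alpha> c" "c \<in> fst L" "a \<in> class_of L \<alpha> c" and w: "sides weak L \<alpha> c L a"
  shows "sides full L \<alpha> c L a"
proof -
  have "sides weak (dual L) \<alpha> c (dual L) a" using w by (simp add: sides_def)
  then have "full (dual L) \<alpha> c (dual L) a"
    using weak_full[of "dual L" \<alpha> c a] L c by (simp add: good_dual class_of_dual)
  then show ?thesis using weak_full[OF assms] by (simp add: sides_def)
qed

section \<open>Numbering the classes from the left\<close>

context
  fixes N :: "'a struct"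
  assumes lin: "lin_order N"
begin

lemma low_0: "x \<in> fst N \<Longrightarrow> low N \<alpha> 0 x"
  unfolding low_def using lo(1)[OF lin] by auto

lemma low_right: "low N \<alpha> k x \<Longrightarrow> le N x y \<Longrightarrow> low N \<alpha> k y"
  unfolding low_def using cnt_right[OF E_equiv[OF lin]] by blast

lemma low_le: "low N \<alpha> k x \<Longrightarrow> i \<le> k \<Longrightarrow> low N \<alpha> i x"
  unfolding low_def using cnt_le_imp[OF E_equiv[OF lin]] by blast

lemma low_class: "low N \<alpha> k x \<Longrightarrow> E N \<alpha> x y \<Longrightarrow> y \<in> fst N \<Longrightarrow> low N \<alpha> k y"
proof (cases k)
  case 0
  then show "y \<in> fst N \<Longrightarrow> ?thesis" using low_0 by simp
next
  case (Suc j)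
  then show "low N \<alpha> k x \<Longrightarrow> E N \<alpha> x y \<Longrightarrow> y \<in> fst N \<Longrightarrow> ?thesis"
    unfolding low_def using cnt_class_right[OF E_equiv[OF lin]] by blast
qed

lemma ith_class_eq_class_of:
  assumes x: "x \<in> ith_class N \<alpha> i"
  shows "ith_class N \<alpha> i = class_of N \<alpha> x"
proof -
  have xN: "x \<in> fst N" using x by (simp add: ith_class_def)
  have *: "E N \<alpha> u v" if "le N u v" "u \<in> ith_class N \<alpha> i" "v \<in> ith_class N \<alpha> i" for u v
    using that unfolding ith_class_def low_def by auto
  have "y \<in> ith_class N \<alpha> i \<longleftrightarrow> y \<in> class_of N \<alpha> x" for y
  proof
    assume y: "y \<in> ith_class N \<alpha> i"
    then have yN: "y \<in> fst N" by (simp add: ith_class_def)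
    then show "y \<in> class_of N \<alpha> x"
      using *[OF _ x y] *[OF _ y x] lo(4)[OF lin xN yN] E_sym[of N \<alpha> x y] by (auto simp: class_of_def)
  next
    assume "y \<in> class_of N \<alpha> x"
    then have y: "y \<in> fst N" "E N \<alpha> x y" by (auto simp: class_of_def)
    then have "E N \<alpha> y x" using E_sym[of N \<alpha> x y] by simp
    then show "y \<in> ith_class N \<alpha> i" using x y low_class[of \<alpha> _ x y] low_class[of \<alpha> _ y x] unfolding ith_class_def by blast
  qed
  then show ?thesis by blast
qed

lemma ith_class_less:
  assumes "x \<in> ith_class N \<alpha> i" "y \<in> ith_class N \<alpha> j" "i < j"
  shows "x \<noteq> y \<and> le N x y"
proof -
  have N: "x \<in> fst N" "y \<in> fst N" using assms by (auto simp: ith_class_def)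
  have "\<not> le N y x"
    using low_right[of \<alpha> "Suc i" y x] low_le[of \<alpha> j y "Suc i"] assms by (auto simp: ith_class_def)
  then show ?thesis using lo(1,4)[OF lin] N by blast
qed

text \<open>The index of \<open>x\<close> is the predecessor of the least \<open>j\<close> at which
  \<open>low\<close> fails; it is at most \<open>n\<close>, and \<open>low\<close> holds at
  0.\<close>

lemma Union_ith_class:
  assumes "\<forall>x\<in>fst N. \<forall>y\<in>fst N. \<not> cnt N (E N \<alpha>) n x y"
  shows "fst N = (\<Union>i\<in>{..<n}. ith_class N \<alpha> i)"
proof
  show "fst N \<subseteq> (\<Union>i\<in>{..<n}. ith_class N \<alpha> i)"
  proof
    fix x assume x: "x \<in> fst N"
    define m where "m = (LEAST j. \<not> low N \<alpha> j x)"
    have n: "\<not> low N \<alpha> n x" using assms x by (auto simp: low_def)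
    then have m: "\<not> low N \<alpha> m x" unfolding m_def by (rule LeastI)
    then obtain i where i: "m = Suc i" using low_0[OF x] by (cases m) auto
    then have "low N \<alpha> i x" using not_less_Least[of i "\<lambda>j. \<not> low N \<alpha> j x"] unfolding m_def by simp
    moreover have "m \<le> n" unfolding m_def using n by (rule Least_le)
    ultimately show "x \<in> (\<Union>i\<in>{..<n}. ith_class N \<alpha> i)" using m i x by (auto simp: ith_class_def)
  qed
qed (auto simp: ith_class_def)

end

text \<open>The point given by the second clause lies in the \<open>i\<close>-th class of
  \<open>N\<close>, because \<open>n\<close> classes leave no room for more on either side. By the
  third clause its parts are right, and the classes are glued from left to right.\<close>

lemma scott_eqv:
  assumes lin: "lin_order N" "lin_order L" and L: "\<forall>x\<in>fst L. \<forall>y\<in>fst L. \<not> cnt L (E L \<alpha>) n x y"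
    and c: "\<And>i. i < n \<Longrightarrow> c i \<in> ith_class L \<alpha> i" and N: "scott L \<alpha> n c N"
  shows "eqv N (fst N) L (fst L)"
proof -
  have N1: "\<forall>x\<in>fst N. \<forall>y\<in>fst N. \<not> cnt N (E N \<alpha>) n x y" using N by (simp add: scott_def)
  have ith_class: "eqv N (ith_class N \<alpha> i) L (ith_class L \<alpha> i)" if i: "i < n" for i
  proof -
    obtain a where a: "a \<in> fst N" "low N \<alpha> i a" "up N \<alpha> (n - Suc i) a" "sides weak L \<alpha> (c i) N a"
      using N i unfolding scott_def by blast
    \<comment> \<open>\<open>k\<close> classes on the left, \<open>l\<close> on the right and the
      class of \<open>a\<close> would make \<open>n + 1\<close> classes.\<close>
    have *: "\<not> (low N \<alpha> k a \<and> up N \<alpha> l a)" if "k + l = n" for k l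
      using N1 cnt_add[OF E_equiv[OF lin(1)], of \<alpha> k l] that unfolding low_def up_def by blast
    have nl: "\<not> low N \<alpha> (Suc i) a" using *[of "Suc i" "n - Suc i"] a(3) i by simp
    have "\<not> up N \<alpha> (n - i) a" using *[of i "n - i"] a(2) i by simp
    then have "sides full L \<alpha> (c i) N a" using N i a(1,4) nl unfolding scott_def by blast
    then have "full L \<alpha> (c i) N a" "full (dual L) \<alpha> (c i) (dual N) a" by (auto simp: sides_def)
    then have "eqv N (upper_class N \<alpha> a) L (upper_class L \<alpha> (c i))" "eqv (dual N) (upper_class (dual N) \<alpha> a) (dual L) (upper_class (dual L) \<alpha> (c i))"
      using upper_class_eqvI[OF lin, of \<alpha> a "c i"] upper_class_eqvI[of "dual N" "dual L" \<alpha> a "c i"] lin unfolding full_def by simp_all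
    moreover have "c i \<in> fst L" using c[OF i] by (simp add: ith_class_def)
    ultimately have "eqv N (class_of N \<alpha> a) L (class_of L \<alpha> (c i))"
      using class_of_eqvI[OF lin a(1)] unfolding eqv_dual by blast
    moreover have "a \<in> ith_class N \<alpha> i" using a nl by (simp add: ith_class_def)
    ultimately show ?thesis using ith_class_eq_class_of[OF lin(1)] ith_class_eq_class_of[OF lin(2) c[OF i]] by metis
  qed
  show ?thesis
    unfolding Union_ith_class[OF lin(1) N1] Union_ith_class[OF lin(2) L]
  proof (rule eqv_glue[OF lin])
    show "eqv N (ith_class N \<alpha> i) L (ith_class L \<alpha> i)" if "i \<in> {..<n}" for i using ith_class that by simp
    fix i j assume ij: "i \<in> {..<n}" "j \<in> {..<n}" "i \<noteq> j"
    have sep: "(\<forall>x\<in>ith_class N \<alpha> i. \<forall>y\<in>ith_class N \<alpha> j. x \<noteq> y \<and> le N x y) \<and> (\<forall>x\<in>ith_class L \<alpha> i. \<forall>y\<in>ith_class L \<alpha> j. x \<noteq> y \<and> le L x y)"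
      if "i < j" for i j
      using ith_class_less[OF lin(1) _ _ that] ith_class_less[OF lin(2) _ _ that] by blast
    show "(\<forall>x\<in>ith_class N \<alpha> i. \<forall>y\<in>ith_class N \<alpha> j. x \<noteq> y \<and> le N x y) \<and> (\<forall>x\<in>ith_class L \<alpha> i. \<forall>y\<in>ith_class L \<alpha> j. x \<noteq> y \<and> le L x y) \<or>
      (\<forall>x\<in>ith_class N \<alpha> i. \<forall>y\<in>ith_class N \<alpha> j. x \<noteq> y \<and> le N y x) \<and> (\<forall>x\<in>ith_class L \<alpha> i. \<forall>y\<in>ith_class L \<alpha> j. x \<noteq> y \<and> le L y x)"
    proof (cases "i < j")
      case True
      then show ?thesis using sep by blast
    next
      case False
      then have "j < i" using ij(3) by simp
      then show ?thesis using sep by blast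
    qed
  qed (auto simp: ith_class_def)
qed

text \<open>The assumption on \<open>n\<close> says that it is the exact number of classes; the
  converse direction of the count is needed to place points by what lies to their right.\<close>

lemma scott_self:
  assumes L: "lin_order L" and n: "\<And>j. (\<exists>x\<in>fst L. \<exists>y\<in>fst L. cnt L (E L \<alpha>) j x y) \<longleftrightarrow> j < n"
    and c: "\<And>i. i < n \<Longrightarrow> c i \<in> ith_class L \<alpha> i" "\<And>i. i < n \<Longrightarrow> good L \<alpha> (c i)"
  shows "scott L \<alpha> n c L"
proof -
  have ex: "\<exists>x\<in>fst L. \<exists>y\<in>fst L. cnt L (E L \<alpha>) (n - Suc 0) x y" if "i < n" for i
    using n[of "n - Suc 0"] that by simp
  \<comment> \<open>A chain through all \<open>n\<close> classes has \<open>n - 1\<close> steps, and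
    \<open>cnt_split\<close> distributes them to the two sides of \<open>a\<close>.\<close>
  have split: "low L \<alpha> (Suc k) a \<or> up L \<alpha> (Suc l) a" if "a \<in> fst L" "Suc (k + l) = n - Suc 0" "i < n" for a k l i
    using ex[OF that(3)] cnt_split[OF E_equiv[OF L] _ that(1), of \<alpha> k l] that(2) unfolding low_def up_def by metis
  have up0: "up L \<alpha> 0 a" if "a \<in> fst L" for a unfolding up_def using that lo(1)[OF L] by auto
  show ?thesis
    unfolding scott_def
  proof (intro conjI ballI)
    show "\<not> cnt L (E L \<alpha>) n x y" if "x \<in> fst L" "y \<in> fst L" for x y using n[of n] that by blast
    fix i assume "i \<in> {..<n}"
    then have i: "i < n" by simp
    have ci: "c i \<in> fst L" "low L \<alpha> i (c i)" "\<not> low L \<alpha> (Suc i) (c i)" using c(1)[OF i] by (auto simp: ith_class_def)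
    have "up L \<alpha> (n - Suc i) (c i)"
    proof (cases "n - Suc i")
      case 0
      then show ?thesis using up0[OF ci(1)] by simp
    next
      case (Suc l)
      then show ?thesis using split[OF ci(1), of i l i] ci(3) i by simp
    qed
    moreover have "sides weak L \<alpha> (c i) L (c i)" unfolding sides_def weak_def using eqv_refl by blast
    ultimately show "\<exists>a\<in>fst L. low L \<alpha> i a \<and> up L \<alpha> (n - Suc i) a \<and> sides weak L \<alpha> (c i) L a"
      using ci(1,2) by blast
    fix a assume a: "a \<in> fst L"
    show "low L \<alpha> (Suc i) a \<or> up L \<alpha> (n - i) a \<or> \<not> sides weak L \<alpha> (c i) L a \<or> sides full L \<alpha> (c i) L a"
    proof (cases "low L \<alpha> (Suc i) a \<or> up L \<alpha> (n - i) a \<or> \<not> sides weak L \<alpha> (c i) L a")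
      case False
      have "low L \<alpha> i a"
      proof (cases i)
        case 0
        then show ?thesis using low_0[OF L a] by simp
      next
        case (Suc k)
        \<comment> \<open>With \<open>i = Suc k\<close> the steps add up to \<open>n - 1\<close>: as
          fewer than \<open>n - i\<close> classes lie to the right of \<open>a\<close>, at least
          \<open>i\<close> lie to the left.\<close>
        then have "Suc (k + (n - Suc i)) = n - Suc 0" "Suc (n - Suc i) = n - i" using i by simp_all
        then show ?thesis using split[OF a _ i, of k "n - Suc i"] False Suc by auto
      qed
      then have "a \<in> ith_class L \<alpha> i" using False a by (simp add: ith_class_def)
      then have "a \<in> class_of L \<alpha> (c i)" using ith_class_eq_class_of[OF L c(1)[OF i]] by simp
      then show ?thesis using sides_weak_full[OF L c(2)[OF i] ci(1)] False by blast
    qed blast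
  qed
qed

section \<open>Invariance under isomorphism\<close>

context
  fixes N :: "'a struct" and L :: "'b struct" and f :: "'a \<Rightarrow> 'b"
  assumes lin: "lin_order N" "lin_order L" and f: "iso_on N (fst N) L (fst L) f"
begin

lemma iso_surj: "fst L = f ` fst N"
  using f by (auto simp: iso_on_def bij_betw_def)

lemma convex_carrier: "convex N (fst N)" "convex L (fst L)"
  using lin_orderD(2,3)[OF lin(1)] lin_orderD(2,3)[OF lin(2)] unfolding convex_def by blast+

lemma cnt_transfer: "x \<in> fst N \<Longrightarrow> y \<in> fst N \<Longrightarrow> cnt L (E L \<alpha>) k (f x) (f y) \<longleftrightarrow> cnt N (E N \<alpha>) k x y"
  using cnt_E_iso[OF lin convex_carrier f] by simp

lemma low_transfer: "x \<in> fst N \<Longrightarrow> low L \<alpha> k (f x) \<longleftrightarrow> low N \<alpha> k x"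
  and up_transfer: "x \<in> fst N \<Longrightarrow> up L \<alpha> k (f x) \<longleftrightarrow> up N \<alpha> k x"
  unfolding low_def up_def iso_surj using cnt_transfer by auto

lemma nth_class_transfer:
  assumes "x \<in> fst N"
  shows "eqv N (nth_class N \<beta> k x) L (nth_class L \<beta> k (f x))"
proof -
  have sub: "nth_class N \<beta> k x \<subseteq> fst N" "nth_class L \<beta> k (f x) \<subseteq> fst L" using nth_class_subset[OF lin(1)] nth_class_subset[OF lin(2)] .
  have iff: "f y \<in> nth_class L \<beta> k (f x) \<longleftrightarrow> y \<in> nth_class N \<beta> k x" if "y \<in> fst N" for y
    unfolding nth_class_def mem_Collect_eq cnt_transfer[OF assms that] ..
  have "f ` nth_class N \<beta> k x = nth_class L \<beta> k (f x)"
  proof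
    show "f ` nth_class N \<beta> k x \<subseteq> nth_class L \<beta> k (f x)" using sub(1) iff by blast
    show "nth_class L \<beta> k (f x) \<subseteq> f ` nth_class N \<beta> k x"
    proof
      fix b assume b: "b \<in> nth_class L \<beta> k (f x)"
      then obtain y where "y \<in> fst N" "b = f y" using sub(2) unfolding iso_surj by blast
      then show "b \<in> f ` nth_class N \<beta> k x" using b iff by blast
    qed
  qed
  then show ?thesis unfolding eqv_def using iso_on_subset[OF f sub(1)] by blast
qed

lemma eqv_nth_class_transfer:
  assumes "x \<in> fst N"
  shows "eqv L (nth_class L \<beta> k (f x)) M X \<longleftrightarrow> eqv N (nth_class N \<beta> k x) M X"
  using eqv_trans[OF nth_class_transfer[OF assms], of \<beta> k M X] eqv_trans[OF eqv_sym[OF nth_class_transfer[OF assms]], of \<beta> k M X] by blast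

lemma weak_transfer: "x \<in> fst N \<Longrightarrow> weak M \<alpha> c L (f x) \<longleftrightarrow> weak M \<alpha> c N x"
  and full_transfer: "x \<in> fst N \<Longrightarrow> full M \<alpha> c L (f x) \<longleftrightarrow> full M \<alpha> c N x"
  unfolding weak_def full_def by (simp_all only: eqv_nth_class_transfer)

end

lemma iso_on_dual: "iso_on N A M B f \<Longrightarrow> iso_on (dual N) A (dual M) B f"
  by (simp add: iso_on_def)

lemma scott_transfer:
  fixes M :: "'c struct"
  assumes lin: "lin_order N" "lin_order L" and f: "iso_on N (fst N) L (fst L) f"
  shows "scott M \<alpha> n c L \<longleftrightarrow> scott M \<alpha> n c N"
proof -
  have dual: "lin_order (dual N)" "lin_order (dual L)" "iso_on (dual N) (fst (dual N)) (dual L) (fst (dual L)) f"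
    using lin iso_on_dual[OF f] by simp_all
  have "sides weak M \<alpha> c L (f x) \<longleftrightarrow> sides weak M \<alpha> c N x" "sides full M \<alpha> c L (f x) \<longleftrightarrow> sides full M \<alpha> c N x"
    if "x \<in> fst N" for x and c
    using that by (simp_all add: sides_def weak_transfer[OF lin f] weak_transfer[OF dual]
        full_transfer[OF lin f] full_transfer[OF dual])
  then show ?thesis
    unfolding scott_def iso_surj[OF lin f]
    by (simp add: cnt_transfer[OF lin f] low_transfer[OF lin f] up_transfer[OF lin f])
qed

subsection \<open>Complexity\<close>

lemma Sg_low: "j < n \<Longrightarrow> Sg (2 * \<alpha> + 1) n (\<lambda>N v. low N \<alpha> i (v j))"
  and Sg_up: "j < n \<Longrightarrow> Sg (2 * \<alpha> + 1) n (\<lambda>N v. up N \<alpha> i (v j))"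
proof -
  assume j: "j < n"
  have 1: "Sg (2 * \<alpha> + 1) (Suc n) (\<lambda>N v. cnt N (E N \<alpha>) i (v n) (v j))"
    and 2: "Sg (2 * \<alpha> + 1) (Suc n) (\<lambda>N v. cnt N (E N \<alpha>) i (v j) (v n))"
    using j by (simp_all add: Sg_cnt)
  show "Sg (2 * \<alpha> + 1) n (\<lambda>N v. low N \<alpha> i (v j))"
    using Sg_Ex[OF pos_succ_ord1 1] by (rule Sg_cong) (use j in \<open>simp add: low_def\<close>)
  show "Sg (2 * \<alpha> + 1) n (\<lambda>N v. up N \<alpha> i (v j))"
    using Sg_Ex[OF pos_succ_ord1 2] by (rule Sg_cong) (use j in \<open>simp add: up_def\<close>)
qed

context
  fixes L :: "'a struct" and c :: 'a
  assumes L: "lin_order L" "countable (fst L)" and c: "c \<in> fst L"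
begin

lemma Pi_full:
  assumes "j < n"
  shows "Pi (2 * \<alpha> + 1) n (\<lambda>N v. full L \<alpha> c N (v j))"
proof -
  let ?I = "{..<\<alpha>} \<times> (UNIV :: nat set)"
  have "Pi (2 * \<alpha> + 1) n (\<lambda>N v. \<forall>p\<in>?I. eqv N (nth_class N (fst p) (Suc (snd p)) (v j)) L (nth_class L (fst p) (Suc (snd p)) c))"
  proof (rule Pi_Inter[OF pos_succ_ord1])
    show "countable ?I" using countable_lessThan_ord1 by blast
    fix p assume "p \<in> ?I"
    then have "2 * fst p + 1 + 1 < 2 * \<alpha> + 1"
      using double_succ_le_ord1[of "fst p" \<alpha>] less_succ_ord1[of "2 * \<alpha>"] by (auto intro: le_less_trans)
    then show "Pi (2 * \<alpha> + 1) n (\<lambda>N v. eqv N (nth_class N (fst p) (Suc (snd p)) (v j)) L (nth_class L (fst p) (Suc (snd p)) c))"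
      by (rule Pi_nth_class_eqv[OF L c assms])
  qed
  then show ?thesis by (rule Sg_cong) (simp add: full_def Bex_def)
qed

text \<open>The type of an \<open>E\<^sub>\<beta>\<close>-class of \<open>L\<close> is \<Sigma> of
  level 2\<beta>+2 \<le> 2\<alpha> and occurs as a premise, so excluding it is \<Pi> of level
  2\<alpha>. Level 0 is separate because infinite conjunctions need a positive level.\<close>

lemma Pi_weak:
  assumes j: "j < n"
  shows "Pi (2 * \<alpha>) n (\<lambda>N v. weak L \<alpha> c N (v j))"
proof (cases "\<alpha> = 0")
  case True
  then have "weak L \<alpha> c N x" for N :: "nat struct" and x by (simp add: weak_def not_less_zero_ord1)
  then show ?thesis using Pi_True[of "2 * \<alpha>" n] by simp
next
  case False
  then have pos: "0 < 2 * \<alpha>" using zero_le_ord1[of \<alpha>] by (intro pos_double_ord1) simp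
  let ?I = "{..<\<alpha>} \<times> (UNIV :: nat set)"
  let ?W = "\<lambda>p N x. (fst p + 1 < \<alpha> \<longrightarrow> eqv N (nth_class N (fst p) (Suc (snd p)) x) L (nth_class L (fst p) (Suc (snd p)) c)) \<and>
     (\<forall>b\<in>fst L. eqv N (nth_class N (fst p) (Suc (snd p)) x) L (class_of L (fst p) b) \<longrightarrow> eqv L (nth_class L (fst p) (Suc (snd p)) c) L (class_of L (fst p) b))"
  have "Pi (2 * \<alpha>) n (\<lambda>N v. \<forall>p\<in>?I. ?W p N (v j))"
  proof (rule Pi_Inter[OF pos])
    show "countable ?I" using countable_lessThan_ord1 by blast
    fix p assume "p \<in> ?I"
    then have p: "fst p < \<alpha>" by auto
    have "Pi (2 * \<alpha>) n (\<lambda>N v. fst p + 1 < \<alpha> \<longrightarrow> eqv N (nth_class N (fst p) (Suc (snd p)) (v j)) L (nth_class L (fst p) (Suc (snd p)) c))"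
    proof (cases "fst p + 1 < \<alpha>")
      case True
      then show ?thesis using Pi_nth_class_eqv[OF L c j double_succ_less_ord1[OF True]] by simp
    next
      case False
      then show ?thesis using Pi_True by simp
    qed
    moreover have "Pi (2 * \<alpha>) n (\<lambda>N v. \<forall>b\<in>fst L. eqv N (nth_class N (fst p) (Suc (snd p)) (v j)) L (class_of L (fst p) b) \<longrightarrow>
      eqv L (nth_class L (fst p) (Suc (snd p)) c) L (class_of L (fst p) b))"
    proof (rule Pi_Inter[OF pos L(2)])
      fix b assume b: "b \<in> fst L"
      have "Sg (2 * \<alpha>) n (\<lambda>N v. eqv N (nth_class N (fst p) (Suc (snd p)) (v j)) L (class_of L (fst p) b))"
        by (rule Sg_mono[OF Sg_nth_class_class_of[OF L b j] double_succ_le_ord1[OF p]])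
      \<comment> \<open>The conclusion mentions only \<open>L\<close> and \<open>c\<close>, so the
        implication is either true or the negation of its premise.\<close>
      then show "Pi (2 * \<alpha>) n (\<lambda>N v. eqv N (nth_class N (fst p) (Suc (snd p)) (v j)) L (class_of L (fst p) b) \<longrightarrow>
        eqv L (nth_class L (fst p) (Suc (snd p)) c) L (class_of L (fst p) b))"
        using Pi_True by (cases "eqv L (nth_class L (fst p) (Suc (snd p)) c) L (class_of L (fst p) b)") simp_all
    qed
    ultimately show "Pi (2 * \<alpha>) n (\<lambda>N v. ?W p N (v j))" by (rule Pi_conj)
  qed
  then show ?thesis by (rule Sg_cong) (auto simp: weak_def)
qed

end

lemma Pi_sides:
  fixes L :: "'a struct"
  assumes L: "lin_order L" "countable (fst L)" "c \<in> fst L" and j: "j < n"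
  shows "Pi (2 * \<alpha>) n (\<lambda>N v. sides weak L \<alpha> c N (v j))" and "Pi (2 * \<alpha> + 1) n (\<lambda>N v. sides full L \<alpha> c N (v j))"
proof -
  have L': "lin_order (dual L)" "countable (fst (dual L))" "c \<in> fst (dual L)" using L by simp_all
  show "Pi (2 * \<alpha>) n (\<lambda>N v. sides weak L \<alpha> c N (v j))" unfolding sides_def
    by (rule Pi_conj[OF Pi_weak[OF L j] Sg_dual[OF Pi_weak[OF L' j]]])
  show "Pi (2 * \<alpha> + 1) n (\<lambda>N v. sides full L \<alpha> c N (v j))" unfolding sides_def
    by (rule Pi_conj[OF Pi_full[OF L j] Sg_dual[OF Pi_full[OF L' j]]])
qed

text \<open>The body of the second clause is \<Sigma> of level 2\<alpha>+1 even after its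
  existential quantifier; the third clause puts a universal quantifier before a \<Pi> condition of
  level 2\<alpha>+2.\<close>

lemma Pi_scott:
  fixes L :: "'a struct"
  assumes L: "lin_order L" "countable (fst L)" "\<And>i. i < n \<Longrightarrow> c i \<in> fst L"
  shows "Pi (2 * \<alpha> + 1 + 1) 0 (\<lambda>N v. scott L \<alpha> n c N)"
proof -
  let ?\<gamma> = "2 * \<alpha> + 1" let ?\<delta> = "?\<gamma> + 1"
  have up: "Sg ?\<gamma> k P \<Longrightarrow> Pi ?\<delta> k P" for k P by (rule Sg_less_Pi[OF _ less_succ_ord1])
  have mono: "Pi ?\<gamma> k P \<Longrightarrow> Pi ?\<delta> k P" for k P by (rule Sg_mono[OF _ less_imp_le[OF less_succ_ord1]])
  have "Pi ?\<delta> (Suc (Suc 0)) (\<lambda>N v. \<not> cnt N (E N \<alpha>) n (v 0) (v (Suc 0)))"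
    by (rule mono, simp, rule Sg_cnt) auto
  from Pi_All[OF pos_succ_ord1 Pi_All[OF pos_succ_ord1 this]]
  have 1: "Pi ?\<delta> 0 (\<lambda>N v. \<forall>x\<in>fst N. \<forall>y\<in>fst N. \<not> cnt N (E N \<alpha>) n x y)" by simp
  have 2: "Pi ?\<delta> 0 (\<lambda>N v. \<forall>i\<in>{..<n}. \<exists>a\<in>fst N. low N \<alpha> i a \<and> up N \<alpha> (n - Suc i) a \<and> sides weak L \<alpha> (c i) N a)"
  proof (rule Pi_Inter[OF pos_succ_ord1])
    fix i assume "i \<in> {..<n}"
    then have "Sg ?\<gamma> (Suc 0) (\<lambda>N v. sides weak L \<alpha> (c i) N (v 0))"
      using Pi_less_Sg[OF Pi_sides(1)[OF L(1,2) L(3)] less_succ_ord1] by simp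
    then have "Sg ?\<gamma> (Suc 0) (\<lambda>N v. low N \<alpha> i (v 0) \<and> up N \<alpha> (n - Suc i) (v 0) \<and> sides weak L \<alpha> (c i) N (v 0))"
      by (intro Sg_conj Sg_low Sg_up) simp_all
    from up[OF Sg_Ex[OF pos_succ_ord1 this]]
    show "Pi ?\<delta> 0 (\<lambda>N v. \<exists>a\<in>fst N. low N \<alpha> i a \<and> up N \<alpha> (n - Suc i) a \<and> sides weak L \<alpha> (c i) N a)" by simp
  qed simp
  have 3: "Pi ?\<delta> 0 (\<lambda>N v. \<forall>i\<in>{..<n}. \<forall>a\<in>fst N. low N \<alpha> (Suc i) a \<or> up N \<alpha> (n - i) a \<or>
        \<not> sides weak L \<alpha> (c i) N a \<or> sides full L \<alpha> (c i) N a)"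
  proof (rule Pi_Inter[OF pos_succ_ord1])
    fix i assume "i \<in> {..<n}"
    then have ci: "c i \<in> fst L" using L(3) by simp
    have "Sg ?\<gamma> (Suc 0) (\<lambda>N v. \<not> sides weak L \<alpha> (c i) N (v 0))"
      by (rule Sg_mono[OF Pi_sides(1)[OF L(1,2) ci] less_imp_le[OF less_succ_ord1]]) simp
    moreover have "Pi ?\<gamma> (Suc 0) (\<lambda>N v. sides full L \<alpha> (c i) N (v 0))"
      by (rule Pi_sides(2)[OF L(1,2) ci]) simp
    ultimately have "Pi ?\<delta> (Suc 0) (\<lambda>N v. low N \<alpha> (Suc i) (v 0) \<or> up N \<alpha> (n - i) (v 0) \<or>
        \<not> sides weak L \<alpha> (c i) N (v 0) \<or> sides full L \<alpha> (c i) N (v 0))"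
      by (intro Pi_disj up[OF Sg_low] up[OF Sg_up] up[of _ "\<lambda>N v. \<not> sides weak L \<alpha> (c i) N (v 0)"] mono) simp_all
    from Pi_All[OF pos_succ_ord1 this]
    show "Pi ?\<delta> 0 (\<lambda>N v. \<forall>a\<in>fst N. low N \<alpha> (Suc i) a \<or> up N \<alpha> (n - i) a \<or>
        \<not> sides weak L \<alpha> (c i) N a \<or> sides full L \<alpha> (c i) N a)" by simp
  qed simp
  show ?thesis unfolding scott_def by (rule Pi_conj[OF 1 Pi_conj[OF 2 3]])
qed

text \<open>Definability was meant on linear orders only, whereas a Scott sentence is tested on all
  structures. The order axioms are therefore added as one further conjunct.\<close>

lemma Pi_sentence:
  assumes P: "Pi \<gamma> 0 (\<lambda>N v. P N)" and \<gamma>: "0 < \<gamma>"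
  shows "\<exists>\<phi>. is_Pi \<gamma> \<phi> \<and> sentence \<phi> \<and> (\<forall>N :: nat struct. is_struct N \<longrightarrow> (models N \<phi> \<longleftrightarrow> lin_order N \<and> P N))"
proof -
  let ?Q = "\<lambda>(N :: nat struct) v. le N (v 0) (v 0) \<and> \<not> (\<not> le N (v 0) (v 1) \<and> \<not> le N (v 1) (v 0)) \<and>
    \<not> ((le N (v 0) (v 1) \<and> le N (v 1) (v 0)) \<and> \<not> v 0 = v 1) \<and>
    \<not> ((le N (v 0) (v 1) \<and> le N (v 1) (v 2)) \<and> \<not> le N (v 0) (v (2 :: nat)))"
  have "Qf 3 ?Q" by (intro Qf.intros) simp_all
  then obtain \<chi> where \<chi>: "finitary_qf \<chi>" "free_vars \<chi> \<subseteq> {..<3}" "\<And>N v. sat N v \<chi> \<longleftrightarrow> ?Q N v"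
    using Qf_realize[of 3 ?Q id] by auto
  let ?ax = "foldr All [0, 1, 2] \<chi>"
  have ax: "sat N v ?ax \<longleftrightarrow> lin_order N" if "is_struct N" for N :: "nat struct" and v
  proof -
    have "sat N v ?ax \<longleftrightarrow> (\<forall>x\<in>fst N. \<forall>y\<in>fst N. \<forall>z\<in>fst N. ?Q N (v(0 := x, 1 := y, 2 := z)))"
      by (simp add: \<chi>(3))
    also have "\<dots> \<longleftrightarrow> lin_order N"
      using that unfolding lin_order_iff is_struct_def by (simp; blast)
    finally show ?thesis .
  qed
  have ax_fv: "free_vars ?ax = {}" using \<chi>(2) by (auto simp: numeral_eq_Suc less_Suc_eq)
  obtain \<psi> where \<psi>: "is_Pi \<gamma> \<psi>" "free_vars \<psi> \<subseteq> {}" "\<And>N v. valid 0 N v \<Longrightarrow> sat N v \<psi> \<longleftrightarrow> P N"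
    using Pi_realize[OF P] by auto
  obtain I F where IF: "\<psi> = Conj I F"
    "\<And>i. i \<in> I \<Longrightarrow> \<exists>xs \<psi>. F i = foldr All xs \<psi> \<and> (\<exists>\<beta><\<gamma>. is_Sigma \<beta> \<psi>)"
    using \<psi>(1) \<gamma> by (auto elim: is_Pi.cases)
  \<comment> \<open>The conjuncts are shifted by one to free index 0 for the axioms.\<close>
  let ?F = "\<lambda>i. case i of 0 \<Rightarrow> ?ax | Suc j \<Rightarrow> F j"
  let ?\<phi> = "Conj (insert 0 (Suc ` I)) ?F"
  have "is_Pi \<gamma> ?\<phi>"
  proof (rule Pi_pos[OF \<gamma>])
    fix i assume "i \<in> insert 0 (Suc ` I)"
    then consider "i = 0" | j where "i = Suc j" "j \<in> I" by blast
    then show "\<exists>xs \<psi>. ?F i = foldr All xs \<psi> \<and> (\<exists>\<beta><\<gamma>. is_Sigma \<beta> \<psi>)"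
    proof cases
      case 1
      then have "?F i = foldr All [0, 1, 2] \<chi>" by simp
      moreover have "is_Sigma 0 \<chi>" using \<chi>(1) by (rule Sigma_zero)
      ultimately show ?thesis using \<gamma> by blast
    next
      case 2
      then show ?thesis using IF(2) by simp
    qed
  qed
  moreover have "sentence ?\<phi>" using \<psi>(2) ax_fv unfolding IF(1) sentence_def by simp
  moreover have "models N ?\<phi> \<longleftrightarrow> lin_order N \<and> P N" if N: "is_struct N" for N :: "nat struct"
  proof -
    have "sat N v ?\<phi> \<longleftrightarrow> lin_order N \<and> sat N v \<psi>" for v
      using ax[OF N, of v] unfolding IF(1) by simp
    moreover have "sat N v \<psi> \<longleftrightarrow> P N" if "lin_order N" for v
      using \<psi>(3)[of N v] that by (simp add: valid_def)
    ultimately show ?thesis unfolding models_def by blast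
  qed
  ultimately show ?thesis by blast
qed

section \<open>Orders of Hausdorff rank at most \<open>\<alpha>\<close> have finitely many classes\<close>

text \<open>\<open>idx\<close> gives the summand of a point. Each fiber is convex in
  \<open>K\<close> and isomorphic to its summand, so counts within it can be computed in the
  summand.\<close>

lemma sum_fibers:
  fixes L :: "'i :: linorder \<Rightarrow> 'a struct"
  assumes K: "lin_order K" "isomorphic K (sum_order I L)" and L: "\<And>i. i \<in> I \<Longrightarrow> lin_order (L i)"
  obtains idx where "\<And>x. x \<in> fst K \<Longrightarrow> idx x \<in> I" "\<And>x y. le K x y \<Longrightarrow> idx x \<le> idx y"
    "\<And>i \<beta> m x y. i \<in> I \<Longrightarrow> \<forall>x y. \<not> cnt (L i) (E (L i) \<beta>) m x y \<Longrightarrow> idx x = i \<Longrightarrow> idx y = i \<Longrightarrow> \<not> cnt K (E K \<beta>) m x y"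
proof -
  obtain f where f: "bij_betw f (fst K) (Sigma I (\<lambda>i. fst (L i)))"
    "\<And>x y. x \<in> fst K \<Longrightarrow> y \<in> fst K \<Longrightarrow> le K x y \<longleftrightarrow> (f x, f y) \<in> snd (sum_order I L)"
    using K(2) unfolding isomorphic_def by (auto simp: sum_order_def)
  note lo = lin_orderD[OF K(1)]
  have fm: "fst (f x) \<in> I" "snd (f x) \<in> fst (L (fst (f x)))" if "x \<in> fst K" for x
    using bij_betwE[OF f(1)] that by (auto simp: mem_Sigma_iff split_beta)
  have le: "le K x y \<longleftrightarrow> fst (f x) < fst (f y) \<or> fst (f x) = fst (f y) \<and> le (L (fst (f x))) (snd (f x)) (snd (f y))"
    if "x \<in> fst K" "y \<in> fst K" for x y
    unfolding f(2)[OF that] using fm[OF that(1)] fm[OF that(2)] by (cases "f x"; cases "f y") (auto simp: sum_order_def)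
  have mono: "fst (f x) \<le> fst (f y)" if "le K x y" for x y
    using le[of x y] lo(2,3)[OF that] that by auto
  show thesis
  proof (rule that[of "\<lambda>x. fst (f x)"])
    show "fst (f x) \<in> I" if "x \<in> fst K" for x using fm(1)[OF that] .
    show "fst (f x) \<le> fst (f y)" if "le K x y" for x y using mono[OF that] .
    fix i \<beta> m x y
    assume i: "i \<in> I" "\<forall>x y. \<not> cnt (L i) (E (L i) \<beta>) m x y" "fst (f x) = i" "fst (f y) = i"
    show "\<not> cnt K (E K \<beta>) m x y"
    proof
      assume cnt: "cnt K (E K \<beta>) m x y"
      then have xy: "x \<in> fst K" "y \<in> fst K" using cnt_le[OF K(1) cnt] lo(2,3) by blast+
      let ?A = "{x \<in> fst K. fst (f x) = i}" and ?g = "\<lambda>x. snd (f x)"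
      have "inj_on ?g ?A"
      proof (rule inj_onI)
        fix u v assume uv: "u \<in> ?A" "v \<in> ?A" "?g u = ?g v"
        then have "f u = f v" by (simp add: prod_eqI)
        then show "u = v" using uv(1,2) f(1) by (auto simp: bij_betw_def dest: inj_onD)
      qed
      moreover have "?g ` ?A = fst (L i)"
      proof
        show "fst (L i) \<subseteq> ?g ` ?A"
        proof
          fix b assume "b \<in> fst (L i)"
          then have "(i, b) \<in> f ` fst K" using f(1) i(1) by (auto simp: bij_betw_def)
          then obtain z where "z \<in> fst K" "f z = (i, b)" by force
          then show "b \<in> ?g ` ?A" by force
        qed
      qed (use fm in auto)
      ultimately have iso: "iso_on K ?A (L i) (fst (L i)) ?g"
        using le i(3,4) by (auto simp: iso_on_def bij_betw_def)
      have "convex K ?A"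
        unfolding convex_def
      proof (intro conjI ballI allI impI)
        fix u v w assume "u \<in> ?A" "w \<in> ?A" "le K u v" "le K v w"
        then show "v \<in> ?A" using mono[of u v] mono[of v w] lo(3)[of u v] by auto
      qed auto
      moreover have "convex (L i) (fst (L i))"
        using lin_orderD(3)[OF L[OF i(1)]] unfolding convex_def by blast
      ultimately have "cnt K (E K \<beta>) m x y \<longleftrightarrow> cnt (L i) (E (L i) \<beta>) m (?g x) (?g y)"
        using i(3,4) xy by (intro cnt_E_iso[OF K(1) L[OF i(1)] _ _ iso]) auto
      then show False using cnt i(2) by blast
    qed
  qed
qed

text \<open>Bounds on consecutive fibers add up at the larger of the levels, which is again in
  \<open>B\<close>. For \<zeta>-sums \<open>B\<close> consists of the levels below \<alpha>, for
  finite sums of \<alpha> alone.\<close>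

lemma bounded_fibers:
  fixes idx :: "'a \<Rightarrow> int"
  assumes K: "lin_order K" "\<And>x y. le K x y \<Longrightarrow> idx x \<le> idx y" and B: "\<beta>\<^sub>0 \<in> B"
    and fib: "\<And>i. \<exists>\<beta>\<in>B. \<exists>m. \<forall>x y. idx x = i \<longrightarrow> idx y = i \<longrightarrow> \<not> cnt K (E K \<beta>) m x y"
  shows "\<exists>\<beta>\<in>B. \<exists>m. \<forall>x y. i \<le> idx x \<longrightarrow> idx y < i + int n \<longrightarrow> \<not> cnt K (E K \<beta>) m x y"
proof (induction n)
  case 0
  have "\<not> cnt K (E K \<beta>\<^sub>0) 0 x y" if "i \<le> idx x" "idx y < i" for x y
    using K(2)[of x y] that by auto
  then show ?case using B by (intro bexI[of _ \<beta>\<^sub>0] exI[of _ 0]) auto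
next
  case (Suc n)
  then obtain \<beta> m where 1: "\<beta> \<in> B" "\<And>x y. i \<le> idx x \<Longrightarrow> idx y < i + int n \<Longrightarrow> \<not> cnt K (E K \<beta>) m x y" by blast
  obtain \<gamma> l where 2: "\<gamma> \<in> B" "\<And>x y. idx x = i + int n \<Longrightarrow> idx y = i + int n \<Longrightarrow> \<not> cnt K (E K \<gamma>) l x y"
    using fib by blast
  let ?d = "max \<beta> \<gamma>"
  have "\<not> cnt K (E K ?d) (m + l) x y" if "i \<le> idx x" "idx y < i + int (Suc n)" for x y
  proof
    assume "cnt K (E K ?d) (m + l) x y"
    then obtain w where w: "cnt K (E K ?d) m x w" "cnt K (E K ?d) l w y"
      using cnt_add[OF E_equiv[OF K(1)]] by blast
    have "idx w \<le> idx y" using K(2) cnt_le[OF K(1) w(2)] .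
    show False
    proof (cases "idx w < i + int n")
      case True
      then show False using 1(2)[OF that(1) True] cnt_E_antimono[OF w(1), of \<beta>] by simp
    next
      case False
      then have "idx w = i + int n" "idx y = i + int n" using \<open>idx w \<le> idx y\<close> that(2) by auto
      then show False using 2(2) cnt_E_antimono[OF w(2), of \<gamma>] by simp
    qed
  qed
  moreover have "?d \<in> B" using 1(1) 2(1) by (simp add: max_def)
  ultimately show ?case by blast
qed

text \<open>In a finite order each step enlarges an initial segment. In a \<zeta>-sum any two points
  span finitely many summands, which are bounded at a common level below \<alpha>, so there is at
  most one class. In a finite sum the bounds at \<alpha> are added.\<close>

lemma HR_bounded: "HR \<alpha> K \<Longrightarrow> lin_order K \<and> (\<exists>n. \<forall>x y. \<not> cnt K (E K \<alpha>) n x y)"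
proof (induction rule: HR.induct)
  case (finite L)
  note lo = lin_orderD[OF finite(1)]
  have "k < card {u \<in> fst L. le L u y}" if "cnt L (E L 0) k x y" for k x y
    using that
  proof (induction k arbitrary: y)
    case 0
    then have "y \<in> {u \<in> fst L. le L u y}" using lo(1,3) by auto
    then show ?case using finite(2) by (auto simp: card_gt_0_iff)
  next
    case (Suc k)
    then obtain z where z: "cnt L (E L 0) k x z" "le L z y" "z \<noteq> y" by (metis cnt.simps(2) E_refl)
    have "{u \<in> fst L. le L u z} \<subset> {u \<in> fst L. le L u y}"
      using z(2,3) lo(1)[of y] lo(3)[OF z(2)] lo(5)[OF z(2)] lo(6)[OF _ z(2)] by blast
    then have "card {u \<in> fst L. le L u z} < card {u \<in> fst L. le L u y}"
      using finite(2) by (intro psubset_card_mono) auto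
    then show ?case using Suc.IH[OF z(1)] by simp
  qed
  moreover have "card {u \<in> fst L. le L u y} \<le> card (fst L)" for y
    using finite(2) by (intro card_mono) auto
  ultimately show ?case using finite(1) by (meson less_le_trans less_irrefl)
next
  case (zeta_sum \<alpha> L K)
  have L: "lin_order (L i)" for i using zeta_sum.IH by blast
  obtain idx :: "_ \<Rightarrow> int" where idx: "\<And>x y. le K x y \<Longrightarrow> idx x \<le> idx y"
    "\<And>i \<beta> m x y. \<forall>x y. \<not> cnt (L i) (E (L i) \<beta>) m x y \<Longrightarrow> idx x = i \<Longrightarrow> idx y = i \<Longrightarrow> \<not> cnt K (E K \<beta>) m x y"
    using sum_fibers[OF zeta_sum.hyps(2,3) L] by (metis UNIV_I)
  have fib: "\<exists>\<beta>\<in>{..<\<alpha>}. \<exists>m. \<forall>x y. idx x = i \<longrightarrow> idx y = i \<longrightarrow> \<not> cnt K (E K \<beta>) m x y" for i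
    using zeta_sum.IH[of i] idx(2)[of i] by (meson lessThan_iff)
  have "E K \<alpha> x y" if xy: "le K x y" for x y
  proof -
    \<comment> \<open>The range covers the summands from that of \<open>x\<close> to that of
      \<open>y\<close> inclusive, hence the added 1.\<close>
    obtain \<beta> m where "\<beta> < \<alpha>" "\<forall>u v. idx x \<le> idx u \<longrightarrow> idx v < idx x + int (nat (idx y - idx x) + 1) \<longrightarrow> \<not> cnt K (E K \<beta>) m u v"
      using bounded_fibers[OF zeta_sum.hyps(2) idx(1) _ fib, of 0] zeta_sum.hyps(1) by (metis lessThan_iff)
    then have "\<not> cnt K (E K \<beta>) m x y" using idx(1)[OF xy] by simp
    then show ?thesis using E_of_not_cnt[OF zeta_sum.hyps(2) xy] \<open>\<beta> < \<alpha>\<close> by blast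
  qed
  then have "\<forall>x y. \<not> cnt K (E K \<alpha>) (Suc 0) x y"
    using cnt_1_iff[OF E_equiv[OF zeta_sum.hyps(2)]] by blast
  then show ?case using zeta_sum.hyps(2) by blast
next
  case (finite_sum \<alpha> n L K)
  have L: "lin_order (L i)" if "i \<in> {..<n}" for i using finite_sum.IH that by blast
  obtain idx :: "_ \<Rightarrow> nat" where idx: "\<And>x. x \<in> fst K \<Longrightarrow> idx x \<in> {..<n}" "\<And>x y. le K x y \<Longrightarrow> idx x \<le> idx y"
    "\<And>i \<beta> m x y. i \<in> {..<n} \<Longrightarrow> \<forall>x y. \<not> cnt (L i) (E (L i) \<beta>) m x y \<Longrightarrow> idx x = i \<Longrightarrow> idx y = i \<Longrightarrow> \<not> cnt K (E K \<beta>) m x y"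
    using sum_fibers[OF finite_sum.hyps(3,4) L] by blast
  have mem: "x \<in> fst K" "y \<in> fst K" if "cnt K R m x y" for R m x y
    using cnt_le[OF finite_sum.hyps(3) that] lin_orderD(2,3)[OF finite_sum.hyps(3)] by blast+
  have fib: "\<exists>\<beta>\<in>{\<alpha>}. \<exists>m. \<forall>x y. int (idx x) = i \<longrightarrow> int (idx y) = i \<longrightarrow> \<not> cnt K (E K \<beta>) m x y" for i
  proof (cases "0 \<le> i \<and> i < int n")
    case True
    then have i: "nat i \<in> {..<n}" by auto
    then obtain m where "\<forall>x y. \<not> cnt (L (nat i)) (E (L (nat i)) \<alpha>) m x y" using finite_sum.IH by blast
    then show ?thesis using idx(3)[OF i, of \<alpha> m] by (metis nat_int singletonI)
  next
    case False
    then have "\<not> (x \<in> fst K \<and> int (idx x) = i)" for x using idx(1)[of x] by auto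
    then show ?thesis using mem by blast
  qed
  have "int (idx x) \<le> int (idx y)" if "le K x y" for x y using idx(2)[OF that] by simp
  from bounded_fibers[where B = "{\<alpha>}", OF finite_sum.hyps(3) this _ fib, of \<alpha> 0 n]
  obtain m where m: "\<And>x y. 0 \<le> int (idx x) \<Longrightarrow> int (idx y) < 0 + int n \<Longrightarrow> \<not> cnt K (E K \<alpha>) m x y"
    by auto
  have "\<not> cnt K (E K \<alpha>) m x y" for x y
    using m[of x y] mem[of "E K \<alpha>" m x y] idx(1)[of y] by auto
  then show ?case using finite_sum.hyps(3) by blast
qed

lemma lin_order_transfer:
  assumes L: "lin_order L" and N: "is_struct N" and f: "iso_on L (fst L) N (fst N) f"
  shows "lin_order N"
  unfolding lin_order_iff
proof (intro conjI ballI)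
  note lo = lin_orderD[OF L]
  show "snd N \<subseteq> fst N \<times> fst N" using N by (simp add: is_struct_def)
  have surj: "fst N = f ` fst L" using f by (simp add: iso_on_def bij_betw_def)
  have le: "le N (f x) (f y) \<longleftrightarrow> le L x y" if "x \<in> fst L" "y \<in> fst L" for x y
    using f that by (simp add: iso_on_def)
  fix x y z assume xyz: "x \<in> fst N" "y \<in> fst N" "z \<in> fst N"
  then obtain u v w where u: "x = f u" "u \<in> fst L" "y = f v" "v \<in> fst L" "z = f w" "w \<in> fst L"
    unfolding surj by blast
  show "le N x x" "le N x y \<or> le N y x" using lo(1)[OF u(2)] lo(4)[OF u(2,4)] le u by simp_all
  show "le N x y \<and> le N y x \<longrightarrow> x = y" using lo(5)[of u v] le u by auto
  show "le N x y \<and> le N y z \<longrightarrow> le N x z" using lo(6)[of u v w] le u by simp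
qed

theorem theorem2p14:
  fixes L :: "'a struct" and \<alpha> :: ord1
  assumes "lin_order L" and "countable (fst L)" and "scattered L"
    and "has_hausdorff_rank L \<alpha>"
  shows "\<exists>\<phi>. is_Pi (2 * \<alpha> + 2) \<phi> \<and> is_scott_sentence \<phi> L"
proof -
  note L = assms(1)
  let ?ex = "\<lambda>j. \<exists>x\<in>fst L. \<exists>y\<in>fst L. cnt L (E L \<alpha>) j x y"
  have "HR \<alpha> L" using assms(4) by (simp add: has_hausdorff_rank_def)
  then obtain n0 where n0: "\<not> ?ex n0" using HR_bounded by blast
  \<comment> \<open>The number of \<open>E\<^sub>\<alpha>\<close>-classes of \<open>L\<close>, as a
    count of \<open>j\<close> means \<open>j + 1\<close> classes; it is 0 if \<open>L\<close> is
    empty.\<close>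
  define n where "n = (LEAST j. \<not> ?ex j)"
  have "\<not> ?ex n" unfolding n_def using n0 by (rule LeastI)
  moreover have "?ex j" if "j < n" for j using not_less_Least[of j "\<lambda>j. \<not> ?ex j"] that unfolding n_def by blast
  moreover have "?ex k" if "?ex j" "k \<le> j" for j k
    using that(1) cnt_le_imp[OF E_equiv[OF L] _ that(2)] by blast
  ultimately have n: "?ex j \<longleftrightarrow> j < n" for j using not_le[of n j] by blast
  have "\<exists>c. c \<in> ith_class L \<alpha> i \<and> good L \<alpha> c" if i: "i < n" for i
  proof -
    \<comment> \<open>A chain through all classes is cut after \<open>i\<close> steps; the cut point
      \<open>w\<close> lies in the \<open>i\<close>-th class, since one more class on its left would
      give a count of \<open>n\<close>.\<close>
    have "n - Suc 0 = i + (n - Suc i)" using i by simp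
    moreover have "?ex (n - Suc 0)" using n i by auto
    ultimately obtain x y w where w: "x \<in> fst L" "cnt L (E L \<alpha>) i x w" "y \<in> fst L" "cnt L (E L \<alpha>) (n - Suc i) w y"
      using cnt_add[OF E_equiv[OF L], of \<alpha> i "n - Suc i"] by auto
    have wL: "w \<in> fst L" using cnt_le[OF L w(2)] lin_orderD(3)[OF L] by blast
    have "\<not> low L \<alpha> (Suc i) w"
    proof
      assume "low L \<alpha> (Suc i) w"
      then obtain u where u: "u \<in> fst L" "cnt L (E L \<alpha>) (Suc i + (n - Suc i)) u y"
        using cnt_add[OF E_equiv[OF L]] w(4) unfolding low_def by blast
      moreover have "Suc i + (n - Suc i) = n" using i by simp
      ultimately show False using n[of n] w(3) by auto
    qed
    then have "w \<in> ith_class L \<alpha> i" using w(1,2) wL unfolding ith_class_def low_def by blast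
    then have "ith_class L \<alpha> i = class_of L \<alpha> w" by (rule ith_class_eq_class_of[OF L])
    then show ?thesis using exists_good[OF L wL, of \<alpha>] by blast
  qed
  then have "\<forall>i\<in>{..<n}. \<exists>c. c \<in> ith_class L \<alpha> i \<and> good L \<alpha> c" by simp
  then obtain c where "\<forall>i\<in>{..<n}. c i \<in> ith_class L \<alpha> i \<and> good L \<alpha> (c i)" by (rule bchoice[THEN exE])
  then have c: "\<And>i. i < n \<Longrightarrow> c i \<in> ith_class L \<alpha> i" "\<And>i. i < n \<Longrightarrow> good L \<alpha> (c i)" by simp_all
  have cL: "c i \<in> fst L" if "i < n" for i using c(1)[OF that] by (simp add: ith_class_def)
  have "\<exists>\<phi>. is_Pi (2 * \<alpha> + 1 + 1) \<phi> \<and> sentence \<phi> \<and>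
    (\<forall>N :: nat struct. is_struct N \<longrightarrow> (models N \<phi> \<longleftrightarrow> lin_order N \<and> scott L \<alpha> n c N))"
    by (rule Pi_sentence[OF Pi_scott[OF L assms(2) cL] pos_succ_ord1])
  then obtain \<phi> where \<phi>: "is_Pi (2 * \<alpha> + 1 + 1) \<phi>" "sentence \<phi>"
    "\<forall>N :: nat struct. is_struct N \<longrightarrow> (models N \<phi> \<longleftrightarrow> lin_order N \<and> scott L \<alpha> n c N)"
    by (elim exE conjE)
  have "models N \<phi> \<longleftrightarrow> isomorphic L N" if N: "is_struct N" for N :: "nat struct"
    unfolding \<phi>(3)[rule_format, OF N] isomorphic_iff_eqv
  proof
    assume N': "lin_order N \<and> scott L \<alpha> n c N"
    have "\<forall>x\<in>fst L. \<forall>y\<in>fst L. \<not> cnt L (E L \<alpha>) n x y" using n[of n] by blast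
    then show "eqv L (fst L) N (fst N)"
      by (rule eqv_sym[OF scott_eqv[OF conjunct1[OF N'] L _ c(1) conjunct2[OF N']]])
  next
    assume "eqv L (fst L) N (fst N)"
    then obtain f where f: "iso_on L (fst L) N (fst N) f" by (auto simp: eqv_def)
    have linN: "lin_order N" by (rule lin_order_transfer[OF L N f])
    show "lin_order N \<and> scott L \<alpha> n c N"
      unfolding scott_transfer[OF L linN f] using linN scott_self[OF L n c] by (rule conjI)
  qed
  then have "is_scott_sentence \<phi> L" using \<phi>(2) by (simp add: is_scott_sentence_def)
  then show ?thesis using \<phi>(1) unfolding plus_two_ord1 by (intro exI[of _ \<phi>] conjI)
qed

end
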